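(* Let $L=L_K(E)$ be the Leavitt path algebra of an arbitrary graph $E$ over an arbitrary field $K$, and let $I_1,\dots,I_m$ ($m\ge 1$) be powers of distinct prime ideals of $L$ such that the product $I_1\cdots I_m$ is irredundant. Then the prime-power ideals $I_1,\dots,I_m$ are uniquely determined by the product, up to the order in which they appear. That is, if $J_1,\dots,J_n$ ($n\ge 1$) are also powers of distinct prime ideals of $L$ such that the product $J_1\cdots J_n$ is irredundant and $I_1\cdots I_m=J_1\cdots J_n$, then $m=n$ and there is a permutation $\sigma$ of $\{1,\dots,m\}$ such that $I_i=J_{\sigma(i)}$ for all $i$.
   Context: A graph $E=(E^0,E^1,r,s)$ is a directed graph: a nonempty set $E^0$ of vertices, a set $E^1$ of edges, and range and source maps $r,s:E^1\to E^0$ (no finiteness or countability assumptions). A vertex $v$ is regular if $s^{-1}(v)$ is finite and nonempty. For a field $K$, the Leavitt path algebra $L_K(E)$ is the (associative, not necessarily unital) $K$-algebra generated by $\{v\mid v\in E^0\}\cup\{e,e^*\mid e\in E^1\}$ subject to: $vw=\delta_{v,w}v$ for $v,w\in E^0$; $s(e)e=er(e)=e$ and $r(e)e^*=e^*s(e)=e^*$ for $e\in E^1$; $e^*f=\delta_{e,f}r(e)$ for $e,f\in E^1$; and $v=\sum_{e\in s^{-1}(v)}ee^*$ for every regular $v\in E^0$. "Ideal" means two-sided ideal, and the product $IJ$ of ideals is the set of finite sums of products $ab$ with $a\in I$, $b\in J$. A prime ideal is a proper ideal $P$ such that $IJ\subseteq P$ implies $I\subseteq P$ or $J\subseteq P$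 for all ideals $I,J$. A power of a prime ideal $P$ (a prime-power ideal) is an ideal $P^r$ with $r$ a positive integer. "Powers of distinct prime ideals" means $I_i=P_i^{r_i}$ with the $P_i$ pairwise distinct primes and $r_i\ge1$. A product $J_1\cdots J_m$ of ideals is irredundant if either $m=1$ or $J_1\cdots J_m\ne J_1\cdots J_{i-1}J_{i+1}\cdots J_m$ for all $i\in\{1,\dots,m\}$. *)

theory Defs
  imports
    "HOL-Algebra.Ideal_Product"
    "HOL-Algebra.QuotRing"
    "HOL-Library.Poly_Mapping"
    "HOL-Combinatorics.Permutations"
    "Graph_Theory.Digraph"
begin

section \<open>Two-sided ideals of rings without identity\<close>

text \<open>
  The locales \<open>ring\<close>, \<open>ideal\<close> and \<open>primeideal\<close> require an identity (and \<open>primeideal\<close> also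
  commutativity), so only the record type of rings is used; its \<open>one\<close> component is ignored
  throughout. Additive subgroups and the product of two ideals, \<open>ideal_prod\<close> (the finite sums of
  products), do not involve the identity and are those of HOL-Algebra.
\<close>

definition two_sided_ideal :: "('a, 'b) ring_scheme \<Rightarrow> 'a set \<Rightarrow> bool" where
  "two_sided_ideal R I \<longleftrightarrow>
     additive_subgroup I R \<and>
     (\<forall>a\<in>I. \<forall>x\<in>carrier R. x \<otimes>\<^bsub>R\<^esub> a \<in> I \<and> a \<otimes>\<^bsub>R\<^esub> x \<in> I)"

definition prime_ideal :: "('a, 'b) ring_scheme \<Rightarrow> 'a set \<Rightarrow> bool" where
  "prime_ideal R P \<longleftrightarrow>
     two_sided_ideal R P \<and> P \<noteq> carrier R \<and>
     (\<forall>I J. two_sided_ideal R I \<and> two_sided_ideal R J \<and> ideal_prod R I J \<subseteq> P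
        \<longrightarrow> I \<subseteq> P \<or> J \<subseteq> P)"

text \<open>The value on the empty list is a mere convention; only nonempty products are used below.\<close>

fun ideal_list_prod :: "('a, 'b) ring_scheme \<Rightarrow> 'a set list \<Rightarrow> 'a set" where
  "ideal_list_prod R [] = carrier R"
| "ideal_list_prod R [I] = I"
| "ideal_list_prod R (I # J # Is) = ideal_prod R I (ideal_list_prod R (J # Is))"

definition ideal_power :: "('a, 'b) ring_scheme \<Rightarrow> 'a set \<Rightarrow> nat \<Rightarrow> 'a set" where
  "ideal_power R P r = ideal_list_prod R (replicate r P)"

definition powers_of_distinct_primes :: "('a, 'b) ring_scheme \<Rightarrow> 'a set list \<Rightarrow> bool" where
  "powers_of_distinct_primes R Is \<longleftrightarrow>
     (\<exists>Ps rs. length Ps = length Is \<and> length rs = length Is \<and> distinct Ps \<and>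
        (\<forall>i<length Is. prime_ideal R (Ps ! i) \<and> rs ! i \<ge> 1 \<and>
           Is ! i = ideal_power R (Ps ! i) (rs ! i)))"

definition irredundant_product :: "('a, 'b) ring_scheme \<Rightarrow> 'a set list \<Rightarrow> bool" where
  "irredundant_product R Is \<longleftrightarrow>
     length Is = 1 \<or>
     (\<forall>i<length Is. ideal_list_prod R Is \<noteq> ideal_list_prod R (take i Is @ drop (Suc i) Is))"


section \<open>Free algebras\<close>

text \<open>Words form a monoid under concatenation, so that the finitely supported functions
  \<open>'g word \<Rightarrow>\<^sub>0 'k\<close> with the convolution product are the noncommutative polynomials over \<open>'k\<close>.\<close>

datatype 'g word = Word (letters: "'g list")

instantiation word :: (type) monoid_add
begin

definition zero_word :: "'a word" where
  "0 = Word []"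

definition plus_word :: "'a word \<Rightarrow> 'a word \<Rightarrow> 'a word" where
  "u + v = Word (letters u @ letters v)"

instance
  by standard (simp_all add: zero_word_def plus_word_def)

end

text \<open>The free algebra without identity on \<open>X\<close>: polynomials in \<open>X\<close> with zero constant term. The
  value of \<open>one\<close> is irrelevant and does not belong to the carrier.\<close>

definition free_algebra :: "'g set \<Rightarrow> ('g word \<Rightarrow>\<^sub>0 'k::field) ring" where
  "free_algebra X =
     \<lparr> carrier = {p. \<forall>w\<in>Poly_Mapping.keys p. letters w \<noteq> [] \<and> set (letters w) \<subseteq> X},
       monoid.mult = (*), one = 1, zero = 0, add = (+) \<rparr>"

definition gen :: "'g \<Rightarrow> ('g word \<Rightarrow>\<^sub>0 'k::field)" where
  "gen x = Poly_Mapping.single (Word [x]) 1"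

text \<open>The smallest algebra ideal (two-sided ideal closed under scalars) containing \<open>S\<close>. The
  scalar \<open>c\<close> acts as multiplication by the constant polynomial \<open>single 0 c\<close>; closure under this
  is not automatic since constants are not in the carrier.\<close>

definition algebra_ideal_generated ::
    "'g set \<Rightarrow> ('g word \<Rightarrow>\<^sub>0 'k::field) set \<Rightarrow> ('g word \<Rightarrow>\<^sub>0 'k) set" where
  "algebra_ideal_generated X S =
     \<Inter>{I. two_sided_ideal (free_algebra X) I \<and>
          (\<forall>c. \<forall>p\<in>I. Poly_Mapping.single 0 c * p \<in> I) \<and> S \<subseteq> I}"


section \<open>Leavitt path algebras\<close>

text \<open>The source and range maps of a graph are \<open>tail\<close> and \<open>head\<close>.\<close>

datatype ('v, 'e) lpa_gen = Vertex 'v | Edge 'e | Ghost 'e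

definition lpa_gens :: "('v, 'e) pre_digraph \<Rightarrow> ('v, 'e) lpa_gen set" where
  "lpa_gens E = Vertex ` verts E \<union> Edge ` arcs E \<union> Ghost ` arcs E"

definition regular_vertex :: "('v, 'e) pre_digraph \<Rightarrow> 'v \<Rightarrow> bool" where
  "regular_vertex E v \<longleftrightarrow> v \<in> verts E \<and> finite (out_arcs E v) \<and> out_arcs E v \<noteq> {}"

definition lpa_relations ::
    "('v, 'e) pre_digraph \<Rightarrow> (('v, 'e) lpa_gen word \<Rightarrow>\<^sub>0 'k::field) set" where
  "lpa_relations E =
     {gen (Vertex v) * gen (Vertex w) - (if v = w then gen (Vertex v) else 0) | v w.
        v \<in> verts E \<and> w \<in> verts E} \<union>
     {gen (Vertex (tail E e)) * gen (Edge e) - gen (Edge e) | e. e \<in> arcs E} \<union>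
     {gen (Edge e) * gen (Vertex (head E e)) - gen (Edge e) | e. e \<in> arcs E} \<union>
     {gen (Vertex (head E e)) * gen (Ghost e) - gen (Ghost e) | e. e \<in> arcs E} \<union>
     {gen (Ghost e) * gen (Vertex (tail E e)) - gen (Ghost e) | e. e \<in> arcs E} \<union>
     {gen (Ghost e) * gen (Edge f) - (if e = f then gen (Vertex (head E e)) else 0) | e f.
        e \<in> arcs E \<and> f \<in> arcs E} \<union>
     {gen (Vertex v) - (\<Sum>e\<in>out_arcs E v. gen (Edge e) * gen (Ghost e)) | v.
        regular_vertex E v}"

text \<open>Only the ring structure is recorded: the scalar action plays no role for the ideals, which
  are automatically subspaces because a Leavitt path algebra has local units. The field is
  specified by the type argument.\<close>

definition leavitt_path_algebra ::
    "'k::field itself \<Rightarrow> ('v, 'e) pre_digraph \<Rightarrow> (('v, 'e) lpa_gen word \<Rightarrow>\<^sub>0 'k) set ring" where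
  "leavitt_path_algebra K E =
     free_algebra (lpa_gens E) Quot algebra_ideal_generated (lpa_gens E) (lpa_relations E)"

end

theory Submission
  imports
    Defs
    "Graph_Theory.Arc_Walk"
    "HOL-Library.Sublist"
    "HOL-Computational_Algebra.Polynomial"
begin

text \<open>
  For an ideal \<open>I\<close> of the Leavitt path algebra \<open>L\<close> let \<open>gr I\<close> be the ideal generated by the vertices
  in \<open>I\<close> and by the elements \<open>v - (\<Sum>e\<in>F. e e\<^sup>* )\<close> in \<open>I\<close>, where \<open>F\<close> is a finite set of edges leaving
  \<open>v\<close>; it is the largest graded ideal inside \<open>I\<close>. Uniqueness rests on two facts.

  First, \<open>gr I\<close> is s-unital: for \<open>x \<in> gr I\<close> there are \<open>u, u' \<in> gr I\<close> with \<open>x u = x = u' x\<close>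
  (\<open>gr_right_unit\<close>, \<open>gr_left_unit\<close>). Hence \<open>gr P\<close> lies in every power of \<open>P\<close>, and multiplying a product
  of ideals inside \<open>gr P\<close> by a power of \<open>P\<close> does not change it.

  Secondly, if an ideal \<open>Q \<subseteq> P\<close> is not contained in \<open>gr P\<close>, then modulo \<open>gr P\<close> the graph has a cycle \<open>c\<close>
  without exits at some vertex \<open>w \<notin> P\<close>, the corner \<open>w L w\<close> is the Laurent polynomial ring
  \<open>K[c, c\<^sup>-\<^sup>1]\<close>, and \<open>Q\<close> is nonzero in that corner (\<open>exitless_cycle_minimal\<close>). To find the cycle, take an
  element of \<open>Q\<close> with the fewest homogeneous components outside \<open>gr P\<close>, normalised so that its lowest
  component is a projection. Its commutators with homogeneous elements have fewer components, so its
  components are central modulo \<open>gr P\<close>. A component of positive degree that is central is a multiple of a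
  single closed path \<open>c\<close>, and centrality forces \<open>c c\<^sup>*\<close> to be the identity of the corner.

  Two properties of a prime \<open>P\<close> follow by working with polynomials in \<open>c\<close>. A prime \<open>Q\<close> strictly inside \<open>P\<close>
  lies in \<open>gr P\<close> (\<open>prime_strict_subset_gr\<close>), because a nonzero prime ideal of \<open>K[c, c\<^sup>-\<^sup>1]\<close> is maximal.
  And \<open>A P\<^sup>r B \<subseteq> P\<^sup>s\<close> with \<open>r \<le> s\<close> and ideals \<open>A, B\<close> not inside \<open>P\<close> implies \<open>P\<^sup>r = P\<^sup>s\<close>
  (\<open>prime_power_cancel\<close>), because in the corner \<open>P\<close> is generated by one prime polynomial \<open>f\<close> and
  \<open>f\<^sup>s\<close> does not divide \<open>f\<^sup>r g\<close> when \<open>r < s\<close> and \<open>f\<close> does not divide \<open>g\<close>.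

  Now let \<open>P\<^sub>1\<^sup>r ... P\<^sub>m\<^sup>s\<close> be irredundant. If \<open>P\<^sub>i \<subset> P\<^sub>j\<close>, then \<open>P\<^sub>i \<subseteq> gr P\<^sub>j\<close>, so the factor with \<open>P\<^sub>j\<close>
  could be left out; hence the primes are pairwise incomparable (\<open>prime_powers_incomparable\<close>). They are
  therefore the minimal primes over the product and determined by it, and the exponents can be
  compared by cancellation (\<open>unique_prime_powers\<close>).

  The elements of \<open>L\<close> are cosets in a free algebra. To calculate with equations rather than
  congruences, \<open>L\<close> is first identified with a subring of a ring type: if \<open>\<pi>\<close> is a linear projection with
  kernel the ideal of relations, then \<open>x\<close> is represented by the additive endomorphism
  \<open>a \<mapsto> \<pi> (x a)\<close> of the free algebra (locale \<open>algebra_quotient\<close>). The structure theory is developed for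
  any family of elements of a ring type that satisfies the relations between vertices, edges and ghost
  edges and spans a graded subring (locale \<open>graded_cohn_family\<close>).
\<close>


section \<open>Ideals inside a ring type\<close>

text \<open>The subgroup generated by \<open>X\<close> if \<open>X\<close> is closed under negation, as are all sets to which this is
  applied below.\<close>

inductive_set aspan :: "'r::ring set \<Rightarrow> 'r set" for X where
  zero: "0 \<in> aspan X"
| plus: "x \<in> X \<Longrightarrow> y \<in> aspan X \<Longrightarrow> x + y \<in> aspan X"

lemma aspan_base: "x \<in> X \<Longrightarrow> x \<in> aspan X"
  using aspan.plus[OF _ aspan.zero, of x X] by simp

lemma aspan_add: "x \<in> aspan X \<Longrightarrow> y \<in> aspan X \<Longrightarrow> x + y \<in> aspan X"
  by (induction x rule: aspan.induct) (auto simp: add.assoc intro: aspan.plus)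

lemma aspan_uminus:
  assumes "\<And>x. x \<in> X \<Longrightarrow> - x \<in> X" "x \<in> aspan X" shows "- x \<in> aspan X"
  using assms(2)
proof (induction x rule: aspan.induct)
  case (plus x y)
  then show ?case using aspan_add[OF aspan_base[OF assms(1)[OF plus(1)]], of "- y"]
    by (simp add: add.commute)
qed (simp add: aspan.zero)

lemma aspan_diff:
  assumes "\<And>x. x \<in> X \<Longrightarrow> - x \<in> X" "x \<in> aspan X" "y \<in> aspan X" shows "x - y \<in> aspan X"
  using aspan_add[OF assms(2) aspan_uminus[OF assms(1) assms(3)]] by simp

lemma aspan_subset:
  assumes "0 \<in> A" "\<And>x y. x \<in> X \<Longrightarrow> y \<in> A \<Longrightarrow> x + y \<in> A" shows "aspan X \<subseteq> A"
proof
  fix x assume "x \<in> aspan X"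
  then show "x \<in> A" by (induction x rule: aspan.induct) (auto intro: assms)
qed

lemma aspan_mono: "X \<subseteq> Y \<Longrightarrow> aspan X \<subseteq> aspan Y"
  by (rule aspan_subset) (auto intro: aspan.zero aspan.plus)

lemma aspan_lmult:
  assumes "x \<in> aspan X" "\<And>x. x \<in> X \<Longrightarrow> a * x \<in> aspan Y" shows "a * x \<in> aspan Y"
  using assms(1)
proof (induction x rule: aspan.induct)
  case (plus x y)
  then show ?case using aspan_add[OF assms(2)] by (simp add: distrib_left)
qed (simp add: aspan.zero)

lemma aspan_rmult:
  assumes "x \<in> aspan X" "\<And>x. x \<in> X \<Longrightarrow> x * a \<in> aspan Y" shows "x * a \<in> aspan Y"
  using assms(1)
proof (induction x rule: aspan.induct)
  case (plus x y)
  then show ?case using aspan_add[OF assms(2)] by (simp add: distrib_right)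
qed (simp add: aspan.zero)

definition ideal_in :: "'r::ring set \<Rightarrow> 'r set \<Rightarrow> bool" where
  "ideal_in S I \<longleftrightarrow> I \<subseteq> S \<and> 0 \<in> I \<and> (\<forall>x\<in>I. \<forall>y\<in>I. x - y \<in> I) \<and>
     (\<forall>x\<in>I. \<forall>s\<in>S. s * x \<in> I \<and> x * s \<in> I)"

lemma ideal_inD:
  assumes "ideal_in S I"
  shows "I \<subseteq> S" "0 \<in> I" "x \<in> I \<Longrightarrow> y \<in> I \<Longrightarrow> x - y \<in> I" "x \<in> I \<Longrightarrow> s \<in> S \<Longrightarrow> s * x \<in> I"
    "x \<in> I \<Longrightarrow> s \<in> S \<Longrightarrow> x * s \<in> I"
  using assms unfolding ideal_in_def by auto

lemma ideal_in_uminus: "ideal_in S I \<Longrightarrow> x \<in> I \<Longrightarrow> - x \<in> I"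
  using ideal_inD(3)[of S I 0 x] ideal_inD(2)[of S I] by simp

lemma ideal_in_add: "ideal_in S I \<Longrightarrow> x \<in> I \<Longrightarrow> y \<in> I \<Longrightarrow> x + y \<in> I"
  using ideal_inD(3)[of S I x "- y"] ideal_in_uminus[of S I y] by simp

lemma ideal_in_sum: "ideal_in S I \<Longrightarrow> (\<And>i. i \<in> A \<Longrightarrow> f i \<in> I) \<Longrightarrow> sum f A \<in> I"
  by (induction A rule: infinite_finite_induct) (auto simp: ideal_inD(2) ideal_in_add)

lemma ideal_in_diff_cancel:
  assumes "ideal_in S I" "x - y \<in> I" shows "x \<in> I \<longleftrightarrow> y \<in> I"
  using ideal_in_add[OF assms(1,2), of y] ideal_inD(3)[OF assms(1) _ assms(2), of x] by auto

lemma ideal_in_aspan_subset: "ideal_in S I \<Longrightarrow> X \<subseteq> I \<Longrightarrow> aspan X \<subseteq> I"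
  by (rule aspan_subset) (auto simp: ideal_inD(2) ideal_in_add)

lemma aspan_ideal:
  assumes "aspan X \<subseteq> S" "\<And>x. x \<in> X \<Longrightarrow> - x \<in> X"
    and "\<And>x s. x \<in> X \<Longrightarrow> s \<in> S \<Longrightarrow> s * x \<in> X" "\<And>x s. x \<in> X \<Longrightarrow> s \<in> S \<Longrightarrow> x * s \<in> X"
  shows "ideal_in S (aspan X)"
  unfolding ideal_in_def
proof (intro conjI ballI)
  show "x - y \<in> aspan X" if "x \<in> aspan X" "y \<in> aspan X" for x y
    by (rule aspan_diff[OF assms(2) that])
  show "s * x \<in> aspan X" if "x \<in> aspan X" "s \<in> S" for x s
    by (rule aspan_lmult[OF that(1) aspan_base[OF assms(3)[OF _ that(2)]]])
  show "x * s \<in> aspan X" if "x \<in> aspan X" "s \<in> S" for x s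
    by (rule aspan_rmult[OF that(1) aspan_base[OF assms(4)[OF _ that(2)]]])
qed (fact assms(1), rule aspan.zero)

text \<open>Primeness tested on elements. With local units it follows from the definition in terms of
  ideals, and it is the only form in which primeness of a given ideal is used below.\<close>

definition prime_in :: "'r::ring set \<Rightarrow> 'r set \<Rightarrow> bool" where
  "prime_in S P \<longleftrightarrow> ideal_in S P \<and> P \<noteq> S \<and>
     (\<forall>a\<in>S. \<forall>b\<in>S. (\<forall>s\<in>S. a * s * b \<in> P) \<longrightarrow> a \<in> P \<or> b \<in> P)"

lemma prime_inD:
  assumes "prime_in S P"
  shows "ideal_in S P" "P \<noteq> S"
    "a \<in> S \<Longrightarrow> b \<in> S \<Longrightarrow> (\<And>s. s \<in> S \<Longrightarrow> a * s * b \<in> P) \<Longrightarrow> a \<in> P \<or> b \<in> P"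
  using assms unfolding prime_in_def by auto

section \<open>Walks and monomials\<close>

text \<open>The relations between vertices, edges and ghost edges of a Leavitt path algebra. Scalars enter as ring
  elements \<open>sc k\<close> that commute with the generators, so that the ambient type need only be a ring.\<close>

locale cohn_family = wf_digraph E for E :: "('v, 'e) pre_digraph" +
  fixes V :: "'v \<Rightarrow> 'r::ring" and Ed Gh :: "'e \<Rightarrow> 'r" and sc :: "'k::field \<Rightarrow> 'r"
  assumes V_V: "v \<in> verts E \<Longrightarrow> w \<in> verts E \<Longrightarrow> V v * V w = (if v = w then V v else 0)"
    and V_Ed: "e \<in> arcs E \<Longrightarrow> V (tail E e) * Ed e = Ed e"
    and Ed_V: "e \<in> arcs E \<Longrightarrow> Ed e * V (head E e) = Ed e"
    and V_Gh: "e \<in> arcs E \<Longrightarrow> V (head E e) * Gh e = Gh e"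
    and Gh_V: "e \<in> arcs E \<Longrightarrow> Gh e * V (tail E e) = Gh e"
    and Gh_Ed: "e \<in> arcs E \<Longrightarrow> f \<in> arcs E \<Longrightarrow> Gh e * Ed f = (if e = f then V (head E e) else 0)"
    and sc_add: "sc (a + b) = sc a + sc b"
    and sc_mult: "sc (a * b) = sc a * sc b"
    and sc_one_V: "v \<in> verts E \<Longrightarrow> sc 1 * V v = V v"
    and sc_V: "v \<in> verts E \<Longrightarrow> sc a * V v = V v * sc a"
    and sc_Ed: "e \<in> arcs E \<Longrightarrow> sc a * Ed e = Ed e * sc a"
    and sc_Gh: "e \<in> arcs E \<Longrightarrow> sc a * Gh e = Gh e * sc a"
begin

lemma sc_0 [simp]: "sc 0 = 0"
  using sc_add[of 0 0] by simp

lemma sc_uminus: "sc (- a) = - sc a"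
  using sc_add[of a "- a"] by (simp add: eq_neg_iff_add_eq_0 add.commute)

text \<open>The element of a walk, and of its ghost. A walk is a list of edges; the start vertex is a separate
  argument because it cannot be read off the empty list.\<close>

primrec pth :: "'v \<Rightarrow> 'e list \<Rightarrow> 'r" where
  "pth u [] = V u"
| "pth u (e # p) = Ed e * pth (head E e) p"

primrec gst :: "'v \<Rightarrow> 'e list \<Rightarrow> 'r" where
  "gst u [] = V u"
| "gst u (e # p) = gst (head E e) p * Gh e"

lemma awalk_verts: "awalk u p v \<Longrightarrow> u \<in> verts E" "awalk u p v \<Longrightarrow> v \<in> verts E"
  by (auto simp: awalk_def dest: awlast_in_verts) (metis awalkI awalk_def awalk_last_in_verts)+

lemma pth_V: "awalk u p v \<Longrightarrow> pth u p * V v = pth u p"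
  by (induction p arbitrary: u) (auto simp: awalk_Cons_iff awalk_Nil_iff V_V mult.assoc)

lemma V_pth: "awalk u p v \<Longrightarrow> V u * pth u p = pth u p"
  by (cases p) (auto simp: awalk_Cons_iff awalk_Nil_iff V_V V_Ed simp flip: mult.assoc)

lemma V_gst: "awalk u p v \<Longrightarrow> V v * gst u p = gst u p"
  by (induction p arbitrary: u) (auto simp: awalk_Cons_iff awalk_Nil_iff V_V simp flip: mult.assoc)

lemma gst_V: "awalk u p v \<Longrightarrow> gst u p * V u = gst u p"
  by (cases p) (auto simp: awalk_Cons_iff awalk_Nil_iff V_V Gh_V mult.assoc)

lemma pth_append: "awalk u p v \<Longrightarrow> awalk v q w \<Longrightarrow> pth u (p @ q) = pth u p * pth v q"
  by (induction p arbitrary: u) (auto simp: awalk_Cons_iff awalk_Nil_iff V_pth mult.assoc)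

lemma gst_append: "awalk u p v \<Longrightarrow> awalk v q w \<Longrightarrow> gst u (p @ q) = gst v q * gst u p"
  by (induction p arbitrary: u) (auto simp: awalk_Cons_iff awalk_Nil_iff gst_V mult.assoc)

lemma gst_pth_same: "awalk u p v \<Longrightarrow> gst u p * pth u p = V v"
proof (induction p arbitrary: u)
  case (Cons e p)
  then have e: "e \<in> arcs E" "u = tail E e" and p: "awalk (head E e) p v"
    by (auto simp: awalk_Cons_iff)
  have "gst u (e # p) * pth u (e # p) = gst (head E e) p * (Gh e * Ed e) * pth (head E e) p"
    by (simp add: mult.assoc)
  also have "\<dots> = V v" using e p Cons.IH[OF p] gst_V[OF p] by (simp add: Gh_Ed)
  finally show ?case .
qed (auto simp: awalk_Nil_iff V_V)

lemma V_pth_0: "awalk u p v \<Longrightarrow> w \<in> verts E \<Longrightarrow> w \<noteq> u \<Longrightarrow> V w * pth u p = 0"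
  using V_pth[of u p v] V_V[of w u] awalk_verts(1)[of u p v]
  by (metis (no_types, lifting) mult.assoc mult_zero_left)

lemma gst_V_0: "awalk u p v \<Longrightarrow> w \<in> verts E \<Longrightarrow> w \<noteq> u \<Longrightarrow> gst u p * V w = 0"
  using gst_V[of u p v] V_V[of u w] awalk_verts(1)[of u p v]
  by (metis (no_types, lifting) mult.assoc mult_zero_right)

text \<open>Cancelling equal edges from the front leaves the rest of the longer walk, unless the walks diverge.\<close>

lemma gst_pth_cases:
  assumes "awalk u p v" "awalk u' q w"
  shows "(\<exists>t. u = u' \<and> q = p @ t \<and> awalk v t w \<and> gst u p * pth u' q = pth v t) \<or>
         (\<exists>t. u = u' \<and> p = q @ t \<and> t \<noteq> [] \<and> awalk w t v \<and> gst u p * pth u' q = gst w t) \<or>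
         (\<not> (u = u' \<and> (prefix p q \<or> prefix q p)) \<and> gst u p * pth u' q = 0)"
  using assms
proof (induction p arbitrary: u u' q)
  case Nil
  then show ?case using V_pth V_pth_0 by (cases "u = u'") (auto simp: awalk_Nil_iff)
next
  case (Cons e p)
  note e = Cons.prems(1)[unfolded awalk_Cons_iff]
  show ?case
  proof (cases q)
    case Nil
    then show ?thesis using Cons.prems gst_V[OF Cons.prems(1)] gst_V_0[OF Cons.prems(1), of u']
      by (cases "u = u'") (auto simp: awalk_Nil_iff)
  next
    case (Cons f q')
    note f = Cons.prems(2)[unfolded Cons awalk_Cons_iff]
    have eq: "gst u (e # p) * pth u' q = gst (head E e) p * (Gh e * Ed f) * pth (head E f) q'"
      by (simp add: mult.assoc Cons)
    show ?thesis
    proof (cases "e = f")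
      case True
      have eq': "gst u (e # p) * pth u' q = gst (head E e) p * pth (head E e) q'"
        using eq e f True gst_V[of "head E e" p v] by (simp add: Gh_Ed)
      show ?thesis using Cons.IH[of "head E e" "head E e" q'] e f True Cons unfolding eq' by auto
    next
      case False
      then show ?thesis using eq e f Cons by (simp add: Gh_Ed)
    qed
  qed
qed

lemma sc_pth: "awalk u p v \<Longrightarrow> sc a * pth u p = pth u p * sc a"
proof (induction p arbitrary: u)
  case (Cons e p)
  then show ?case by (simp add: awalk_Cons_iff) (metis mult.assoc sc_Ed)
qed (auto simp: awalk_Nil_iff sc_V)

lemma sc_gst: "awalk u p v \<Longrightarrow> sc a * gst u p = gst u p * sc a"
proof (induction p arbitrary: u)
  case (Cons e p)
  then show ?case by (simp add: awalk_Cons_iff) (metis mult.assoc sc_Gh)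
qed (auto simp: awalk_Nil_iff sc_V)

definition monomials :: "'r set" where
  "monomials = {sc k * (pth u p * gst v q) | k u p v q w. awalk u p w \<and> awalk v q w}"

definition S :: "'r set" where "S = aspan monomials"

lemma monomialsI: "awalk u p w \<Longrightarrow> awalk v q w \<Longrightarrow> sc k * (pth u p * gst v q) \<in> monomials"
  unfolding monomials_def by blast

lemma uminus_monomials: "x \<in> monomials \<Longrightarrow> - x \<in> monomials"
  unfolding monomials_def by clarify (metis mult_minus_left sc_uminus)

lemma S_add: "x \<in> S \<Longrightarrow> y \<in> S \<Longrightarrow> x + y \<in> S" unfolding S_def by (rule aspan_add)
lemma S_diff: "x \<in> S \<Longrightarrow> y \<in> S \<Longrightarrow> x - y \<in> S"
  unfolding S_def by (rule aspan_diff[OF uminus_monomials])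
lemma S_0: "0 \<in> S" unfolding S_def by (rule aspan.zero)
lemma S_uminus: "x \<in> S \<Longrightarrow> - x \<in> S" using S_diff[OF S_0] by simp
lemma S_sum: "(\<And>i. i \<in> A \<Longrightarrow> f i \<in> S) \<Longrightarrow> sum f A \<in> S"
  by (induction A rule: infinite_finite_induct) (auto simp: S_0 S_add)

lemma sc_one_pth: "awalk u p v \<Longrightarrow> sc 1 * pth u p = pth u p"
  using V_pth[of u p v] sc_one_V[of u] awalk_verts(1)[of u p v] by (metis mult.assoc)

lemma pth_gst_S: "awalk u p w \<Longrightarrow> awalk v q w \<Longrightarrow> pth u p * gst v q \<in> S"
  using aspan_base[OF monomialsI[of u p w v q 1]] by (simp add: S_def mult.assoc[symmetric] sc_one_pth)

lemma pth_S: "awalk u p v \<Longrightarrow> pth u p \<in> S"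
  using pth_gst_S[of u p v v "[]"] by (simp add: awalk_Nil_iff awalk_verts pth_V)

lemma gst_S: "awalk u p v \<Longrightarrow> gst u p \<in> S"
  using pth_gst_S[of v "[]" v u p] by (simp add: awalk_Nil_iff awalk_verts V_gst)

lemma V_S: "v \<in> verts E \<Longrightarrow> V v \<in> S"
  using pth_S[of v "[]" v] by (simp add: awalk_Nil_iff)
lemma Ed_S: "e \<in> arcs E \<Longrightarrow> Ed e \<in> S"
  using pth_S[of "tail E e" "[e]" "head E e"] by (simp add: awalk_Cons_iff awalk_Nil_iff Ed_V)
lemma Gh_S: "e \<in> arcs E \<Longrightarrow> Gh e \<in> S"
  using gst_S[of "tail E e" "[e]" "head E e"] by (simp add: awalk_Cons_iff awalk_Nil_iff V_Gh)

lemma sc_comm: "sc a * sc b = sc b * sc a"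
  by (metis sc_mult mult.commute)

lemma monomials_comm: "x \<in> monomials \<Longrightarrow> sc a * x = x * sc a"
  unfolding monomials_def
proof clarify
  fix k u p v q w assume "awalk u p w" "awalk v q w"
  have "sc a * (sc k * (pth u p * gst v q)) = sc k * ((sc a * pth u p) * gst v q)"
    using sc_comm[of a k] by (simp add: mult.assoc[symmetric])
  also have "\<dots> = sc k * (pth u p * (sc a * gst v q))"
    unfolding sc_pth[OF \<open>awalk u p w\<close>] by (simp add: mult.assoc)
  also have "\<dots> = sc k * (pth u p * gst v q) * sc a"
    unfolding sc_gst[OF \<open>awalk v q w\<close>] by (simp add: mult.assoc)
  finally show "sc a * (sc k * (pth u p * gst v q)) = sc k * (pth u p * gst v q) * sc a" .
qed

lemma S_comm: "x \<in> S \<Longrightarrow> sc a * x = x * sc a"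
  unfolding S_def by (induction x rule: aspan.induct) (auto simp: monomials_comm algebra_simps)

lemma monomials_one: "x \<in> monomials \<Longrightarrow> sc 1 * x = x"
  unfolding monomials_def by clarify (metis mult.assoc mult_1 sc_mult)

lemma S_one: "x \<in> S \<Longrightarrow> sc 1 * x = x"
  unfolding S_def by (induction x rule: aspan.induct) (auto simp: monomials_one algebra_simps)

lemma sc_monomials: "x \<in> monomials \<Longrightarrow> sc a * x \<in> monomials"
  unfolding monomials_def by clarify (metis mult.assoc sc_mult)

lemma sc_S: "x \<in> S \<Longrightarrow> sc a * x \<in> S"
  unfolding S_def by (rule aspan_lmult) (auto intro: aspan_base sc_monomials)

lemma pth_gst_pth_gst:
  assumes "awalk u p w" "awalk v q w" "awalk u' p' w'" "awalk v' q' w'"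
  shows "pth u p * gst v q * (pth u' p' * gst v' q') = 0 \<or>
    (\<exists>a b z. pth u p * gst v q * (pth u' p' * gst v' q') = pth u a * gst v' b \<and> awalk u a z \<and> awalk v' b z \<and>
       int (length a) - int (length b) =
         int (length p) - int (length q) + (int (length p') - int (length q')))"
proof -
  have eq: "pth u p * gst v q * (pth u' p' * gst v' q') = pth u p * (gst v q * pth u' p') * gst v' q'"
    by (simp add: mult.assoc)
  from gst_pth_cases[OF assms(2,3)] show ?thesis
  proof (elim disjE exE conjE)
    fix t assume t: "p' = q @ t" "awalk w t w'" "gst v q * pth u' p' = pth w t"
    have "pth u p * gst v q * (pth u' p' * gst v' q') = pth u (p @ t) * gst v' q'"
      unfolding eq t(3) using pth_append[OF assms(1) t(2)] by simp
    moreover have "awalk u (p @ t) w'" using awalk_appendI[OF assms(1) t(2)] .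
    ultimately show ?thesis using assms(4) t(1)
      by (intro disjI2 exI[of _ "p @ t"] exI[of _ q'] exI[of _ w']) simp
  next
    fix t assume t: "q = p' @ t" "awalk w' t w" "gst v q * pth u' p' = gst w' t"
    have "pth u p * gst v q * (pth u' p' * gst v' q') = pth u p * gst v' (q' @ t)"
      unfolding eq t(3) using gst_append[OF assms(4) t(2)] by (simp add: mult.assoc)
    moreover have "awalk v' (q' @ t) w" using awalk_appendI[OF assms(4) t(2)] .
    ultimately show ?thesis using assms(1) t(1)
      by (intro disjI2 exI[of _ p] exI[of _ "q' @ t"] exI[of _ w]) simp
  qed (simp add: eq)
qed

definition hmonomials :: "int \<Rightarrow> 'r set" where
  "hmonomials n = {sc k * (pth u p * gst v q) | k u p v q w. awalk u p w \<and> awalk v q w \<and>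
     n = int (length p) - int (length q)}"

definition hom_part :: "int \<Rightarrow> 'r set" where "hom_part n = aspan (hmonomials n)"

lemma uminus_hmonomials: "x \<in> hmonomials n \<Longrightarrow> - x \<in> hmonomials n"
  unfolding hmonomials_def by clarify (metis mult_minus_left sc_uminus)

lemma hmonomials_mult:
  assumes "x \<in> hmonomials m" "y \<in> hmonomials n" shows "x * y \<in> insert 0 (hmonomials (m + n))"
proof -
  from assms(1) obtain k u p v q w where x: "x = sc k * (pth u p * gst v q)" "awalk u p w" "awalk v q w"
    "m = int (length p) - int (length q)" unfolding hmonomials_def by blast
  from assms(2) obtain k' u' p' v' q' w' where y: "y = sc k' * (pth u' p' * gst v' q')" 
    "awalk u' p' w'" "awalk v' q' w'" "n = int (length p') - int (length q')"
    unfolding hmonomials_def by blast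
  have c: "(pth u p * gst v q) * sc k' = sc k' * (pth u p * gst v q)"
    using S_comm[OF pth_gst_S[OF x(2,3)]] by simp
  have "x * y = sc k * ((pth u p * gst v q) * sc k') * (pth u' p' * gst v' q')"
    unfolding x(1) y(1) by (simp add: mult.assoc)
  also have "\<dots> = sc (k * k') * (pth u p * gst v q * (pth u' p' * gst v' q'))"
    unfolding c sc_mult by (simp add: mult.assoc)
  finally have eq: "x * y = \<dots>" .
  from pth_gst_pth_gst[OF x(2,3) y(2,3)] show ?thesis
  proof (elim disjE exE conjE)
    fix a b z assume *: "pth u p * gst v q * (pth u' p' * gst v' q') = pth u a * gst v' b"
      "awalk u a z" "awalk v' b z" "int (length a) - int (length b) =
       int (length p) - int (length q) + (int (length p') - int (length q'))"
    show ?thesis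
      unfolding eq *(1) hmonomials_def x(4) y(4) using *(2,3) *(4)[symmetric] by blast
  qed (simp add: eq)
qed

end

context cohn_family
begin

lemma monomials_UN: "monomials = (\<Union>n. hmonomials n)"
proof (rule equalityI; rule subsetI)
  fix x assume "x \<in> monomials"
  then obtain k u p v q w where "x = sc k * (pth u p * gst v q)" "awalk u p w" "awalk v q w"
    unfolding monomials_def by blast
  then have "x \<in> hmonomials (int (length p) - int (length q))" unfolding hmonomials_def by blast
  then show "x \<in> (\<Union>n. hmonomials n)" by blast
next
  fix x assume "x \<in> (\<Union>n. hmonomials n)"
  then obtain n where "x \<in> hmonomials n" by blast
  then obtain k u p v q w where "x = sc k * (pth u p * gst v q)" "awalk u p w" "awalk v q w"
    unfolding hmonomials_def by blast
  then show "x \<in> monomials" using monomialsI by simp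
qed

lemma hmonomials_S: "x \<in> hmonomials n \<Longrightarrow> x \<in> S"
  unfolding S_def monomials_UN by (rule aspan_base, rule UN_I[OF UNIV_I])

lemma hom_part_S: "x \<in> hom_part n \<Longrightarrow> x \<in> S"
  unfolding hom_part_def S_def monomials_UN by (erule subsetD[OF aspan_mono, rotated], rule UN_upper, rule UNIV_I)

lemma hom_part_mult:
  assumes "x \<in> hom_part m" "y \<in> hom_part n" shows "x * y \<in> hom_part (m + n)"
proof -
  have "x * b \<in> hom_part (m + n)" if "b \<in> hmonomials n" for b
    using assms(1) unfolding hom_part_def 
  proof (rule aspan_rmult)
    fix x assume "x \<in> hmonomials m"
    from hmonomials_mult[OF this that] show "x * b \<in> aspan (hmonomials (m + n))"
      by (elim insertE) (simp add: aspan.zero, rule aspan_base)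
  qed
  with assms(2) show ?thesis unfolding hom_part_def by (rule aspan_lmult)
qed

lemma S_mult:
  assumes "x \<in> S" "y \<in> S" shows "x * y \<in> S"
proof -
  have *: "a * b \<in> S" if ab: "a \<in> monomials" "b \<in> monomials" for a b
  proof -
    obtain m n where "a \<in> hmonomials m" "b \<in> hmonomials n" using ab by (auto simp: monomials_UN)
    then have "a * b \<in> insert 0 (hmonomials (m + n))" by (rule hmonomials_mult)
    then show ?thesis using hmonomials_S S_0 by auto
  qed
  have "x * b \<in> S" if "b \<in> monomials" for b
    using assms(1) *[OF _ that] unfolding S_def by (rule aspan_rmult)
  with assms(2) show ?thesis unfolding S_def by (rule aspan_lmult)
qed

lemma ideal_in_S: "ideal_in S S"
  unfolding ideal_in_def using S_0 S_diff S_mult by auto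

lemma sc_ideal: 
  assumes "ideal_in S I" "x \<in> I" "x = x * u" "u \<in> S" shows "sc k * x \<in> I"
proof -
  have "x \<in> S" using ideal_inD(1)[OF assms(1)] assms(2) by blast
  have "sc k * x = (sc k * x) * u" by (subst (1) assms(3)) (rule mult.assoc[symmetric])
  then have "sc k * x = x * (sc k * u)" unfolding S_comm[OF \<open>x \<in> S\<close>] by (simp only: mult.assoc)
  then show ?thesis using ideal_inD(5)[OF assms(1,2) sc_S[OF assms(4)]] by simp
qed

section \<open>Local units\<close>

lemma monomial_V:
  assumes "awalk u p w" "awalk v q w" "finite W" "W \<subseteq> verts E"
  shows "u \<in> W \<Longrightarrow> (\<Sum>w\<in>W. V w) * (sc k * (pth u p * gst v q)) = sc k * (pth u p * gst v q)"
    and "v \<in> W \<Longrightarrow> sc k * (pth u p * gst v q) * (\<Sum>w\<in>W. V w) = sc k * (pth u p * gst v q)"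
proof -
  assume "u \<in> W"
  have "(\<Sum>w\<in>W. V w) * pth u p = (\<Sum>w\<in>W. if w = u then pth u p else 0)"
    unfolding sum_distrib_right using V_pth[OF assms(1)] V_pth_0[OF assms(1)] assms(4)
    by (intro sum.cong) auto
  then have *: "(\<Sum>w\<in>W. V w) * pth u p = pth u p" using assms \<open>u \<in> W\<close> by simp
  have c: "(\<Sum>w\<in>W. V w) * sc k = sc k * (\<Sum>w\<in>W. V w)"
    by (rule S_comm[symmetric], rule S_sum, rule V_S, rule subsetD[OF assms(4)])
  have "(\<Sum>w\<in>W. V w) * (sc k * (pth u p * gst v q)) = ((\<Sum>w\<in>W. V w) * sc k) * pth u p * gst v q"
    by (simp only: mult.assoc)
  also have "\<dots> = sc k * ((\<Sum>w\<in>W. V w) * pth u p) * gst v q" unfolding c by (simp only: mult.assoc)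
  also have "\<dots> = sc k * (pth u p * gst v q)" unfolding * by (simp only: mult.assoc)
  finally show "(\<Sum>w\<in>W. V w) * (sc k * (pth u p * gst v q)) = sc k * (pth u p * gst v q)" .
next
  assume "v \<in> W"
  have "gst v q * (\<Sum>w\<in>W. V w) = (\<Sum>w\<in>W. if w = v then gst v q else 0)"
    unfolding sum_distrib_left using gst_V[OF assms(2)] gst_V_0[OF assms(2)] assms(4)
    by (intro sum.cong) auto
  then have *: "gst v q * (\<Sum>w\<in>W. V w) = gst v q" using assms \<open>v \<in> W\<close> by simp
  then show "sc k * (pth u p * gst v q) * (\<Sum>w\<in>W. V w) = sc k * (pth u p * gst v q)"
    by (simp only: mult.assoc)
qed

text \<open>A sum of vertices, taken over any finite set that contains the sources of the paths that
  occur in an element, is an identity for that element.\<close>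

lemma S_local_unit_ex:
  assumes "x \<in> S"
  shows "\<exists>W. finite W \<and> W \<subseteq> verts E \<and> (\<forall>W'. finite W' \<and> W \<subseteq> W' \<and> W' \<subseteq> verts E \<longrightarrow>
    (\<Sum>w\<in>W'. V w) * x = x \<and> x * (\<Sum>w\<in>W'. V w) = x)"
  using assms unfolding S_def
proof (induction x rule: aspan.induct)
  case (plus x y)
  from plus.IH obtain W where W: "finite W" "W \<subseteq> verts E"
    "\<forall>W'. finite W' \<and> W \<subseteq> W' \<and> W' \<subseteq> verts E \<longrightarrow> (\<Sum>w\<in>W'. V w) * y = y \<and> y * (\<Sum>w\<in>W'. V w) = y"
    by (elim exE conjE)
  from plus.hyps obtain k u p v q w where x: "x = sc k * (pth u p * gst v q)" "awalk u p w" "awalk v q w"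
    unfolding monomials_def by blast
  show ?case
  proof (rule exI[of _ "insert u (insert v W)"], intro conjI allI impI)
    show "finite (insert u (insert v W))" using W(1) by simp
    show "insert u (insert v W) \<subseteq> verts E"
      using W(2) awalk_verts(1)[OF x(2)] awalk_verts(1)[OF x(3)] by simp
    fix W' assume W': "finite W' \<and> insert u (insert v W) \<subseteq> W' \<and> W' \<subseteq> verts E"
    then have y: "(\<Sum>w\<in>W'. V w) * y = y" "y * (\<Sum>w\<in>W'. V w) = y" using W(3) by simp_all
    from W' have "(\<Sum>w\<in>W'. V w) * x = x" "x * (\<Sum>w\<in>W'. V w) = x"
      unfolding x(1) using monomial_V[OF x(2,3), of W' k] by simp_all
    with y show "(\<Sum>w\<in>W'. V w) * (x + y) = x + y" "(x + y) * (\<Sum>w\<in>W'. V w) = x + y"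
      by (simp_all only: distrib_left distrib_right)
  qed
next
  case zero
  show ?case by (rule exI[of _ "{}"]) simp
qed

lemma S_local_unit:
  assumes "x \<in> S"
  obtains W where "finite W" "W \<subseteq> verts E" "(\<Sum>w\<in>W. V w) * x = x" "x * (\<Sum>w\<in>W. V w) = x"
  using S_local_unit_ex[OF assms] by (elim exE conjE) (simp add: that)

text \<open>Ideals are subspaces: a local unit takes the scalar into the algebra.\<close>

lemma sc_in_ideal:
  assumes "ideal_in S I" "x \<in> I" shows "sc k * x \<in> I"
proof -
  have "x \<in> S" using ideal_inD(1)[OF assms(1)] assms(2) by blast
  then obtain W where W: "W \<subseteq> verts E" "x * (\<Sum>w\<in>W. V w) = x" by (metis S_local_unit)
  show ?thesis
    by (rule sc_ideal[OF assms W(2)[symmetric]], rule S_sum, rule V_S, rule subsetD[OF W(1)])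
qed

lemma ex_right_vertex:
  assumes "ideal_in S I" "x \<in> S" "x \<notin> I" shows "\<exists>w\<in>verts E. x * V w \<notin> I"
proof (rule ccontr)
  assume *: "\<not> ?thesis"
  obtain W where W: "W \<subseteq> verts E" "x * (\<Sum>w\<in>W. V w) = x" using S_local_unit[OF assms(2)] by metis
  have "x * (\<Sum>w\<in>W. V w) \<in> I" unfolding sum_distrib_left
  proof (rule ideal_in_sum[OF assms(1)])
    fix w assume "w \<in> W"
    then show "x * V w \<in> I" using * W(1) by (metis subsetD)
  qed
  then show False using W(2) assms(3) by simp
qed

lemma ideal_generated_by:
  assumes "a \<in> S"
  shows "ideal_in S (aspan {x * a * y | x y. x \<in> S \<and> y \<in> S})" "a \<in> aspan {x * a * y | x y. x \<in> S \<and> y \<in> S}"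
proof -
  let ?X = "{x * a * y | x y. x \<in> S \<and> y \<in> S}"
  obtain W where W: "W \<subseteq> verts E" "(\<Sum>w\<in>W. V w) * a = a" "a * (\<Sum>w\<in>W. V w) = a"
    using S_local_unit[OF assms] by metis
  have "(\<Sum>w\<in>W. V w) \<in> S" by (rule S_sum, rule V_S, rule subsetD[OF W(1)])
  then have "(\<Sum>w\<in>W. V w) * a * (\<Sum>w\<in>W. V w) \<in> aspan ?X" by (intro aspan_base) blast
  then show "a \<in> aspan ?X" using W(2,3) by simp
  show "ideal_in S (aspan ?X)"
  proof (rule aspan_ideal)
    show "aspan ?X \<subseteq> S" by (rule ideal_in_aspan_subset[OF ideal_in_S]) (auto intro: S_mult assms)
    fix x assume "x \<in> ?X"
    then obtain b d where bd: "x = b * a * d" "b \<in> S" "d \<in> S" by auto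
    have "- x = (- b) * a * d" by (simp add: bd(1))
    then show "- x \<in> ?X" using S_uminus[OF bd(2)] bd(3) by blast
    fix s assume s: "s \<in> S"
    have "s * x = (s * b) * a * d" "x * s = b * a * (d * s)" by (simp_all add: bd(1) mult.assoc)
    then show "s * x \<in> ?X" "x * s \<in> ?X" using S_mult[OF s bd(2)] S_mult[OF bd(3) s] bd(2,3) by blast+
  qed
qed

section \<open>The graded part of an ideal\<close>

text \<open>The projection onto the walks from \<open>w\<close> that do not begin with an edge in \<open>F\<close>. A vertex is the case
  \<open>F = {}\<close>; the other ones in an ideal account for its breaking vertices.\<close>

definition eps :: "'v \<Rightarrow> 'e set \<Rightarrow> 'r" where "eps w F = V w - (\<Sum>e\<in>F. Ed e * Gh e)"

definition adm :: "'v \<Rightarrow> 'e set \<Rightarrow> bool" where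
  "adm w F \<longleftrightarrow> w \<in> verts E \<and> finite F \<and> F \<subseteq> out_arcs E w"

lemma eps_empty [simp]: "eps w {} = V w" by (simp add: eps_def)
lemma adm_empty [simp]: "adm w {} \<longleftrightarrow> w \<in> verts E" by (simp add: adm_def)

lemma Ed_Gh_S: "e \<in> arcs E \<Longrightarrow> Ed e * Gh e \<in> S" by (simp add: S_mult Ed_S Gh_S)

lemma eps_S: "adm w F \<Longrightarrow> eps w F \<in> S"
  unfolding eps_def adm_def
  by (intro S_diff V_S S_sum Ed_Gh_S) (simp, metis in_out_arcs_conv subsetD)

lemma adm_Int: "adm w F \<Longrightarrow> adm w F' \<Longrightarrow> adm w (F \<inter> F')" by (auto simp: adm_def)

lemma eps_Ed:
  assumes "adm w F" "e \<in> out_arcs E w" shows "eps w F * Ed e = (if e \<in> F then 0 else Ed e)"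
proof -
  have e: "e \<in> arcs E" "tail E e = w" using assms(2) by auto
  have "(\<Sum>f\<in>F. Ed f * Gh f) * Ed e = (\<Sum>f\<in>F. if f = e then Ed e else 0)"
    unfolding sum_distrib_right using assms(1) e
    by (intro sum.cong) (auto simp: mult.assoc Gh_Ed Ed_V adm_def)
  also have "\<dots> = (if e \<in> F then Ed e else 0)" using assms(1) by (simp add: adm_def)
  finally show ?thesis using V_Ed[OF e(1)] e(2) by (simp add: eps_def left_diff_distrib)
qed

lemma Gh_eps:
  assumes "adm w F" "e \<in> out_arcs E w" shows "Gh e * eps w F = (if e \<in> F then 0 else Gh e)"
proof -
  have e: "e \<in> arcs E" "tail E e = w" using assms(2) by auto
  have "Gh e * (\<Sum>f\<in>F. Ed f * Gh f) = (\<Sum>f\<in>F. if f = e then Gh e else 0)"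
    unfolding sum_distrib_left using assms(1) e
    by (intro sum.cong) (auto simp: mult.assoc[symmetric] Gh_Ed V_Gh adm_def)
  also have "\<dots> = (if e \<in> F then Gh e else 0)" using assms(1) by (simp add: adm_def)
  finally show ?thesis using Gh_V[OF e(1)] e(2) by (simp add: eps_def right_diff_distrib)
qed

lemma eps_V: assumes "adm w F" shows "eps w F * V w = eps w F"
proof -
  have "Gh e * V w = Gh e" if "e \<in> F" for e using that Gh_V[of e] assms by (auto simp: adm_def)
  then have "(\<Sum>e\<in>F. Ed e * Gh e) * V w = (\<Sum>e\<in>F. Ed e * Gh e)"
    unfolding sum_distrib_right mult.assoc by simp
  then show ?thesis using assms by (simp add: eps_def adm_def left_diff_distrib V_V)
qed

lemma V_eps: assumes "adm w F" shows "V w * eps w F = eps w F"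
proof -
  have "V w * Ed e = Ed e" if "e \<in> F" for e using that V_Ed[of e] assms by (auto simp: adm_def)
  then have "V w * (\<Sum>e\<in>F. Ed e * Gh e) = (\<Sum>e\<in>F. Ed e * Gh e)"
    unfolding sum_distrib_left mult.assoc[symmetric] by simp
  then show ?thesis using assms by (simp add: eps_def adm_def right_diff_distrib V_V)
qed

lemma eps_eps:
  assumes "adm w F" "adm w F'" shows "eps w F * eps w F' = eps w (F \<union> F')"
proof -
  have fin: "finite F" "finite F'" using assms by (auto simp: adm_def)
  have "eps w F * (\<Sum>e\<in>F'. Ed e * Gh e) = (\<Sum>e\<in>F'. if e \<in> F then 0 else Ed e * Gh e)"
    unfolding sum_distrib_left using assms eps_Ed[OF assms(1)]
    by (intro sum.cong) (auto simp: adm_def mult.assoc[symmetric])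
  also have "\<dots> = (\<Sum>e\<in>F' - F. Ed e * Gh e)"
    by (rule sum.mono_neutral_cong_right) (use fin in auto)
  finally have "eps w F * eps w F' = eps w F - (\<Sum>e\<in>F' - F. Ed e * Gh e)"
    using eps_V[OF assms(1)] by (simp add: eps_def[of w F'] right_diff_distrib)
  also have "\<dots> = eps w (F \<union> F')"
    using sum.union_disjoint[of F "F' - F" "\<lambda>e. Ed e * Gh e"] fin by (simp add: eps_def)
  finally show ?thesis .
qed

text \<open>So the index sets \<open>F\<close> with \<open>eps w F\<close> in a given ideal are closed under intersection.\<close>

lemma eps_Int:
  assumes "adm w F" "adm w F'"
  shows "eps w (F \<inter> F') = eps w F + eps w F' - eps w F * eps w F'"
  using sum.union_inter[of F F' "\<lambda>e. Ed e * Gh e"] assms unfolding eps_eps[OF assms]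
  by (simp add: eps_def adm_def algebra_simps)

lemma eps_pth:
  assumes "adm w F" "awalk w p u" "p \<noteq> []"
  shows "eps w F * pth w p = (if hd p \<in> F then 0 else pth w p)"
proof -
  obtain e q where p: "p = e # q" using assms(3) by (cases p) auto
  have e: "e \<in> out_arcs E w" using assms(2) by (auto simp: p awalk_Cons_iff)
  show ?thesis using eps_Ed[OF assms(1) e] by (simp add: p mult.assoc[symmetric])
qed

lemma gst_eps:
  assumes "adm w F" "awalk w p u" "p \<noteq> []"
  shows "gst w p * eps w F = (if hd p \<in> F then 0 else gst w p)"
proof -
  obtain e q where p: "p = e # q" using assms(3) by (cases p) auto
  have e: "e \<in> out_arcs E w" using assms(2) by (auto simp: p awalk_Cons_iff)
  show ?thesis using Gh_eps[OF assms(1) e] by (simp add: p mult.assoc)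
qed

definition gr_gens :: "'r set \<Rightarrow> 'r set" where
  "gr_gens I = {a * eps w F * b | a b w F. a \<in> S \<and> b \<in> S \<and> adm w F \<and> eps w F \<in> I}"

definition gr :: "'r set \<Rightarrow> 'r set" where "gr I = aspan (gr_gens I)"

lemma gr_gens_cases:
  assumes "x \<in> gr_gens I"
  obtains a b w F where "x = a * eps w F * b" "a \<in> S" "b \<in> S" "adm w F" "eps w F \<in> I"
  using assms unfolding gr_gens_def mem_Collect_eq by (elim exE conjE)

lemma gr_gens_memI:
  "a \<in> S \<Longrightarrow> b \<in> S \<Longrightarrow> adm w F \<Longrightarrow> eps w F \<in> I \<Longrightarrow> a * eps w F * b \<in> gr_gens I"
  unfolding gr_gens_def
  by (rule CollectI, rule exI[of _ a], rule exI[of _ b], rule exI[of _ w], rule exI[of _ F], simp)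

lemma gr_gensI: "a \<in> S \<Longrightarrow> b \<in> S \<Longrightarrow> adm w F \<Longrightarrow> eps w F \<in> I \<Longrightarrow> a * eps w F * b \<in> gr I"
  unfolding gr_def by (rule aspan_base[OF gr_gens_memI])

lemma uminus_gr_gens: assumes "x \<in> gr_gens I" shows "- x \<in> gr_gens I"
proof -
  from assms obtain a b w F where x: "x = a * eps w F * b" "a \<in> S" "b \<in> S" "adm w F" "eps w F \<in> I"
    by (rule gr_gens_cases)
  have "- x = (- a) * eps w F * b" by (simp add: x(1))
  then show ?thesis using gr_gens_memI[OF S_uminus[OF x(2)] x(3-5)] by simp
qed

lemma gr_subset: assumes "ideal_in S I" shows "gr I \<subseteq> I"
  unfolding gr_def
proof (rule ideal_in_aspan_subset[OF assms], rule subsetI)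
  fix x assume "x \<in> gr_gens I"
  then obtain a b w F where "x = a * eps w F * b" "a \<in> S" "b \<in> S" "adm w F" "eps w F \<in> I"
    by (rule gr_gens_cases)
  then show "x \<in> I" by (simp add: ideal_inD(4,5)[OF assms])
qed

lemma gr_ideal:
  assumes "ideal_in S I" shows "ideal_in S (gr I)"
  unfolding gr_def
proof (rule aspan_ideal)
  show "aspan (gr_gens I) \<subseteq> S" using gr_subset[OF assms] ideal_inD(1)[OF assms] by (simp add: gr_def)
  show "- x \<in> gr_gens I" if "x \<in> gr_gens I" for x by (rule uminus_gr_gens[OF that])
  show "s * x \<in> gr_gens I" "x * s \<in> gr_gens I" if x: "x \<in> gr_gens I" and s: "s \<in> S" for x s
  proof -
    from x obtain a b w F where y: "x = a * eps w F * b" "a \<in> S" "b \<in> S" "adm w F" "eps w F \<in> I"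
      by (rule gr_gens_cases)
    have "s * x = (s * a) * eps w F * b" "x * s = a * eps w F * (b * s)" by (simp_all add: y(1) mult.assoc)
    then show "s * x \<in> gr_gens I" "x * s \<in> gr_gens I"
      using gr_gens_memI[OF S_mult[OF s y(2)] y(3-5)] gr_gens_memI[OF y(2) S_mult[OF y(3) s] y(4,5)] by simp_all
  qed
qed

lemma eps_gr: "adm w F \<Longrightarrow> eps w F \<in> I \<Longrightarrow> eps w F \<in> gr I"
  using gr_gensI[of "V w" "V w" w F I] V_S[of w] by (simp add: V_eps eps_V adm_def)

lemma V_gr: "w \<in> verts E \<Longrightarrow> V w \<in> I \<Longrightarrow> V w \<in> gr I"
  using eps_gr[of w "{}" I] by simp

lemma pth_in_ideal:
  assumes "ideal_in S I" "awalk u p v" shows "pth u p \<in> I \<longleftrightarrow> V v \<in> I"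
  using ideal_inD(4)[OF assms(1) _ gst_S[OF assms(2)], of "pth u p"]
    ideal_inD(4)[OF assms(1) _ pth_S[OF assms(2)], of "V v"]
  by (auto simp: gst_pth_same[OF assms(2)] pth_V[OF assms(2)])

lemma gst_in_ideal:
  assumes "ideal_in S I" "awalk u p v" shows "gst u p \<in> I \<longleftrightarrow> V v \<in> I"
  using ideal_inD(5)[OF assms(1) _ pth_S[OF assms(2)], of "gst u p"]
    ideal_inD(5)[OF assms(1) _ gst_S[OF assms(2)], of "V v"]
  by (auto simp: gst_pth_same[OF assms(2)] V_gst[OF assms(2)])

text \<open>Spanning sets of \<open>gr I\<close> in which one of the two outer factors is a single path.\<close>

definition right_gens :: "'r set \<Rightarrow> 'r set" where
  "right_gens I = {a * eps w F * gst u p | a w F u p. a \<in> S \<and> adm w F \<and> eps w F \<in> I \<and> awalk u p w}"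

definition left_gens :: "'r set \<Rightarrow> 'r set" where
  "left_gens I = {pth u p * eps w F * a | a w F u p. a \<in> S \<and> adm w F \<and> eps w F \<in> I \<and> awalk u p w}"

lemma right_gensI:
  "a \<in> S \<Longrightarrow> adm w F \<Longrightarrow> eps w F \<in> I \<Longrightarrow> awalk u p w \<Longrightarrow> a * eps w F * gst u p \<in> aspan (right_gens I)"
  unfolding right_gens_def
  by (rule aspan_base, rule CollectI, rule exI[of _ a], rule exI[of _ w], rule exI[of _ F],
      rule exI[of _ u], rule exI[of _ p], simp)

lemma left_gensI:
  "a \<in> S \<Longrightarrow> adm w F \<Longrightarrow> eps w F \<in> I \<Longrightarrow> awalk u p w \<Longrightarrow> pth u p * eps w F * a \<in> aspan (left_gens I)"
  unfolding left_gens_def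
  by (rule aspan_base, rule CollectI, rule exI[of _ a], rule exI[of _ w], rule exI[of _ F],
      rule exI[of _ u], rule exI[of _ p], simp)

text \<open>A projection \<open>eps w F\<close> kills a nontrivial path from \<open>w\<close> or fixes it. In the second case the end of the
  path lies in \<open>I\<close> and takes over the role of the projection.\<close>

lemma gr_right_form:
  assumes I: "ideal_in S I"
  shows "gr I \<subseteq> aspan (right_gens I)"
proof -
  have gen: "a * eps w F * b \<in> aspan (right_gens I)"
    if a: "a \<in> S" and w: "adm w F" "eps w F \<in> I" and b: "b \<in> S" for a b w F
    using b[unfolded S_def]
  proof (rule aspan_lmult)
    fix b assume "b \<in> monomials"
    then obtain k u p v q z where b: "b = sc k * (pth u p * gst v q)" and p: "awalk u p z" and q: "awalk v q z"
      unfolding monomials_def by blast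
    have "a * eps w F * sc k = (sc k * a) * eps w F"
      using S_comm[OF S_mult[OF a eps_S[OF w(1)]], of k] by (simp add: mult.assoc)
    then have eq: "a * eps w F * b = (sc k * a) * (eps w F * pth u p) * gst v q"
      unfolding b by (metis mult.assoc)
    have wv: "w \<in> verts E" using w by (simp add: adm_def)
    consider "u \<noteq> w" | "u = w" "p = []" | "u = w" "p \<noteq> []" by blast
    then show "a * eps w F * b \<in> aspan (right_gens I)"
    proof cases
      case 1
      then have "V w * pth u p = 0" using V_pth_0[OF p wv] by blast
      then have "eps w F * pth u p = 0" by (metis eps_V[OF w(1)] mult.assoc mult_zero_right)
      then show ?thesis by (simp add: eq aspan.zero)
    next
      case 2
      then have "w = z" using p by (auto simp: awalk_Nil_iff)
      have "a * eps w F * b = (sc k * a) * eps w F * gst v q"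
        unfolding eq using 2 eps_V[OF w(1)] by simp
      then show ?thesis using right_gensI[OF sc_S[OF a] w] q \<open>w = z\<close> by simp
    next
      case 3
      show ?thesis
      proof (cases "hd p \<in> F")
        case True
        then show ?thesis unfolding eq using 3 eps_pth[OF w(1), of p z] p by (simp add: aspan.zero)
      next
        case False
        then have ep: "eps w F * pth u p = pth u p" using 3 eps_pth[OF w(1), of p z] p by simp
        have "pth u p \<in> I" using ideal_inD(5)[OF I w(2) pth_S[OF p]] ep by simp
        then have zI: "V z \<in> I" using pth_in_ideal[OF I p] by simp
        have "a * eps w F * b = (sc k * a * pth u p) * eps z {} * gst v q"
          unfolding eq ep by (simp add: mult.assoc V_gst[OF q])
        then show ?thesis
          using right_gensI[of "sc k * a * pth u p" z "{}" I v q] zI q awalk_verts(2)[OF q]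
            S_mult[OF sc_S[OF a] pth_S[OF p]] by simp
      qed
    qed
  qed
  show ?thesis unfolding gr_def
  proof (rule aspan_subset)
    fix x y assume x0: "x \<in> gr_gens I" and "y \<in> aspan (right_gens I)"
    from x0 obtain a b w F where x: "x = a * eps w F * b" "a \<in> S" "b \<in> S" "adm w F" "eps w F \<in> I"
      by (rule gr_gens_cases)
    show "x + y \<in> aspan (right_gens I)"
      unfolding x(1) by (rule aspan_add[OF gen[OF x(2,4,5,3)] \<open>y \<in> aspan (right_gens I)\<close>])
  qed (rule aspan.zero)
qed

lemma gr_left_form:
  assumes I: "ideal_in S I"
  shows "gr I \<subseteq> aspan (left_gens I)"
proof -
  have gen: "b * (eps w F * a) \<in> aspan (left_gens I)"
    if a: "a \<in> S" and w: "adm w F" "eps w F \<in> I" and b: "b \<in> S" for a b w F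
    using b[unfolded S_def]
  proof (rule aspan_rmult)
    fix b assume "b \<in> monomials"
    then obtain k u p v q z where b: "b = sc k * (pth u p * gst v q)" and p: "awalk u p z" and q: "awalk v q z"
      unfolding monomials_def by blast
    have c: "sc k * (pth u p * (gst v q * eps w F)) = (pth u p * (gst v q * eps w F)) * sc k"
      by (intro S_comm S_mult pth_S[OF p] gst_S[OF q] eps_S[OF w(1)])
    have "b * (eps w F * a) = sc k * (pth u p * (gst v q * eps w F)) * a"
      unfolding b by (simp add: mult.assoc)
    then have eq: "b * (eps w F * a) = pth u p * (gst v q * eps w F) * (sc k * a)"
      unfolding c by (simp add: mult.assoc)
    have wv: "w \<in> verts E" using w by (simp add: adm_def)
    consider "v \<noteq> w" | "v = w" "q = []" | "v = w" "q \<noteq> []" by blast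
    then show "b * (eps w F * a) \<in> aspan (left_gens I)"
    proof cases
      case 1
      then have "gst v q * V w = 0" using gst_V_0[OF q wv] by blast
      then have "gst v q * eps w F = 0" by (metis V_eps[OF w(1)] mult.assoc mult_zero_left)
      then show ?thesis by (simp add: eq aspan.zero)
    next
      case 2
      then have "w = z" using q by (auto simp: awalk_Nil_iff)
      have "b * (eps w F * a) = pth u p * eps w F * (sc k * a)"
        unfolding eq using 2 V_eps[OF w(1)] by simp
      then show ?thesis using left_gensI[OF sc_S[OF a] w] p \<open>w = z\<close> by simp
    next
      case 3
      show ?thesis
      proof (cases "hd q \<in> F")
        case True
        then show ?thesis unfolding eq using 3 gst_eps[OF w(1), of q z] q by (simp add: aspan.zero)
      next
        case False
        then have ep: "gst v q * eps w F = gst v q" using 3 gst_eps[OF w(1), of q z] q by simp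
        have "gst v q \<in> I" using ideal_inD(4)[OF I w(2) gst_S[OF q]] ep by simp
        then have zI: "V z \<in> I" using gst_in_ideal[OF I q] by simp
        have "b * (eps w F * a) = pth u p * eps z {} * (gst v q * (sc k * a))"
          unfolding eq ep by (simp add: pth_V[OF p] mult.assoc)
        then show ?thesis
          using left_gensI[of "gst v q * (sc k * a)" z "{}" I u p] zI p awalk_verts(2)[OF p]
            S_mult[OF gst_S[OF q] sc_S[OF a]] by simp
      qed
    qed
  qed
  show ?thesis unfolding gr_def
  proof (rule aspan_subset)
    fix x y assume x0: "x \<in> gr_gens I" and "y \<in> aspan (left_gens I)"
    from x0 obtain a b w F where x: "x = a * eps w F * b" "a \<in> S" "b \<in> S" "adm w F" "eps w F \<in> I"
      by (rule gr_gens_cases)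
    show "x + y \<in> aspan (left_gens I)" unfolding x(1) mult.assoc[of a]
      by (rule aspan_add[OF gen[OF x(3,4,5,2)] \<open>y \<in> aspan (left_gens I)\<close>])
  qed (rule aspan.zero)
qed

end

section \<open>Units for graded ideals\<close>

lemma aspan_closed_set: "0 \<in> A \<Longrightarrow> (\<And>x y. x \<in> A \<Longrightarrow> y \<in> A \<Longrightarrow> x + y \<in> A) \<Longrightarrow> X \<subseteq> A \<Longrightarrow> aspan X \<subseteq> A"
  by (rule aspan_subset) (simp, metis subsetD)

text \<open>If a shortest index \<open>b\<close> is removed with the help of its unit \<open>u b\<close>, every other term survives unchanged or
  vanishes, so induction applies to the remaining terms. The operation \<open>m\<close> is multiplication or its opposite,
  which yields right and left units at once.\<close>

lemma common_unit:
  fixes y u :: "'i \<Rightarrow> 'r::ring" and len :: "'i \<Rightarrow> nat" and m :: "'r \<Rightarrow> 'r \<Rightarrow> 'r"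
  assumes m: "m = (*) \<or> m = (\<lambda>x y. y * x)"
    and G: "0 \<in> G" "\<And>a b. a \<in> G \<Longrightarrow> b \<in> G \<Longrightarrow> a + b - m a b \<in> G"
    and "finite B" "\<And>b. b \<in> B \<Longrightarrow> u b \<in> G" "\<And>b. b \<in> B \<Longrightarrow> m (y b) (u b) = y b"
    and "\<And>b c. b \<in> B \<Longrightarrow> c \<in> B \<Longrightarrow> len c \<le> len b \<Longrightarrow> m (y b) (u c) = 0 \<or> m (y b) (u c) = y b"
  shows "\<exists>v\<in>G. m (sum y B) v = sum y B"
  using assms(4-)
proof (induction "card B" arbitrary: B rule: less_induct)
  case less
  have m_assoc: "m (m p q) r = m p (m q r)" and m_diff: "m (p - q) r = m p r - m q r"
    and m_add: "m p (q + r) = m p q + m p r" and m_rdiff: "m p (q - r) = m p q - m p r"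
    and m_sum: "m (sum f C) q = (\<Sum>c\<in>C. m (f c) q)" and m_0: "m 0 q = 0" "m q 0 = 0"
    for p q r :: 'r and f :: "'i \<Rightarrow> 'r" and C
    using m by (auto simp: mult.assoc distrib_left distrib_right left_diff_distrib right_diff_distrib
        sum_distrib_left sum_distrib_right)
  show ?case
  proof (cases "B = {}")
    case True
    then show ?thesis using G(1) m_0 by (intro bexI[of _ 0]) simp_all
  next
    case False
    \<comment> \<open>A unit for a shortest index fixes or kills every term, so the killed terms are all that remains.\<close>
    define b0 where "b0 = arg_min_on len B"
    have b0: "b0 \<in> B" using arg_min_if_finite(1)[OF less.prems(1) False, of len] by (simp add: b0_def)
    have le: "len b0 \<le> len b" if "b \<in> B" for b
      using arg_min_least[OF less.prems(1) False that, of len] by (simp add: b0_def)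
    define B' where "B' = {b \<in> B - {b0}. m (y b) (u b0) = 0}"
    have B': "finite B'" "B' \<subseteq> B" "card B' < card B"
    proof -
      show "finite B'" "B' \<subseteq> B" using less.prems(1) by (auto simp: B'_def)
      have "B' \<subset> B" using b0 by (auto simp: B'_def)
      then show "card B' < card B" using less.prems(1) by (rule psubset_card_mono[rotated])
    qed
    have "\<exists>v\<in>G. m (sum y B') v = sum y B'"
      by (rule less.hyps[OF B'(3,1)]) (use B'(2) less.prems in \<open>meson subsetD\<close>)+
    then obtain v where v: "v \<in> G" "m (sum y B') v = sum y B'" by metis
    have "sum y B - m (sum y B) (u b0) = (\<Sum>b\<in>B. y b - m (y b) (u b0))"
      by (simp add: m_sum sum_subtractf)
    also have "\<dots> = (\<Sum>b\<in>B. if b \<in> B' then y b else 0)"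
    proof (rule sum.cong)
      fix b assume b: "b \<in> B"
      show "y b - m (y b) (u b0) = (if b \<in> B' then y b else 0)"
        using less.prems(4)[OF b b0 le[OF b]] less.prems(3)[OF b0] b by (auto simp: B'_def)
    qed simp
    also have "\<dots> = sum y B'"
      using B'(2) less.prems(1) by (simp add: sum.If_cases Int_absorb1)
    finally have eq: "sum y B - m (sum y B) (u b0) = sum y B'" .
    \<comment> \<open>The operation \<open>u + v - u v\<close> makes \<open>1 - (u + v - u v) = (1 - u) (1 - v)\<close>.\<close>
    have "m (sum y B) (u b0 + v - m (u b0) v) = 
        m (sum y B) (u b0) + m (sum y B - m (sum y B) (u b0)) v"
      by (simp add: m_add m_rdiff m_diff m_assoc)
    also have "\<dots> = sum y B" unfolding eq v(2) using eq by (simp add: algebra_simps)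
    finally show ?thesis using G(2)[OF less.prems(2)[OF b0] v(1)] by metis
  qed
qed

context cohn_family
begin

text \<open>The projection at the end of the walk \<open>b\<close>, conjugated to its start.\<close>

definition pe :: "'v \<times> 'e list \<Rightarrow> 'e set \<Rightarrow> 'r" where
  "pe b F = pth (fst b) (snd b) * eps (awlast (fst b) (snd b)) F * gst (fst b) (snd b)"

text \<open>The indices for which this projection belongs to \<open>gr I\<close>.\<close>

definition pidx :: "'r set \<Rightarrow> ('v \<times> 'e list) \<Rightarrow> 'e set \<Rightarrow> bool" where
  "pidx I b F \<longleftrightarrow> awalk (fst b) (snd b) (awlast (fst b) (snd b)) \<and> adm (awlast (fst b) (snd b)) F \<and>
     eps (awlast (fst b) (snd b)) F \<in> I"

lemma awalk_awlast: "awalk u p v \<Longrightarrow> awlast u p = v"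
  by (simp add: awalk_def awlast_if_cas)

lemma pe_mult_same:
  assumes "pidx I b F" "pidx J b F'" shows "pe b F * pe b F' = pe b (F \<union> F')"
proof -
  obtain u p where b: "b = (u, p)" by (cases b)
  define w where "w = awlast u p"
  have w: "awalk u p w" "adm w F" "adm w F'" using assms by (simp_all add: pidx_def b w_def)
  have "pe b F * pe b F' = pth u p * (eps w F * ((gst u p * pth u p) * eps w F')) * gst u p"
    by (simp add: pe_def b w_def mult.assoc)
  also have "\<dots> = pth u p * eps w (F \<union> F') * gst u p"
    unfolding gst_pth_same[OF w(1)] V_eps[OF w(3)] eps_eps[OF w(2,3)] by (rule refl)
  finally show ?thesis by (simp add: pe_def b w_def)
qed

text \<open>A projection is either below or orthogonal to that of a different walk which is not longer.\<close>

lemma pe_mult: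
  assumes "pidx I b F" "pidx I c F'" "b \<noteq> c" "length (snd c) \<le> length (snd b)"
  shows "pe b F * pe c F' = 0 \<or> pe b F * pe c F' = pe b F"
    and "pe c F' * pe b F = 0 \<or> pe c F' * pe b F = pe b F"
proof -
  obtain u p u' p' where b: "b = (u, p)" and c: "c = (u', p')" by (cases b, cases c)
  define w w' where "w = awlast u p" and "w' = awlast u' p'"
  have w: "awalk u p w" "adm w F" and w': "awalk u' p' w'" "adm w' F'"
    using assms by (simp_all add: pidx_def b c w_def w'_def)
  have e1: "pe b F * pe c F' = pth u p * eps w F * (gst u p * pth u' p' * eps w' F') * gst u' p'"
    by (simp add: pe_def b c w_def w'_def mult.assoc)
  show "pe b F * pe c F' = 0 \<or> pe b F * pe c F' = pe b F"
    using gst_pth_cases[OF w(1) w'(1)]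
  proof (elim disjE exE conjE)
    fix t assume "u = u'" "p' = p @ t"
    with assms(3,4) show ?thesis by (simp add: b c)
  next
    fix t assume t: "u = u'" "p = p' @ t" "t \<noteq> []" "awalk w' t w" "gst u p * pth u' p' = gst w' t"
    have "gst w' t * gst u' p' = gst u p" using gst_append[OF w'(1) t(4)] t(1,2) by simp
    then show ?thesis unfolding e1 t(5) gst_eps[OF w'(2) t(4,3)]
      by (simp add: pe_def b w_def mult.assoc)
  next
    assume "gst u p * pth u' p' = 0"
    then show ?thesis unfolding e1 by simp
  qed
  have e2: "pe c F' * pe b F = pth u' p' * (eps w' F' * (gst u' p' * pth u p)) * eps w F * gst u p"
    by (simp add: pe_def b c w_def w'_def mult.assoc)
  show "pe c F' * pe b F = 0 \<or> pe c F' * pe b F = pe b F"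
    using gst_pth_cases[OF w'(1) w(1)]
  proof (elim disjE exE conjE)
    fix t assume t: "u' = u" "p = p' @ t" "awalk w' t w" "gst u' p' * pth u p = pth w' t"
    then have "t \<noteq> []" using assms(3) by (auto simp: b c)
    have "pth u' p' * pth w' t = pth u p" using pth_append[OF w'(1) t(3)] t(1,2) by simp
    then show ?thesis unfolding e2 t(4) eps_pth[OF w'(2) t(3) \<open>t \<noteq> []\<close>]
      by (simp add: pe_def b w_def)
  next
    fix t assume "u' = u" "p' = p @ t" "t \<noteq> []"
    with assms(3,4) show ?thesis by (simp add: b c)
  next
    assume "gst u' p' * pth u p = 0"
    then show ?thesis unfolding e2 by simp
  qed
qed

lemma pe_gr:
  assumes "pidx I b F" shows "pe b F \<in> gr I"
  using gr_gensI[OF pth_S gst_S, of "fst b" "snd b" _ "fst b" "snd b" _ "awlast (fst b) (snd b)" F I] assms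
  unfolding pidx_def pe_def by metis

text \<open>Several terms may have the same walk \<open>b\<close> but different sets of edges; their intersection gives a unit that
  serves all of them, so that distinct terms have distinct walks, as \<open>common_unit\<close> requires.\<close>

lemma gr_sum_form:
  assumes m: "m = (*) \<or> m = (\<lambda>x y. y * x)"
    and "x \<in> aspan {y. \<exists>b F. pidx I b F \<and> m y (pe b F) = (y::'r)}"
    and I: "ideal_in S I"
  shows "\<exists>B y F. finite B \<and> x = sum y B \<and> (\<forall>b\<in>B. pidx I b (F b) \<and> m (y b) (pe b (F b)) = y b)"
  using assms(2)
proof (induction x rule: aspan.induct)
  case zero
  show ?case by (rule exI[of _ "{}"]) simp
next
  case (plus x z)
  from plus.hyps(1) obtain b F0 where b: "pidx I b F0" "m x (pe b F0) = x" by auto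
  from plus.IH obtain B y F where B: "finite B" "z = sum y B"
    "\<forall>b\<in>B. pidx I b (F b) \<and> m (y b) (pe b (F b)) = y b" by auto
  show ?case
  proof (cases "b \<in> B")
    case False
    have "x + z = sum (y(b := x)) (insert b B)"
      using B(1,2) False by (simp add: sum.insert) (rule sum.cong, auto)
    then show ?thesis using B False b
      by (intro exI[of _ "insert b B"] exI[of _ "y(b := x)"] exI[of _ "F(b := F0)"]) auto
  next
    case True
    define w where "w = awlast (fst b) (snd b)"
    have Fb: "pidx I b (F b)" "m (y b) (pe b (F b)) = y b" using B(3) True by auto
    have adm: "adm w F0" "adm w (F b)" using b(1) Fb(1) by (simp_all add: pidx_def w_def)
    have inI: "eps w F0 \<in> I" "eps w (F b) \<in> I" using b(1) Fb(1) by (simp_all add: pidx_def w_def)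
    have "eps w (F0 \<inter> F b) \<in> I"
      unfolding eps_Int[OF adm]
      by (intro ideal_inD(3)[OF I] ideal_in_add[OF I] inI ideal_inD(4)[OF I] eps_S[OF adm(1)])
    then have c: "pidx I b (F0 \<inter> F b)"
      using b(1) adm_Int[OF adm] by (simp add: pidx_def w_def)
    have m_assoc: "m (m p q) r = m p (m q r)" and m_add: "m (p + q) r = m p r + m q r"
      and m_pe: "m (pe b F1) (pe b F2) = pe b (F1 \<union> F2)" if "pidx I b F1" "pidx I b F2"
      for p q r F1 F2
      using m pe_mult_same[OF that] pe_mult_same[OF that(2,1)]
      by (auto simp: mult.assoc distrib_left distrib_right Un_commute)
    have 1: "m x (pe b (F0 \<inter> F b)) = x"
      using m_assoc[OF c c, of x "pe b F0" "pe b (F0 \<inter> F b)"] m_pe[OF b(1) c] b(2)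
      by (simp add: Un_absorb2)
    have 2: "m (y b) (pe b (F0 \<inter> F b)) = y b"
      using m_assoc[OF c c, of "y b" "pe b (F b)" "pe b (F0 \<inter> F b)"] m_pe[OF Fb(1) c] Fb(2)
      by (simp add: Un_absorb2)
    have 3: "m (x + y b) (pe b (F0 \<inter> F b)) = x + y b" using m_add[OF c c] 1 2 by simp
    have "x + z = sum (y(b := x + y b)) B"
      unfolding B(2) sum.remove[OF B(1) True, of y] sum.remove[OF B(1) True, of "y(b := x + y b)"]
      by (simp add: add.assoc)
    then show ?thesis using B c 3
      by (intro exI[of _ B] exI[of _ "y(b := x + y b)"] exI[of _ "F(b := F0 \<inter> F b)"]) auto
  qed
qed

lemma gr_unit:
  assumes m: "m = (*) \<or> m = (\<lambda>x y. y * x)"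
    and x: "x \<in> aspan {y. \<exists>b F. pidx I b F \<and> m y (pe b F) = (y::'r)}"
    and I: "ideal_in S I"
  shows "\<exists>v\<in>gr I. m x v = x"
proof -
  from gr_sum_form[OF assms] obtain B y F where B: "finite B" "x = sum y B"
    "\<And>b. b \<in> B \<Longrightarrow> pidx I b (F b)" "\<And>b. b \<in> B \<Longrightarrow> m (y b) (pe b (F b)) = y b" by metis
  note gI = gr_ideal[OF I]
  have m_assoc: "m (m p q) r = m p (m q r)" and m_0: "m p 0 = 0" for p q r :: 'r
    using m by (auto simp: mult.assoc)
  show ?thesis unfolding B(2)
  proof (rule common_unit[OF m, of "gr I" B "\<lambda>b. pe b (F b)" y "\<lambda>b. length (snd b)"])
    show "0 \<in> gr I" by (rule ideal_inD(2)[OF gI])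
    show "a + b - m a b \<in> gr I" if "a \<in> gr I" "b \<in> gr I" for a b
    proof -
      have "a \<in> S" "b \<in> S" using that ideal_inD(1)[OF gI] by auto
      then have "m a b \<in> gr I" using m that ideal_inD(4,5)[OF gI] by auto
      then show ?thesis by (intro ideal_inD(3)[OF gI] ideal_in_add[OF gI] that)
    qed
    show "finite B" by fact
    show "pe b (F b) \<in> gr I" if "b \<in> B" for b by (rule pe_gr[OF B(3)[OF that]])
    show "m (y b) (pe b (F b)) = y b" if "b \<in> B" for b by (rule B(4)[OF that])
    show "m (y b) (pe c (F c)) = 0 \<or> m (y b) (pe c (F c)) = y b"
      if "b \<in> B" "c \<in> B" "length (snd c) \<le> length (snd b)" for b c
    proof (cases "b = c")
      case False
      have "m (pe b (F b)) (pe c (F c)) = 0 \<or> m (pe b (F b)) (pe c (F c)) = pe b (F b)"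
        using pe_mult[OF B(3)[OF that(1)] B(3)[OF that(2)] False that(3)] m by auto
      then show ?thesis
        using m_assoc[of "y b" "pe b (F b)" "pe c (F c)"] B(4)[OF that(1)] m_0 by auto
    qed (simp add: B(4) that)
  qed
qed

lemma gr_right_unit:
  assumes I: "ideal_in S I" and x: "x \<in> gr I" shows "\<exists>v\<in>gr I. x * v = x"
proof -
  have "right_gens I \<subseteq> {y. \<exists>b F. pidx I b F \<and> y * pe b F = y}"
  proof
    fix y assume "y \<in> right_gens I"
    then obtain a w F u p where y: "y = a * eps w F * gst u p" "adm w F" "eps w F \<in> I" "awalk u p w"
      unfolding right_gens_def by auto
    have w: "awlast u p = w" by (rule awalk_awlast[OF y(4)])
    have "y * pe (u, p) F = a * eps w F * ((gst u p * pth u p) * eps w F) * gst u p"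
      by (simp add: y(1) pe_def w mult.assoc)
    also have "\<dots> = a * (eps w F * eps w F) * gst u p"
      unfolding gst_pth_same[OF y(4)] V_eps[OF y(2)] by (simp add: mult.assoc)
    also have "\<dots> = y" by (simp add: eps_eps[OF y(2,2)] y(1))
    finally show "y \<in> {y. \<exists>b F. pidx I b F \<and> y * pe b F = y}"
      using y w by (auto simp: pidx_def intro!: exI[of _ u] exI[of _ p] exI[of _ F])
  qed
  then have "x \<in> aspan {y. \<exists>b F. pidx I b F \<and> y * pe b F = y}"
    using gr_right_form[OF I] x aspan_mono by (metis (no_types, lifting) subsetD)
  then show ?thesis using gr_unit[of "(*)" x I] I by simp
qed

lemma gr_left_unit:
  assumes I: "ideal_in S I" and x: "x \<in> gr I" shows "\<exists>v\<in>gr I. v * x = x"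
proof -
  have "left_gens I \<subseteq> {y. \<exists>b F. pidx I b F \<and> pe b F * y = y}"
  proof
    fix y assume "y \<in> left_gens I"
    then obtain a w F u p where y: "y = pth u p * eps w F * a" "adm w F" "eps w F \<in> I" "awalk u p w"
      unfolding left_gens_def by auto
    have w: "awlast u p = w" by (rule awalk_awlast[OF y(4)])
    have "pe (u, p) F * y = pth u p * (eps w F * ((gst u p * pth u p) * eps w F)) * a"
      by (simp add: y(1) pe_def w mult.assoc)
    also have "\<dots> = pth u p * (eps w F * eps w F) * a"
      unfolding gst_pth_same[OF y(4)] V_eps[OF y(2)] by (simp add: mult.assoc)
    also have "\<dots> = y" by (simp add: eps_eps[OF y(2,2)] y(1))
    finally show "y \<in> {y. \<exists>b F. pidx I b F \<and> pe b F * y = y}"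
      using y w by (auto simp: pidx_def intro!: exI[of _ u] exI[of _ p] exI[of _ F])
  qed
  then have "x \<in> aspan {y. \<exists>b F. pidx I b F \<and> pe b F * y = y}"
    using gr_left_form[OF I] x aspan_mono by (metis (no_types, lifting) subsetD)
  then show ?thesis using gr_unit[of "\<lambda>x y. y * x" x I] I by simp
qed

end

section \<open>Homogeneous elements\<close>

context cohn_family
begin

lemma hmonomialsI:
  "awalk u p w \<Longrightarrow> awalk v q w \<Longrightarrow> n = int (length p) - int (length q) \<Longrightarrow>
    sc k * (pth u p * gst v q) \<in> hmonomials n"
  unfolding hmonomials_def
  by (rule CollectI, rule exI[of _ k], rule exI[of _ u], rule exI[of _ p], rule exI[of _ v],
      rule exI[of _ q], rule exI[of _ w], simp)

lemma pth_gst_hmonomials: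
  assumes "awalk u p w" "awalk v q w" "n = int (length p) - int (length q)"
  shows "pth u p * gst v q \<in> hmonomials n"
  using hmonomialsI[OF assms, of 1] by (simp add: mult.assoc[symmetric] sc_one_pth[OF assms(1)])

lemma pth_hom: assumes "awalk u p v" shows "pth u p \<in> hom_part (int (length p))"
proof -
  have "awalk v [] v" using awalk_verts(2)[OF assms] by (simp add: awalk_Nil_iff)
  from pth_gst_hmonomials[OF assms this refl] show ?thesis unfolding hom_part_def
    by (intro aspan_base) (simp add: pth_V[OF assms])
qed

lemma gst_hom: assumes "awalk u p v" shows "gst u p \<in> hom_part (- int (length p))"
proof -
  have "awalk v [] v" using awalk_verts(2)[OF assms] by (simp add: awalk_Nil_iff)
  from pth_gst_hmonomials[OF this assms refl] show ?thesis unfolding hom_part_def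
    by (intro aspan_base) (simp add: V_gst[OF assms])
qed

lemma hom_part_diff: "x \<in> hom_part n \<Longrightarrow> y \<in> hom_part n \<Longrightarrow> x - y \<in> hom_part n"
  unfolding hom_part_def by (rule aspan_diff[OF uminus_hmonomials])

lemma eps_hom: assumes "adm w F" shows "eps w F \<in> hom_part 0"
proof -
  have w: "w \<in> verts E" "finite F" using assms by (simp_all add: adm_def)
  then have V: "V w \<in> hom_part 0" using pth_hom[of w "[]" w] by (simp add: awalk_Nil_iff)
  have Ee: "Ed e * Gh e \<in> hmonomials 0" if "e \<in> F" for e
  proof -
    have e: "e \<in> arcs E" "tail E e = w" using that assms by (auto simp: adm_def)
    have wk: "awalk w [e] (head E e)" using e by (auto simp: awalk_Cons_iff awalk_Nil_iff)
    from pth_gst_hmonomials[OF wk wk refl] show ?thesis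
      by (simp add: Ed_V e V_Gh)
  qed
  have "(\<Sum>e\<in>F. Ed e * Gh e) \<in> hom_part 0" using w(2) Ee unfolding hom_part_def
    by (induction F rule: finite_induct) (simp_all add: aspan.zero aspan.plus)
  then show ?thesis unfolding eps_def by (rule hom_part_diff[OF V])
qed

lemma V_hom: "w \<in> verts E \<Longrightarrow> V w \<in> hom_part 0"
  using eps_hom[of w "{}"] by simp

lemma sc_hom: assumes "x \<in> hom_part n" shows "sc k * x \<in> hom_part n"
  using assms unfolding hom_part_def
proof (rule aspan_lmult)
  fix x assume "x \<in> hmonomials n"
  then obtain k' u p v q w where x: "x = sc k' * (pth u p * gst v q)" "awalk u p w" "awalk v q w"
    "n = int (length p) - int (length q)" unfolding hmonomials_def by auto
  have "sc k * x = sc (k * k') * (pth u p * gst v q)" by (simp add: x(1) sc_mult mult.assoc)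
  then have "sc k * x \<in> hmonomials n" using hmonomialsI[OF x(2,3,4)] by simp
  then show "sc k * x \<in> aspan (hmonomials n)" by (rule aspan_base)
qed

lemma sc_cancel: assumes "ideal_in S I" "x \<in> S" "k \<noteq> 0" "sc k * x \<in> I" shows "x \<in> I"
proof -
  have "sc (1 / k) * (sc k * x) = x" using assms(2,3) by (simp add: mult.assoc[symmetric] sc_mult[symmetric] S_one)
  then show ?thesis using sc_in_ideal[OF assms(1,4), of "1 / k"] by simp
qed

section \<open>Eliminating ghost edges\<close>

text \<open>Combinations of paths, without ghost edges, of length \<open>n\<close> that end in \<open>w\<close>.\<close>

definition real_gens :: "int \<Rightarrow> 'v \<Rightarrow> 'r set" where
  "real_gens n w = {sc k * pth u p | k u p. awalk u p w \<and> int (length p) = n}"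

definition real_part :: "int \<Rightarrow> 'v \<Rightarrow> 'r set" where "real_part n w = aspan (real_gens n w)"

lemma real_gens_cases:
  assumes "x \<in> real_gens n w"
  obtains k u p where "x = sc k * pth u p" "awalk u p w" "int (length p) = n"
  using assms unfolding real_gens_def mem_Collect_eq by (elim exE conjE)

lemma real_gensI: "awalk u p w \<Longrightarrow> int (length p) = n \<Longrightarrow> sc k * pth u p \<in> real_gens n w"
  unfolding real_gens_def by auto

lemma real_part_add: "x \<in> real_part n w \<Longrightarrow> y \<in> real_part n w \<Longrightarrow> x + y \<in> real_part n w"
  unfolding real_part_def by (rule aspan_add)

lemma real_part_S: "x \<in> real_part n w \<Longrightarrow> x \<in> S"
  unfolding real_part_def
proof (induction x rule: aspan.induct)
  case (plus x y)
  from plus.hyps(1) obtain k u p where "x = sc k * pth u p" "awalk u p w" by (rule real_gens_cases)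
  then show ?case using S_add[OF sc_S[OF pth_S] plus.IH] by simp
qed (rule S_0)

lemma real_part_V: "x \<in> real_part n w \<Longrightarrow> x * V w = x"
  unfolding real_part_def
proof (induction x rule: aspan.induct)
  case (plus x y)
  from plus.hyps(1) obtain k u p where "x = sc k * pth u p" "awalk u p w" by (rule real_gens_cases)
  then show ?case using plus.IH by (simp add: distrib_right mult.assoc pth_V)
qed simp

lemma real_part_Ed:
  assumes "x \<in> real_part n w" "e \<in> out_arcs E w" shows "x * Ed e \<in> real_part (n + 1) (head E e)"
  using assms(1) unfolding real_part_def
proof (rule aspan_rmult)
  fix x assume "x \<in> real_gens n w"
  then obtain k u p where x: "x = sc k * pth u p" "awalk u p w" "int (length p) = n" by (rule real_gens_cases)
  have e: "awalk w [e] (head E e)" "e \<in> arcs E" using assms(2) by (auto simp: awalk_Cons_iff awalk_Nil_iff)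
  have "x * Ed e = sc k * pth u (p @ [e])"
    using pth_append[OF x(2) e(1)] Ed_V[OF e(2)] by (simp add: x(1) mult.assoc)
  moreover have "awalk u (p @ [e]) (head E e)" by (rule awalk_appendI[OF x(2) e(1)])
  ultimately have "x * Ed e \<in> real_gens (n + 1) (head E e)" using real_gensI x(3) by simp
  then show "x * Ed e \<in> aspan (real_gens (n + 1) (head E e))" by (rule aspan_base)
qed

text \<open>For \<open>n \<ge> 0\<close> every path that occurs is at least as long as \<open>p\<close>, so no ghost edges remain.\<close>

lemma real_part_strip:
  assumes "y \<in> real_part (n + int (length p)) w" "awalk u p v" "n \<ge> 0"
  shows "gst u p * y \<in> real_part n w"
  using assms(1) unfolding real_part_def
proof (rule aspan_lmult)
  fix x assume "x \<in> real_gens (n + int (length p)) w"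
  then obtain k u' p' where x: "x = sc k * pth u' p'" "awalk u' p' w" "int (length p') = n + int (length p)"
    by (rule real_gens_cases)
  have eq: "gst u p * x = sc k * (gst u p * pth u' p')"
    using sc_gst[OF assms(2)] by (simp add: x(1) mult.assoc[symmetric])
  show "gst u p * x \<in> aspan (real_gens n w)"
    using gst_pth_cases[OF assms(2) x(2)]
  proof (elim disjE exE conjE)
    fix t assume t: "p' = p @ t" "awalk v t w" "gst u p * pth u' p' = pth v t"
    then have "int (length t) = n" using x(3) by simp
    then show ?thesis unfolding eq t(3) by (intro aspan_base real_gensI t(2))
  next
    fix t assume t: "p = p' @ t" "t \<noteq> []"
    have "n + int (length t) = 0" using x(3) t(1) by simp
    then have "length t = 0" using assms(3) by linarith
    then show ?thesis using t(2) by simp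
  qed (simp add: eq aspan.zero)
qed

text \<open>Distinct paths of equal length are orthogonal, so the ghost of a path extracts its coefficient.\<close>

lemma real_part_coeff:
  assumes "y \<in> real_part n w" "y \<noteq> 0"
  shows "\<exists>u p k. awalk u p w \<and> int (length p) = n \<and> k \<noteq> 0 \<and> gst u p * y = sc k * V w"
proof -
  have "\<exists>B c. finite B \<and> (\<forall>b\<in>B. awalk (fst b) (snd b) w \<and> int (length (snd b)) = n) \<and>
      y = (\<Sum>b\<in>B. sc (c b) * pth (fst b) (snd b))"
    using assms(1) unfolding real_part_def
  proof (induction y rule: aspan.induct)
    case zero
    show ?case by (rule exI[of _ "{}"]) simp
  next
    case (plus x y)
    from plus.hyps(1) obtain k u p where x: "x = sc k * pth u p" "awalk u p w" "int (length p) = n"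
      by (rule real_gens_cases)
    from plus.IH obtain B c where B: "finite B" "y = (\<Sum>b\<in>B. sc (c b) * pth (fst b) (snd b))"
      "\<forall>b\<in>B. awalk (fst b) (snd b) w \<and> int (length (snd b)) = n" by auto
    define c' where "c' b = (if b = (u, p) then k else 0) + (if b \<in> B then c b else 0)" for b
    have "(\<Sum>b\<in>insert (u, p) B. sc (c' b) * pth (fst b) (snd b)) =
      (\<Sum>b\<in>insert (u, p) B. (if b = (u, p) then x else 0) + (if b \<in> B then sc (c b) * pth (fst b) (snd b) else 0))"
      by (rule sum.cong) (auto simp: c'_def sc_add x(1) distrib_right)
    also have "\<dots> = x + (\<Sum>b\<in>insert (u, p) B. if b \<in> B then sc (c b) * pth (fst b) (snd b) else 0)"
      using B(1) by (simp add: sum.distrib)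
    also have "(\<Sum>b\<in>insert (u, p) B. if b \<in> B then sc (c b) * pth (fst b) (snd b) else 0) = y"
      unfolding B(2) using B(1) by (intro sum.mono_neutral_cong_right) auto
    finally show ?case using B x
      by (intro exI[of _ "insert (u, p) B"] exI[of _ c']) auto
  qed
  then obtain B c where B: "finite B" "\<forall>b\<in>B. awalk (fst b) (snd b) w \<and> int (length (snd b)) = n"
    "y = (\<Sum>b\<in>B. sc (c b) * pth (fst b) (snd b))" by auto
  obtain b where b: "b \<in> B" "c b \<noteq> 0"
  proof (cases "\<forall>b\<in>B. c b = 0")
    case True
    then have "y = 0" unfolding B(3) by simp
    with assms(2) show ?thesis by simp
  qed (use that in auto)
  have wb: "awalk (fst b) (snd b) w" "int (length (snd b)) = n" using B(2) b(1) by auto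
  have "gst (fst b) (snd b) * y = (\<Sum>d\<in>B. if d = b then sc (c b) * V w else 0)"
    unfolding B(3) sum_distrib_left
  proof (rule sum.cong)
    fix d assume d: "d \<in> B"
    have wd: "awalk (fst d) (snd d) w" "int (length (snd d)) = n" using B(2) d by auto
    have "gst (fst b) (snd b) * (sc (c d) * pth (fst d) (snd d)) =
        sc (c d) * (gst (fst b) (snd b) * pth (fst d) (snd d))"
      using sc_gst[OF wb(1), of "c d"] by (simp add: mult.assoc[symmetric])
    also have "\<dots> = (if d = b then sc (c b) * V w else 0)"
    proof (cases "d = b")
      case True
      then show ?thesis using gst_pth_same[OF wb(1)] by simp
    next
      case False
      have "gst (fst b) (snd b) * pth (fst d) (snd d) = 0"
        using gst_pth_cases[OF wb(1) wd(1)]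
      proof (elim disjE exE conjE)
        fix t assume "fst b = fst d" "snd d = snd b @ t"
        with wb(2) wd(2) False show ?thesis by (simp add: prod_eq_iff)
      next
        fix t assume "fst b = fst d" "snd b = snd d @ t" "t \<noteq> []"
        with wb(2) wd(2) show ?thesis by simp
      qed
      then show ?thesis using False by simp
    qed
    finally show "gst (fst b) (snd b) * (sc (c d) * pth (fst d) (snd d)) = (if d = b then sc (c b) * V w else 0)" .
  qed simp
  also have "\<dots> = sc (c b) * V w" using B(1) b(1) by simp
  finally show ?thesis using wb b(2) by metis
qed

text \<open>Elements of \<open>ghost_part m n w\<close> have degree \<open>n\<close>, end in \<open>w\<close> and involve ghost paths of length
  at most \<open>m\<close>.\<close>

primrec ghost_part :: "nat \<Rightarrow> int \<Rightarrow> 'v \<Rightarrow> 'r set" where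
  "ghost_part 0 n w = real_part n w"
| "ghost_part (Suc m) n w = {y + (\<Sum>e\<in>F. z e * Gh e) | y F z. y \<in> real_part n w \<and> finite F \<and>
     F \<subseteq> out_arcs E w \<and> (\<forall>e\<in>F. z e \<in> ghost_part m (n + 1) (head E e))}"

lemma ghost_part_SucI:
  "y \<in> real_part n w \<Longrightarrow> finite F \<Longrightarrow> F \<subseteq> out_arcs E w \<Longrightarrow>
    (\<And>e. e \<in> F \<Longrightarrow> z e \<in> ghost_part m (n + 1) (head E e)) \<Longrightarrow>
    y + (\<Sum>e\<in>F. z e * Gh e) \<in> ghost_part (Suc m) n w"
  unfolding ghost_part.simps
  by (rule CollectI, rule exI[of _ y], rule exI[of _ F], rule exI[of _ z]) simp

lemma ghost_part_SucE:
  assumes "x \<in> ghost_part (Suc m) n w"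
  obtains y F z where "x = y + (\<Sum>e\<in>F. z e * Gh e)" "y \<in> real_part n w" "finite F"
    "F \<subseteq> out_arcs E w" "\<forall>e\<in>F. z e \<in> ghost_part m (n + 1) (head E e)"
  using assms unfolding ghost_part.simps mem_Collect_eq by (elim exE conjE)

lemma real_ghost_part: "x \<in> real_part n w \<Longrightarrow> x \<in> ghost_part m n w"
proof (cases m)
  case (Suc k)
  assume "x \<in> real_part n w"
  then show ?thesis using ghost_part_SucI[of x n w "{}" "\<lambda>_. 0" k] Suc by simp
qed simp

lemma ghost_part_mono: "x \<in> ghost_part m n w \<Longrightarrow> x \<in> ghost_part (Suc m) n w"
proof (induction m arbitrary: x n w)
  case 0
  then show ?case using real_ghost_part[of x n w "Suc 0"] by simp
next
  case (Suc m)
  from Suc.prems obtain y F z where x: "x = y + (\<Sum>e\<in>F. z e * Gh e)" "y \<in> real_part n w" "finite F"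
    "F \<subseteq> out_arcs E w" "\<forall>e\<in>F. z e \<in> ghost_part m (n + 1) (head E e)"
    by (rule ghost_part_SucE)
  show ?case unfolding x(1) by (rule ghost_part_SucI[OF x(2-4)]) (rule Suc.IH[OF x(5)[rule_format]])
qed

lemma ghost_part_mono_le: "x \<in> ghost_part m n w \<Longrightarrow> m \<le> m' \<Longrightarrow> x \<in> ghost_part m' n w"
  by (rule dec_induct[of m m' "\<lambda>k. x \<in> ghost_part k n w"]) (simp_all only: ghost_part_mono)

lemma ghost_part_0: "0 \<in> ghost_part m n w"
  by (rule real_ghost_part) (simp add: real_part_def aspan.zero)

lemma ghost_part_add: "x \<in> ghost_part m n w \<Longrightarrow> x' \<in> ghost_part m n w \<Longrightarrow> x + x' \<in> ghost_part m n w"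
proof (induction m arbitrary: x x' n w)
  case 0
  then show ?case by (simp add: real_part_add)
next
  case (Suc m)
  from Suc.prems(1) obtain y F z where x: "x = y + (\<Sum>e\<in>F. z e * Gh e)" "y \<in> real_part n w" "finite F"
    "F \<subseteq> out_arcs E w" "\<forall>e\<in>F. z e \<in> ghost_part m (n + 1) (head E e)"
    by (rule ghost_part_SucE)
  from Suc.prems(2) obtain y' F' z' where x': "x' = y' + (\<Sum>e\<in>F'. z' e * Gh e)" "y' \<in> real_part n w"
    "finite F'" "F' \<subseteq> out_arcs E w" "\<forall>e\<in>F'. z' e \<in> ghost_part m (n + 1) (head E e)"
    by (rule ghost_part_SucE)
  define z1 where "z1 e = (if e \<in> F then z e else 0) + (if e \<in> F' then z' e else 0)" for e
  have "(\<Sum>e\<in>F \<union> F'. z1 e * Gh e) = (\<Sum>e\<in>F \<union> F'. (if e \<in> F then z e * Gh e else 0)) +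
      (\<Sum>e\<in>F \<union> F'. (if e \<in> F' then z' e * Gh e else 0))"
    unfolding sum.distrib[symmetric] by (rule sum.cong) (auto simp: z1_def distrib_right)
  also have "(\<Sum>e\<in>F \<union> F'. (if e \<in> F then z e * Gh e else 0)) = (\<Sum>e\<in>F. z e * Gh e)"
    using x(3) x'(3) by (intro sum.mono_neutral_cong_right) auto
  also have "(\<Sum>e\<in>F \<union> F'. (if e \<in> F' then z' e * Gh e else 0)) = (\<Sum>e\<in>F'. z' e * Gh e)"
    using x(3) x'(3) by (intro sum.mono_neutral_cong_right) auto
  finally have eq: "x + x' = (y + y') + (\<Sum>e\<in>F \<union> F'. z1 e * Gh e)" by (simp add: x(1) x'(1) algebra_simps)
  show ?case unfolding eq
  proof (rule ghost_part_SucI)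
    show "y + y' \<in> real_part n w" by (rule real_part_add[OF x(2) x'(2)])
    show "finite (F \<union> F')" "F \<union> F' \<subseteq> out_arcs E w" using x x' by auto
    fix e
    show "z1 e \<in> ghost_part m (n + 1) (head E e)" unfolding z1_def
      by (rule Suc.IH) (simp_all add: x(5) x'(5) ghost_part_0)
  qed
qed

lemma ghost_part_V: "x \<in> ghost_part m n w \<Longrightarrow> x * V w = x"
proof (cases m)
  case (Suc k)
  assume "x \<in> ghost_part m n w"
  then obtain y F z where x: "x = y + (\<Sum>e\<in>F. z e * Gh e)" "y \<in> real_part n w" "F \<subseteq> out_arcs E w"
    unfolding Suc by (elim ghost_part_SucE)
  have "Gh e * V w = Gh e" if "e \<in> F" for e using that x(3) Gh_V[of e] by auto
  then have "(\<Sum>e\<in>F. z e * Gh e) * V w = (\<Sum>e\<in>F. z e * Gh e)"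
    unfolding sum_distrib_right mult.assoc by simp
  then show ?thesis using real_part_V[OF x(2)] by (simp add: x(1) distrib_right)
qed (simp add: real_part_V)

lemma monomial_ghost_part:
  "awalk v q z \<Longrightarrow> awalk u p z \<Longrightarrow>
    sc k * (pth u p * gst v q) \<in> ghost_part (length q) (int (length p) - int (length q)) v"
proof (induction q arbitrary: v)
  case Nil
  then have "v = z" by (simp add: awalk_Nil_iff)
  have "sc k * pth u p \<in> real_part (int (length p)) z"
    unfolding real_part_def by (intro aspan_base real_gensI Nil) simp
  then show ?case using \<open>v = z\<close> pth_V[OF Nil(2)] by simp
next
  case (Cons e q)
  have e: "e \<in> out_arcs E v" "awalk (head E e) q z" using Cons.prems(1) by (auto simp: awalk_Cons_iff)
  have "0 + (\<Sum>f\<in>{e}. (sc k * (pth u p * gst (head E e) q)) * Gh f)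
      \<in> ghost_part (Suc (length q)) (int (length p) - int (length (e # q))) v"
  proof (rule ghost_part_SucI)
    fix f assume "f \<in> {e}"
    then show "sc k * (pth u p * gst (head E e) q)
      \<in> ghost_part (length q) (int (length p) - int (length (e # q)) + 1) (head E f)"
      using Cons.IH[OF e(2) Cons.prems(2)] by simp
  qed (use e in \<open>auto simp: real_part_def aspan.zero\<close>)
  then show ?case by (simp add: mult.assoc)
qed

lemma hom_ghost_part:
  assumes "x \<in> hom_part n" "w \<in> verts E" shows "\<exists>m. x * V w \<in> ghost_part m n w"
  using assms(1) unfolding hom_part_def
proof (induction x rule: aspan.induct)
  case zero
  then show ?case using ghost_part_0 by simp
next
  case (plus x y)
  from plus.hyps(1) obtain k u p v q z where x: "x = sc k * (pth u p * gst v q)" "awalk u p z" "awalk v q z"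
    "n = int (length p) - int (length q)" unfolding hmonomials_def by auto
  have "\<exists>m. x * V w \<in> ghost_part m n w"
  proof (cases "v = w")
    case True
    then have "x * V w = x" using gst_V[OF x(3)] by (simp add: x(1) mult.assoc)
    then show ?thesis using monomial_ghost_part[OF x(3,2), of k] x(1,4) True by metis
  next
    case False
    then have "x * V w = 0" using gst_V_0[OF x(3) assms(2)] by (simp add: x(1) mult.assoc)
    then show ?thesis using ghost_part_0 by simp
  qed
  then obtain m where m: "x * V w \<in> ghost_part m n w" by auto
  from plus.IH obtain m' where m': "y * V w \<in> ghost_part m' n w" by auto
  have "(x + y) * V w \<in> ghost_part (max m m') n w"
    unfolding distrib_right
    by (intro ghost_part_add ghost_part_mono_le[OF m] ghost_part_mono_le[OF m']) simp_all
  then show ?case by auto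
qed

text \<open>A homogeneous element outside an ideal can be multiplied on the right by a path, and by a
  projection that behaves like a sink modulo the ideal, to free it from ghost edges without
  entering the ideal. If all edges out of \<open>w\<close> take \<open>x\<close> into the ideal, then the first edges
  of the finitely many ghost paths in \<open>x\<close> are cut off by \<open>eps w F\<close>, and this is sink-like.\<close>

lemma ghost_elimination:
  assumes G: "ideal_in S G" and "x \<in> ghost_part m n w" "w \<in> verts E" "x \<in> S" "x \<notin> G"
  shows "\<exists>p u F y. awalk w p u \<and> adm u F \<and> (F = {} \<or> (\<forall>e\<in>out_arcs E u. eps u F * Ed e \<in> G)) \<and>
    y \<in> real_part (n + int (length p)) u \<and> x * pth w p * eps u F = y * eps u F \<and> y * eps u F \<notin> G"
  using assms(2-)
proof (induction m arbitrary: x n w)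
  case 0
  have "x * V w = x" using ghost_part_V[OF 0(1)] .
  then show ?case using 0
    by (intro exI[of _ "[]"] exI[of _ w] exI[of _ "{}"] exI[of _ x]) (simp add: awalk_Nil_iff mult.assoc V_V)
next
  case (Suc m)
  \<comment> \<open>Write \<open>x = y + (\<Sum>e\<in>F. z e e\<^sup>* )\<close>. An edge that keeps \<open>x\<close> outside \<open>G\<close> shortens the ghost paths; if there is
    none, then \<open>eps w F\<close> annihilates the sum and leaves \<open>y\<close>.\<close>
  from Suc.prems(1) obtain y F z where x: "x = y + (\<Sum>e\<in>F. z e * Gh e)" "y \<in> real_part n w" "finite F"
    "F \<subseteq> out_arcs E w" "\<forall>e\<in>F. z e \<in> ghost_part m (n + 1) (head E e)"
    by (rule ghost_part_SucE)
  have xEd: "x * Ed e = y * Ed e + (if e \<in> F then z e else 0)" if e: "e \<in> out_arcs E w" for e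
  proof -
    have "(\<Sum>f\<in>F. z f * Gh f) * Ed e = (\<Sum>f\<in>F. if f = e then z e else 0)"
      unfolding sum_distrib_right
    proof (rule sum.cong)
      fix f assume f: "f \<in> F"
      have "f \<in> arcs E" "e \<in> arcs E" using f x(4) e by auto
      then show "z f * Gh f * Ed e = (if f = e then z e else 0)"
        using Gh_Ed[of f e] ghost_part_V[OF x(5)[rule_format, OF f]]
        by (cases "f = e") (simp_all add: mult.assoc)
    qed simp
    then show ?thesis using x(3) by (simp add: x(1) distrib_right)
  qed
  show ?case
  proof (cases "\<exists>e\<in>out_arcs E w. x * Ed e \<notin> G")
    case True
    then obtain e where e: "e \<in> out_arcs E w" "x * Ed e \<notin> G" by auto
    have ea: "e \<in> arcs E" "tail E e = w" using e by auto
    have 1: "x * Ed e \<in> ghost_part m (n + 1) (head E e)" unfolding xEd[OF e(1)]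
      by (rule ghost_part_add[OF real_ghost_part[OF real_part_Ed[OF x(2) e(1)]]]) (simp add: x(5) ghost_part_0)
    have 2: "head E e \<in> verts E" "x * Ed e \<in> S" using ea S_mult[OF Suc.prems(3) Ed_S] by auto
    from Suc.IH[OF 1 2 e(2)] obtain p u F' y' where IH: "awalk (head E e) p u" "adm u F'"
      "F' = {} \<or> (\<forall>e\<in>out_arcs E u. eps u F' * Ed e \<in> G)" "y' \<in> real_part (n + 1 + int (length p)) u"
      "x * Ed e * pth (head E e) p * eps u F' = y' * eps u F'" "y' * eps u F' \<notin> G" by auto
    have "awalk w (e # p) u" using IH(1) ea by (auto simp: awalk_Cons_iff)
    moreover have "x * pth w (e # p) * eps u F' = y' * eps u F'" using IH(5) by (simp add: mult.assoc)
    moreover have "y' \<in> real_part (n + int (length (e # p))) u" using IH(4) by (simp add: algebra_simps)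
    ultimately show ?thesis using IH(2,3,6) by metis
  next
    case False
    then have xe: "x * Ed e \<in> G" if "e \<in> out_arcs E w" for e using that by auto
    have adm: "adm w F" using x(3,4) Suc.prems(2) by (simp add: adm_def)
    have "x * (\<Sum>e\<in>F. Ed e * Gh e) \<in> G" unfolding sum_distrib_left mult.assoc[symmetric]
    proof (rule ideal_in_sum[OF G])
      fix e assume "e \<in> F"
      then have "e \<in> out_arcs E w" using x(4) by auto
      then show "x * Ed e * Gh e \<in> G" using ideal_inD(5)[OF G xe Gh_S, of e e] by simp
    qed
    moreover have "x - x * eps w F = x * (\<Sum>e\<in>F. Ed e * Gh e)"
      using ghost_part_V[OF Suc.prems(1)] by (simp add: eps_def right_diff_distrib)
    ultimately have xeps: "x * eps w F \<notin> G"
      using ideal_in_diff_cancel[OF G, of x "x * eps w F"] Suc.prems(4) by simp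
    have "(\<Sum>e\<in>F. z e * Gh e) * eps w F = 0" unfolding sum_distrib_right
    proof (rule sum.neutral, rule ballI)
      fix e assume "e \<in> F"
      then have "Gh e * eps w F = 0" using Gh_eps[OF adm] x(4) by auto
      then show "z e * Gh e * eps w F = 0" by (simp add: mult.assoc)
    qed
    then have xy: "x * eps w F = y * eps w F" by (simp add: x(1) distrib_right)
    have "y \<noteq> 0" using xeps xy ideal_inD(2)[OF G] by auto
    from real_part_coeff[OF x(2) this] obtain u p k where k: "awalk u p w" "k \<noteq> 0" "gst u p * y = sc k * V w"
      by auto
    have "eps w F * Ed e \<in> G" if e: "e \<in> out_arcs E w" for e
    proof (cases "e \<in> F")
      case True
      then show ?thesis using eps_Ed[OF adm e] ideal_inD(2)[OF G] by simp
    next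
      case False
      have ea: "e \<in> arcs E" "tail E e = w" using e by auto
      have "y * Ed e \<in> G" using xe[OF e] xEd[OF e] False by simp
      then have "gst u p * (y * Ed e) \<in> G" by (rule ideal_inD(4)[OF G _ gst_S[OF k(1)]])
      then have "sc k * Ed e \<in> G" using k(3) V_Ed[OF ea(1)] ea(2) by (metis mult.assoc)
      then have "Ed e \<in> G" by (rule sc_cancel[OF G Ed_S[OF ea(1)] k(2)])
      then show ?thesis using eps_Ed[OF adm e] False by simp
    qed
    moreover have "x * pth w [] * eps w F = y * eps w F"
      using xy V_eps[OF adm] by (simp add: mult.assoc)
    moreover have "awalk w [] w" using Suc.prems(2) by (simp add: awalk_Nil_iff)
    ultimately show ?thesis using adm x(2) xeps xy
      by (intro exI[of _ "[]"] exI[of _ w] exI[of _ F] exI[of _ y]) simp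
  qed
qed

end

section \<open>Components and central elements\<close>

locale graded_cohn_family = cohn_family E V Ed Gh sc
  for E :: "('v, 'e) pre_digraph" and V :: "'v \<Rightarrow> 'r::ring" and Ed Gh :: "'e \<Rightarrow> 'r"
    and sc :: "'k::field \<Rightarrow> 'r" +
  fixes comp :: "int \<Rightarrow> 'r \<Rightarrow> 'r"
  assumes comp_add: "x \<in> S \<Longrightarrow> y \<in> S \<Longrightarrow> comp n (x + y) = comp n x + comp n y"
    and comp_hmonomial: "x \<in> hmonomials m \<Longrightarrow> comp n x = (if n = m then x else 0)"
begin

lemma comp_0 [simp]: "comp n 0 = 0"
  using comp_add[OF S_0 S_0, of n] by simp

lemma comp_diff: assumes "x \<in> S" "y \<in> S" shows "comp n (x - y) = comp n x - comp n y"
  using comp_add[OF S_diff[OF assms] assms(2), of n] by (simp add: algebra_simps)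

lemma comp_hom: "x \<in> hom_part m \<Longrightarrow> comp n x = (if n = m then x else 0)"
  unfolding hom_part_def
proof (induction x rule: aspan.induct)
  case (plus x y)
  have "x \<in> S" "y \<in> S" using hmonomials_S[OF plus.hyps(1)] hom_part_S plus.hyps(2) by (simp_all add: hom_part_def)
  then show ?case using comp_add[of x y n] plus.IH comp_hmonomial[OF plus.hyps(1)] by simp
qed simp

lemma S_induct [consumes 1, case_names zero add hom]:
  assumes "x \<in> S" "P 0" "\<And>x y. x \<in> S \<Longrightarrow> y \<in> S \<Longrightarrow> P x \<Longrightarrow> P y \<Longrightarrow> P (x + y)"
    "\<And>n x. x \<in> hom_part n \<Longrightarrow> P x"
  shows "P x"
  using assms(1) unfolding S_def
proof (induction x rule: aspan.induct)
  case (plus x y)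
  from plus.hyps(1) obtain n where "x \<in> hmonomials n" unfolding monomials_UN by auto
  then have "P x" "x \<in> S" using assms(4)[of x n] hmonomials_S by (simp_all add: hom_part_def aspan_base)
  then show ?case using assms(3) plus by (simp add: S_def)
qed (rule assms(2))

lemma comp_hom_part: "x \<in> S \<Longrightarrow> comp n x \<in> hom_part n"
proof (induction x rule: S_induct)
  case (add x y)
  then show ?case using comp_add[of x y n] by (simp add: hom_part_def aspan_add)
qed (simp_all add: comp_hom hom_part_def aspan.zero)

lemma comp_S: "x \<in> S \<Longrightarrow> comp n x \<in> S"
  by (rule hom_part_S[OF comp_hom_part])

lemma finite_comp: "x \<in> S \<Longrightarrow> finite {n. comp n x \<noteq> 0}"
proof (induction x rule: S_induct)
  case (add x y)
  have "{n. comp n (x + y) \<noteq> 0} \<subseteq> {n. comp n x \<noteq> 0} \<union> {n. comp n y \<noteq> 0}"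
    using comp_add[OF add(1,2)] by auto
  then show ?case by (rule finite_subset) (simp add: add.IH)
next
  case (hom n x)
  have "{m. comp m x \<noteq> 0} \<subseteq> {n}" using comp_hom[OF hom] by auto
  then show ?case by (rule finite_subset) simp
qed simp

lemma sum_comp: 
  assumes "x \<in> S" "finite N" "{n. comp n x \<noteq> 0} \<subseteq> N" shows "(\<Sum>n\<in>N. comp n x) = x"
  using assms
proof (induction x arbitrary: N rule: S_induct)
  case (add x y)
  define M where "M = N \<union> {n. comp n x \<noteq> 0} \<union> {n. comp n y \<noteq> 0}"
  have M: "finite M" using add.prems(1) finite_comp[OF add(1)] finite_comp[OF add(2)] by (simp add: M_def)
  have "(\<Sum>n\<in>N. comp n (x + y)) = (\<Sum>n\<in>M. comp n (x + y))"
    using add.prems(2) M by (intro sum.mono_neutral_left) (auto simp: M_def)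
  also have "\<dots> = (\<Sum>n\<in>M. comp n x) + (\<Sum>n\<in>M. comp n y)"
    using comp_add[OF add(1,2)] by (simp add: sum.distrib)
  also have "\<dots> = x + y" using add.IH(1)[OF M] add.IH(2)[OF M] by (auto simp: M_def)
  finally show ?case .
next
  case (hom n x)
  have "(\<Sum>m\<in>N. comp m x) = (\<Sum>m\<in>N. if m = n then x else 0)" using comp_hom[OF hom(1)] by simp
  also have "\<dots> = x"
  proof (cases "x = 0")
    case False
    then have "n \<in> N" using hom(3) comp_hom[OF hom(1), of n] by auto
    then show ?thesis using hom(2) by simp
  qed (simp cong: if_cong)
  finally show ?case .
qed simp

lemma comp_lmult:
  assumes "a \<in> hom_part k" "x \<in> S" shows "comp n (a * x) = a * comp (n - k) x"
  using assms(2)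
proof (induction x rule: S_induct)
  case (add x y)
  have "a \<in> S" by (rule hom_part_S[OF assms(1)])
  then show ?case using add comp_add[of "a * x" "a * y" n] comp_add[of x y "n - k"] S_mult
    by (simp add: distrib_left)
next
  case (hom m x)
  then show ?case using comp_hom[OF hom_part_mult[OF assms(1) hom], of n] comp_hom[OF hom, of "n - k"] by auto
qed simp

lemma comp_rmult:
  assumes "a \<in> hom_part k" "x \<in> S" shows "comp n (x * a) = comp (n - k) x * a"
  using assms(2)
proof (induction x rule: S_induct)
  case (add x y)
  have "a \<in> S" by (rule hom_part_S[OF assms(1)])
  then show ?case using add comp_add[of "x * a" "y * a" n] comp_add[of x y "n - k"] S_mult
    by (simp add: distrib_right)
next
  case (hom m x)
  then show ?case using comp_hom[OF hom_part_mult[OF hom assms(1)], of n] comp_hom[OF hom, of "n - k"] by auto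
qed simp

text \<open>A spanning element is a product of an arbitrary coefficient and a homogeneous element of \<open>gr I\<close>, so its
  components are of the same form.\<close>

lemma comp_gr:
  assumes I: "ideal_in S I" and "x \<in> gr I" shows "comp n x \<in> gr I"
proof -
  note gI = gr_ideal[OF I]
  have "aspan (right_gens I) \<subseteq> {x \<in> S. comp n x \<in> gr I}"
  proof (rule aspan_closed_set)
    show "0 \<in> {x \<in> S. comp n x \<in> gr I}" using S_0 ideal_inD(2)[OF gI] by simp
    show "x + y \<in> {x \<in> S. comp n x \<in> gr I}"
      if "x \<in> {x \<in> S. comp n x \<in> gr I}" "y \<in> {x \<in> S. comp n x \<in> gr I}" for x y
      using that comp_add[of x y n] S_add ideal_in_add[OF gI] by simp
    show "right_gens I \<subseteq> {x \<in> S. comp n x \<in> gr I}"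
    proof
      fix x assume "x \<in> right_gens I"
      then obtain a w F u p where x: "x = a * eps w F * gst u p" "a \<in> S" "adm w F" "eps w F \<in> I" "awalk u p w"
        unfolding right_gens_def by auto
      have h: "eps w F * gst u p \<in> hom_part (0 + - int (length p))"
        by (rule hom_part_mult[OF eps_hom[OF x(3)] gst_hom[OF x(5)]])
      have "comp n x = comp (n - (0 + - int (length p))) a * eps w F * gst u p"
        unfolding x(1) mult.assoc by (rule comp_rmult[OF h x(2)])
      also have "\<dots> \<in> gr I" by (rule gr_gensI[OF comp_S[OF x(2)] gst_S[OF x(5)] x(3,4)])
      finally show "x \<in> {x \<in> S. comp n x \<in> gr I}"
        using S_mult[OF S_mult[OF x(2) eps_S[OF x(3)]] gst_S[OF x(5)]] by (simp add: x(1))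
    qed
  qed
  then show ?thesis using gr_right_form[OF I] assms(2) by auto
qed

text \<open>After the ghost edges have been eliminated on the right, the ghost of one of the remaining paths extracts
  its coefficient on the left.\<close>

lemma homogeneous_reduction:
  assumes G: "ideal_in S G" and x: "x \<in> hom_part n" "x \<notin> G"
  shows "\<exists>a b i j u F. a \<in> hom_part i \<and> b \<in> hom_part j \<and> i + n + j = 0 \<and> adm u F \<and> eps u F \<notin> G \<and>
    (F = {} \<or> (\<forall>e\<in>out_arcs E u. eps u F * Ed e \<in> G)) \<and> a * x * b = eps u F"
proof -
  have xS: "x \<in> S" by (rule hom_part_S[OF x(1)])
  from ex_right_vertex[OF G xS x(2)] obtain w where w: "w \<in> verts E" "x * V w \<notin> G" by auto
  from hom_ghost_part[OF x(1) w(1)] obtain m where m: "x * V w \<in> ghost_part m n w" by auto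
  from ghost_elimination[OF G m w(1) S_mult[OF xS V_S[OF w(1)]] w(2)]
  obtain p u F y where *: "awalk w p u" "adm u F" "F = {} \<or> (\<forall>e\<in>out_arcs E u. eps u F * Ed e \<in> G)"
    "y \<in> real_part (n + int (length p)) u" "x * V w * pth w p * eps u F = y * eps u F" "y * eps u F \<notin> G"
    by auto
  have "y \<noteq> 0" using *(6) ideal_inD(2)[OF G] by auto
  from real_part_coeff[OF *(4) this] obtain u' q k where k: "awalk u' q u" "int (length q) = n + int (length p)"
    "k \<noteq> 0" "gst u' q * y = sc k * V u" by auto
  have nG: "eps u F \<notin> G"
    using *(6) ideal_inD(4)[OF G _ real_part_S[OF *(4)]] by auto
  have "sc (1 / k) * gst u' q * x * (V w * pth w p * eps u F) = sc (1 / k) * gst u' q * (x * V w * pth w p * eps u F)"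
    by (simp add: mult.assoc)
  also have "\<dots> = sc (1 / k) * ((gst u' q * y) * eps u F)" unfolding *(5) by (simp add: mult.assoc)
  also have "\<dots> = sc (1 / k) * sc k * (V u * eps u F)" unfolding k(4) by (simp add: mult.assoc)
  also have "\<dots> = eps u F" using k(3) unfolding sc_mult[symmetric] V_eps[OF *(2)]
    by (simp add: S_one eps_S *(2))
  finally have "sc (1 / k) * gst u' q * x * (V w * pth w p * eps u F) = eps u F" .
  moreover have "sc (1 / k) * gst u' q \<in> hom_part (- int (length q))" by (rule sc_hom[OF gst_hom[OF k(1)]])
  moreover have "V w * pth w p * eps u F \<in> hom_part (0 + int (length p) + 0)"
    by (intro hom_part_mult V_hom w(1) pth_hom[OF *(1)] eps_hom *(2))
  moreover have "- int (length q) + n + (0 + int (length p) + 0) = 0" using k(2) by simp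
  ultimately show ?thesis using *(2,3) nG by metis
qed

text \<open>An element of positive degree begins with an edge, which a sink-like projection takes into the ideal.\<close>

lemma sink_hom:
  assumes G: "ideal_in S G" and F: "adm u F" "\<forall>e\<in>out_arcs E u. eps u F * Ed e \<in> G"
    and "x \<in> hom_part n" "n > 0"
  shows "eps u F * x \<in> G"
proof -
  have "hmonomials n \<subseteq> {x. eps u F * x \<in> G}"
  proof
    fix x assume "x \<in> hmonomials n"
    then obtain k u' p v q w where x: "x = sc k * (pth u' p * gst v q)" "awalk u' p w" "awalk v q w"
      "n = int (length p) - int (length q)" unfolding hmonomials_def by auto
    have "p \<noteq> []" using x(4) assms(5) by auto
    then obtain e p' where p: "p = e # p'" by (cases p) auto
    have e: "e \<in> arcs E" "u' = tail E e" "awalk (head E e) p' w" using x(2) by (auto simp: p awalk_Cons_iff)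
    have sc: "eps u F * sc k = sc k * eps u F" using S_comm[OF eps_S[OF F(1)]] by simp
    have eq: "eps u F * x = sc k * (eps u F * Ed e * (pth (head E e) p' * gst v q))"
      by (simp add: x(1) p mult.assoc[symmetric] sc)
    show "x \<in> {x. eps u F * x \<in> G}"
    proof (cases "u' = u")
      case True
      then have "eps u F * Ed e \<in> G" using F(2) e by auto
      then have "eps u F * Ed e * (pth (head E e) p' * gst v q) \<in> G"
        by (rule ideal_inD(5)[OF G _ pth_gst_S[OF e(3) x(3)]])
      then show ?thesis unfolding mem_Collect_eq eq by (rule sc_in_ideal[OF G])
    next
      case False
      have uv: "u \<in> verts E" using F(1) by (simp add: adm_def)
      have "V u * Ed e = V u * V (tail E e) * Ed e" using V_Ed[OF e(1)] by (simp add: mult.assoc)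
      also have "\<dots> = 0" using V_V[OF uv, of "tail E e"] e False by auto
      finally have "eps u F * Ed e = 0" using eps_V[OF F(1)] by (metis mult.assoc mult_zero_right)
      then show ?thesis unfolding mem_Collect_eq eq using ideal_inD(2)[OF G] by simp
    qed
  qed
  then have "aspan (hmonomials n) \<subseteq> {x. eps u F * x \<in> G}"
    by (intro aspan_closed_set) (simp_all add: ideal_inD(2)[OF G] distrib_left ideal_in_add[OF G])
  then show ?thesis using assms(4) by (auto simp: hom_part_def)
qed

text \<open>An element of \<open>Q\<close> with fewest components outside \<open>gr P\<close>, normalised to lowest component a
  projection, is central modulo \<open>gr P\<close>, because commutators have fewer such components.\<close>

lemma central_element:
  assumes P: "ideal_in S P" and Q: "ideal_in S Q" "Q \<subseteq> P" "\<not> Q \<subseteq> gr P"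
  shows "\<exists>u F z n. adm u F \<and> (F = {} \<or> (\<forall>e\<in>out_arcs E u. eps u F * Ed e \<in> gr P)) \<and>
     z \<in> Q \<and> eps u F * z * eps u F = z \<and> n > 0 \<and> comp n z \<notin> gr P \<and>
     (\<forall>d y. y \<in> hom_part d \<longrightarrow> eps u F * y * eps u F = y \<longrightarrow> y * comp n z - comp n z * y \<in> gr P)"
proof -
  define G where "G = gr P"
  have G: "ideal_in S G" unfolding G_def by (rule gr_ideal[OF P])
  have GP: "G \<subseteq> P" unfolding G_def by (rule gr_subset[OF P])
  \<comment> \<open>The degrees of the components that survive modulo \<open>G\<close>.\<close>
  define supp where "supp x = {n. comp n x \<notin> G}" for x
  have fin: "finite (supp x)" if "x \<in> S" for x
    by (rule finite_subset[OF _ finite_comp[OF that]]) (use ideal_inD(2)[OF G] in \<open>auto simp: supp_def\<close>)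
  have QS: "x \<in> S" if "x \<in> Q" for x using that ideal_inD(1)[OF Q(1)] by auto
  have in_G: "x \<in> G" if "x \<in> S" "supp x = {}" for x
  proof -
    have "(\<Sum>n\<in>{n. comp n x \<noteq> 0}. comp n x) \<in> G"
      by (rule ideal_in_sum[OF G]) (use that(2) in \<open>auto simp: supp_def\<close>)
    then show ?thesis using sum_comp[OF that(1) finite_comp[OF that(1)]] by simp
  qed
  obtain q0 where "q0 \<in> Q - G" using Q(3) by (auto simp: G_def)
  then obtain q where q: "q \<in> Q" "q \<notin> G" and
    min: "\<And>x. x \<in> Q \<Longrightarrow> card (supp x) < card (supp q) \<Longrightarrow> x \<in> G"
    using ex_has_least_nat[of "\<lambda>x. x \<in> Q - G" q0 "\<lambda>x. card (supp x)"] by (metis Diff_iff not_le)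
  have sq: "supp q \<noteq> {}" "finite (supp q)" using in_G[OF QS[OF q(1)]] q(2) fin[OF QS[OF q(1)]] by auto
  define n0 where "n0 = Min (supp q)"
  have n0: "comp n0 q \<notin> G" "\<And>n. comp n q \<notin> G \<Longrightarrow> n0 \<le> n"
    using Min_in[OF sq(2,1)] Min_le[OF sq(2)] by (auto simp: supp_def n0_def)
  from homogeneous_reduction[OF G comp_hom_part[OF QS[OF q(1)]] n0(1)]
  obtain a b i j u F where ab: "a \<in> hom_part i" "b \<in> hom_part j" "i + n0 + j = 0" "adm u F" "eps u F \<notin> G"
    "F = {} \<or> (\<forall>e\<in>out_arcs E u. eps u F * Ed e \<in> G)" "a * comp n0 q * b = eps u F" by (elim exE conjE)
  define \<epsilon> where "\<epsilon> = eps u F"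
  have \<epsilon>: "\<epsilon> * \<epsilon> = \<epsilon>" "\<epsilon> \<in> S" "\<epsilon> \<in> hom_part 0" "\<epsilon> \<notin> G" "\<epsilon> \<notin> P"
    using eps_eps[OF ab(4,4)] eps_S[OF ab(4)] eps_hom[OF ab(4)] ab(5) eps_gr[OF ab(4)]
    by (auto simp: \<epsilon>_def G_def)
  define z where "z = \<epsilon> * (a * q * b) * \<epsilon>"
  have aS: "a \<in> S" "b \<in> S" using hom_part_S ab by auto
  have zQ: "z \<in> Q" unfolding z_def
    by (intro ideal_inD(4,5)[OF Q(1)] q(1) aS \<epsilon>(2))
  have zz: "\<epsilon> * z * \<epsilon> = z"
    unfolding z_def by (simp add: mult.assoc \<epsilon>(1)) (simp add: \<epsilon>(1) mult.assoc[symmetric])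
  have compz: "comp n z = \<epsilon> * (a * comp (n + n0) q * b) * \<epsilon>" for n
  proof -
    have qS: "q \<in> S" "a * q \<in> S" "a * q * b \<in> S" "\<epsilon> * (a * q * b) \<in> S"
      using QS[OF q(1)] aS \<epsilon>(2) by (auto intro: S_mult)
    have "n - j - i = n + n0" using ab(3) by simp
    then show ?thesis unfolding z_def
      by (simp only: comp_rmult[OF \<epsilon>(3) qS(4)] comp_lmult[OF \<epsilon>(3) qS(3)] comp_rmult[OF ab(2) qS(2)]
          comp_lmult[OF ab(1) qS(1)] diff_zero)
  qed
  have comp0: "comp 0 z = \<epsilon>" using compz[of 0] ab(7) \<epsilon>(1) by (simp add: \<epsilon>_def)
  have suppz: "n + n0 \<in> supp q" if n: "n \<in> supp z" for n
  proof (rule ccontr)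
    assume "n + n0 \<notin> supp q"
    then have "comp (n + n0) q \<in> G" by (simp add: supp_def)
    then have "comp n z \<in> G" unfolding compz by (intro ideal_inD(4,5)[OF G] aS \<epsilon>(2))
    then show False using n by (simp add: supp_def)
  qed
  have pos: "n \<ge> 0" if "n \<in> supp z" for n using suppz[OF that] n0(2)[of "n + n0"] by (simp add: supp_def)
  have card_z: "card (supp z) \<le> card (supp q)"
  proof (rule card_inj_on_le[of "\<lambda>n. n + n0"])
    show "(\<lambda>n. n + n0) ` supp z \<subseteq> supp q" using suppz by auto
  qed (simp_all add: sq)
  have zS: "z \<in> S" by (rule QS[OF zQ])
  have central: "y * comp n z - comp n z * y \<in> G" if y: "y \<in> hom_part d" "\<epsilon> * y * \<epsilon> = y" for y d n
  proof -
    have yS: "y \<in> S" by (rule hom_part_S[OF y(1)])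
    define c where "c = y * z - z * y"
    have cS: "y * z \<in> S" "z * y \<in> S" using yS zS by (auto intro: S_mult)
    have cQ: "c \<in> Q" unfolding c_def
      by (intro ideal_inD(3)[OF Q(1)] ideal_inD(4,5)[OF Q(1)] zQ yS)
    have compc: "comp m c = y * comp (m - d) z - comp (m - d) z * y" for m
      unfolding c_def comp_diff[OF cS] comp_lmult[OF y(1) zS] comp_rmult[OF y(1) zS] ..
    have ye: "y * \<epsilon> = y" "\<epsilon> * y = y" using y(2) \<epsilon>(1) by (metis mult.assoc)+
    \<comment> \<open>The component of degree \<open>d\<close> vanishes since \<open>comp 0 z\<close> is the identity of the corner, so \<open>c\<close> has fewer
      components than \<open>z\<close> and the minimality of \<open>q\<close> applies.\<close>
    have "supp c \<subseteq> (\<lambda>m. m + d) ` (supp z - {0})"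
    proof
      fix m assume m: "m \<in> supp c"
      have "m - d \<noteq> 0"
      proof
        assume "m - d = 0"
        then have "comp m c = 0" unfolding compc using comp0 ye by simp
        then show False using m ideal_inD(2)[OF G] by (simp add: supp_def)
      qed
      moreover have "m - d \<in> supp z"
      proof (rule ccontr)
        assume "m - d \<notin> supp z"
        then have "comp (m - d) z \<in> G" by (simp add: supp_def)
        then have "comp m c \<in> G" unfolding compc
          by (intro ideal_inD(3)[OF G] ideal_inD(4,5)[OF G] yS)
        then show False using m by (simp add: supp_def)
      qed
      ultimately show "m \<in> (\<lambda>m. m + d) ` (supp z - {0})" by (intro image_eqI[of _ _ "m - d"]) auto
    qed
    then have "card (supp c) \<le> card (supp z - {0})"
      using surj_card_le[of "supp z - {0}" "supp c" "\<lambda>m. m + d"] fin[OF zS] by simp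
    also have "\<dots> < card (supp z)"
      using fin[OF zS] comp0 \<epsilon>(4) by (intro card_Diff1_less) (auto simp: supp_def)
    finally have "c \<in> G" using min[OF cQ] card_z by linarith
    then have "comp (n + d) c \<in> G" using comp_gr[OF P] by (simp add: G_def)
    then show ?thesis unfolding compc by simp
  qed
  \<comment> \<open>Otherwise \<open>z\<close> would agree with \<open>\<epsilon>\<close> modulo \<open>G\<close>, but \<open>z \<in> P\<close> and \<open>\<epsilon> \<notin> P\<close>.\<close>
  have "\<exists>n. n \<in> supp z \<and> n \<noteq> 0"
  proof (rule ccontr)
    assume no: "\<not> ?thesis"
    have "z - \<epsilon> \<in> G"
    proof (rule in_G[OF S_diff[OF zS \<epsilon>(2)]])
      have "comp n (z - \<epsilon>) \<in> G" for n
      proof (cases "n = 0")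
        case True
        then show ?thesis using comp_diff[OF zS \<epsilon>(2)] comp0 comp_hom[OF \<epsilon>(3)] ideal_inD(2)[OF G] by simp
      next
        case False
        then show ?thesis using comp_diff[OF zS \<epsilon>(2)] comp_hom[OF \<epsilon>(3)] no by (auto simp: supp_def)
      qed
      then show "supp (z - \<epsilon>) = {}" by (simp add: supp_def)
    qed
    then have "z - \<epsilon> \<in> P" using GP by auto
    then have "\<epsilon> \<in> P" using ideal_in_diff_cancel[OF P, of z \<epsilon>] zQ Q(2) by auto
    then show False using \<epsilon>(5) by simp
  qed
  then obtain n where n: "n \<in> supp z" "n \<noteq> 0" by auto
  then have "n > 0" using pos[OF n(1)] by simp
  moreover have "comp n z \<notin> G" using n by (simp add: supp_def)
  ultimately show ?thesis using ab(4,6) zQ zz central unfolding \<epsilon>_def G_def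
    by (intro exI[of _ u] exI[of _ F] exI[of _ z] exI[of _ n]) auto
qed

end

section \<open>Cycles without exits\<close>

context graded_cohn_family
begin

text \<open>The central component of positive degree given by \<open>central_element\<close> becomes, after its ghost edges have been
  eliminated, a combination \<open>t'\<close> of closed paths of equal length. Commuting with one of these paths, \<open>c\<close>, shows that
  \<open>t'\<close> is a multiple of \<open>c\<close>. The projection \<open>w - c c\<^sup>*\<close> annihilates \<open>c\<close> from the left, hence also from the right, and
  so it vanishes.\<close>

lemma exitless_cycle_exists:
  assumes P: "ideal_in S P" and Q: "ideal_in S Q" "Q \<subseteq> P" "\<not> Q \<subseteq> gr P"
  shows "\<exists>w c z. awalk w c w \<and> c \<noteq> [] \<and> V w \<notin> P \<and> V w - pth w c * gst w c \<in> gr P \<and>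
    z \<in> Q \<and> V w * z * V w = z \<and> z \<notin> gr P"
proof -
  note G = gr_ideal[OF P]
  from central_element[OF assms] obtain u F z n where
    F: "adm u F" "F = {} \<or> (\<forall>e\<in>out_arcs E u. eps u F * Ed e \<in> gr P)"
    and z: "z \<in> Q" "eps u F * z * eps u F = z" and n: "n > 0" "comp n z \<notin> gr P"
    and "\<forall>d y. y \<in> hom_part d \<longrightarrow> eps u F * y * eps u F = y \<longrightarrow> y * comp n z - comp n z * y \<in> gr P"
    by (elim exE conjE)
  then have central: "\<And>d y. y \<in> hom_part d \<Longrightarrow> eps u F * y * eps u F = y \<Longrightarrow> y * comp n z - comp n z * y \<in> gr P"
    by blast
  have u: "u \<in> verts E" using F(1) by (simp add: adm_def)
  have zS: "z \<in> S" using z(1) ideal_inD(1)[OF Q(1)] by auto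
  define t where "t = comp n z"
  have t: "t \<in> hom_part n" "t \<in> S" "t \<notin> gr P"
    using comp_hom_part[OF zS] comp_S[OF zS] n(2) by (simp_all add: t_def)
  have te: "eps u F * t * eps u F = t"
  proof -
    have "comp n (eps u F * z * eps u F) = eps u F * comp n z * eps u F"
      using comp_rmult[OF eps_hom[OF F(1)] S_mult[OF eps_S[OF F(1)] zS], of n]
        comp_lmult[OF eps_hom[OF F(1)] zS, of n] by simp
    then show ?thesis using z(2) by (simp add: t_def)
  qed
  \<comment> \<open>A sink-like projection would take \<open>t\<close>, which has positive degree, into \<open>gr P\<close>.\<close>
  have "F = {}"
  proof (rule ccontr)
    assume "F \<noteq> {}"
    then have "eps u F * t \<in> gr P" using sink_hom[OF G F(1) _ t(1) n(1)] F(2) by blast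
    then have "eps u F * t * eps u F \<in> gr P" by (rule ideal_inD(5)[OF G _ eps_S[OF F(1)]])
    then show False using te t(3) by simp
  qed
  with te have Vt: "V u * t * V u = t" by simp
  have Vz: "V u * z * V u = z" using z(2) \<open>F = {}\<close> by simp
  have tV: "t * V u = t" "V u * t = t" using Vt V_V[OF u u] by (metis mult.assoc)+
  have central': "y * t - t * y \<in> gr P" if "y \<in> hom_part d" "V u * y * V u = y" for d y
    using central[OF that(1)] that(2) \<open>F = {}\<close> by (simp add: t_def)
  from hom_ghost_part[OF t(1) u] obtain m where "t \<in> ghost_part m n u" using tV by auto
  from ghost_elimination[OF G this u t(2,3)] obtain p w F' y where
    p: "awalk u p w" and F': "adm w F'" "F' = {} \<or> (\<forall>e\<in>out_arcs E w. eps w F' * Ed e \<in> gr P)"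
    and y: "y \<in> real_part (n + int (length p)) w" "t * pth u p * eps w F' = y * eps w F'" "y * eps w F' \<notin> gr P"
    by (elim exE conjE)
  have w: "w \<in> verts E" using F'(1) by (simp add: adm_def)
  have pS: "pth u p \<in> S" "gst u p \<in> S" using pth_S[OF p] gst_S[OF p] .
  define t' where "t' = gst u p * t * pth u p"
  have t'S: "t' \<in> S" unfolding t'_def by (intro S_mult pS t(2))
  have gp: "gst u p * pth u p = V w" by (rule gst_pth_same[OF p])
  have conj: "V u * (pth u p * y' * gst u p) * V u = pth u p * y' * gst u p" for y'
    using V_pth[OF p] gst_V[OF p] by (metis mult.assoc)
  have conj_hom: "pth u p * y' * gst u p \<in> hom_part d" if "y' \<in> hom_part d" for y' d
    using hom_part_mult[OF hom_part_mult[OF pth_hom[OF p] that] gst_hom[OF p]] by (simp add: algebra_simps)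
  have central_w: "y' * t' - t' * y' \<in> gr P" if y': "y' \<in> hom_part d" "V w * y' * V w = y'" for y' d
  proof -
    define Y where "Y = pth u p * y' * gst u p"
    have "Y * t - t * Y \<in> gr P"
      unfolding Y_def by (rule central'[OF conj_hom[OF y'(1)] conj])
    then have "gst u p * (Y * t - t * Y) * pth u p \<in> gr P"
      by (intro ideal_inD(4,5)[OF G] pS)
    moreover have y'V: "V w * y' = y'" "y' * V w = y'" using y'(2) V_V[OF w w] by (metis mult.assoc)+
    moreover have "gst u p * (Y * t) * pth u p = y' * t'"
    proof -
      have "gst u p * (Y * t) * pth u p = (gst u p * pth u p) * y' * (gst u p * t * pth u p)"
        by (simp add: Y_def mult.assoc)
      then show ?thesis unfolding gp t'_def[symmetric] y'V(1) .
    qed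
    moreover have "gst u p * (t * Y) * pth u p = t' * y'"
    proof -
      have "gst u p * (t * Y) * pth u p = (gst u p * t * pth u p) * (y' * (gst u p * pth u p))"
        by (simp add: Y_def mult.assoc)
      then show ?thesis unfolding gp t'_def[symmetric] y'V(2) .
    qed
    ultimately show ?thesis by (simp add: right_diff_distrib left_diff_distrib)
  qed
  \<comment> \<open>The projection \<open>eps w F'\<close>, conjugated by \<open>p\<close>, has degree zero, so \<open>t\<close> commutes with it.\<close>
  have comm_p: "t * pth u p * eps w F' - pth u p * eps w F' * (gst u p * t * pth u p * eps w F') \<in> gr P"
  proof -
    define Y where "Y = pth u p * eps w F' * gst u p"
    have "Y * t - t * Y \<in> gr P"
      unfolding Y_def by (rule central'[OF conj_hom[OF eps_hom[OF F'(1)]] conj])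
    then have "- ((Y * t - t * Y) * (pth u p * eps w F')) \<in> gr P"
      by (intro ideal_in_uminus[OF G] ideal_inD(5)[OF G] S_mult pS eps_S F'(1))
    moreover have "t * Y * (pth u p * eps w F') = t * pth u p * eps w F'"
    proof -
      have "t * Y * (pth u p * eps w F') = t * pth u p * (eps w F' * ((gst u p * pth u p) * eps w F'))"
        by (simp add: Y_def mult.assoc)
      then show ?thesis unfolding gp V_eps[OF F'(1)] eps_eps[OF F'(1) F'(1)] by simp
    qed
    moreover have "Y * t * (pth u p * eps w F') = pth u p * eps w F' * (gst u p * t * pth u p * eps w F')"
      by (simp add: Y_def mult.assoc)
    ultimately show ?thesis by (simp add: left_diff_distrib)
  qed
  have tp: "t * pth u p * eps w F' \<notin> gr P" using y(2,3) by simp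
  have t'_hom: "t' \<in> hom_part n"
    unfolding t'_def using hom_part_mult[OF hom_part_mult[OF gst_hom[OF p] t(1)] pth_hom[OF p]] by simp
  have "F' = {}"
  proof (rule ccontr)
    assume "F' \<noteq> {}"
    then have "eps w F' * t' \<in> gr P" using sink_hom[OF G F'(1) _ t'_hom n(1)] F'(2) by blast
    then have "pth u p * (eps w F' * t') * eps w F' \<in> gr P"
      by (rule ideal_inD(5)[OF G ideal_inD(4)[OF G _ pS(1)] eps_S[OF F'(1)]])
    then have "pth u p * eps w F' * (gst u p * t * pth u p * eps w F') \<in> gr P"
      by (simp add: t'_def mult.assoc)
    then show False using comm_p tp ideal_in_diff_cancel[OF G comm_p] by blast
  qed
  then have ty: "t * pth u p = y" using y(2) real_part_V[OF y(1)] pth_V[OF p] by (simp add: mult.assoc)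
  have t'y: "t' = gst u p * y" by (simp add: t'_def mult.assoc ty[symmetric])
  have t'_real: "t' \<in> real_part n w" unfolding t'y by (rule real_part_strip[OF y(1) p]) (use n(1) in simp)
  have t'V: "t' * V w = t'" "V w * t' = t'"
    using real_part_V[OF t'_real] V_gst[OF p] by (simp_all add: t'_def mult.assoc[symmetric])
  have t'G: "t' \<notin> gr P"
  proof
    assume "t' \<in> gr P"
    then have "pth u p * eps w F' * (t' * eps w F') \<in> gr P"
      by (intro ideal_inD(4,5)[OF G] S_mult pS eps_S F'(1))
    then have "pth u p * eps w F' * (gst u p * t * pth u p * eps w F') \<in> gr P" by (simp add: t'_def)
    then show False using tp ideal_in_diff_cancel[OF G comm_p] by blast
  qed
  have VwP: "V w \<notin> P"
  proof
    assume "V w \<in> P"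
    then have "V w \<in> gr P" by (rule V_gr[OF w])
    then have "V w * t' \<in> gr P" by (rule ideal_inD(5)[OF G _ t'S])
    then show False using t'V t'G by simp
  qed
  have "t' \<noteq> 0" using t'G ideal_inD(2)[OF G] by auto
  from real_part_coeff[OF t'_real this] obtain w' c k where
    c: "awalk w' c w" "int (length c) = n" "k \<noteq> 0" "gst w' c * t' = sc k * V w" by (elim exE conjE)
  have "w' = w"
  proof (rule ccontr)
    assume "w' \<noteq> w"
    then have "gst w' c * V w = 0" using gst_V_0[OF c(1) w] by simp
    then have "gst w' c * t' = 0" using t'V(2) by (metis mult.assoc mult_zero_left)
    then have "sc k * V w \<in> P" using c(4) ideal_inD(2)[OF P] by simp
    then show False using sc_cancel[OF P V_S[OF w] c(3)] VwP by simp
  qed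
  note c = c[unfolded this]
  have cS: "pth w c \<in> S" "gst w c \<in> S" using pth_S[OF c(1)] gst_S[OF c(1)] .
  have gc: "gst w c * pth w c = V w" by (rule gst_pth_same[OF c(1)])
  have Vc: "V w * pth w c = pth w c" "pth w c * V w = pth w c" "V w * gst w c = gst w c" "gst w c * V w = gst w c"
    using V_pth[OF c(1)] pth_V[OF c(1)] V_gst[OF c(1)] gst_V[OF c(1)] by simp_all
  \<comment> \<open>Centrality turns \<open>t'\<close> into a multiple of the single closed path \<open>c\<close>.\<close>
  have t'c: "t' - sc k * pth w c \<in> gr P"
  proof -
    have "pth w c * t' - t' * pth w c \<in> gr P"
      by (rule central_w[OF pth_hom[OF c(1)]]) (simp add: Vc mult.assoc)
    then have "gst w c * (pth w c * t' - t' * pth w c) \<in> gr P" by (rule ideal_inD(4)[OF G _ cS(2)])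
    moreover have "gst w c * (pth w c * t' - t' * pth w c) = t' - sc k * pth w c"
      using gc t'V(2) c(4) Vc(1) by (simp add: right_diff_distrib) (metis mult.assoc)
    ultimately show ?thesis by simp
  qed
  define x where "x = V w - pth w c * gst w c"
  have xS: "x \<in> S" unfolding x_def by (intro S_diff V_S w S_mult cS)
  have x_hom: "x \<in> hom_part 0"
    unfolding x_def using hom_part_mult[OF pth_hom[OF c(1)] gst_hom[OF c(1)]]
    by (intro hom_part_diff V_hom w) simp
  have xc: "x * pth w c = 0" using gc Vc by (simp add: x_def left_diff_distrib mult.assoc)
  have Vx: "V w * x = x" "x * V w = x" using Vc V_V[OF w w]
    by (simp_all add: x_def left_diff_distrib right_diff_distrib mult.assoc) (simp add: mult.assoc[symmetric] Vc)
  \<comment> \<open>Modulo \<open>gr P\<close>, \<open>0 = x t' = t' x = k c x\<close>, and \<open>c\<^sup>* c x = x\<close>.\<close>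
  have "x \<in> gr P"
  proof -
    have 1: "x * t' - t' * x \<in> gr P" by (rule central_w[OF x_hom]) (simp add: Vx)
    have "x * (t' - sc k * pth w c) \<in> gr P" by (rule ideal_inD(4)[OF G t'c xS])
    moreover have "x * (sc k * pth w c) = 0"
      using S_comm[OF xS, of k] xc by (metis mult.assoc mult_zero_right)
    ultimately have "x * t' \<in> gr P" by (simp add: right_diff_distrib)
    then have 2: "t' * x \<in> gr P" using ideal_in_diff_cancel[OF G 1] by simp
    have "(t' - sc k * pth w c) * x \<in> gr P" by (rule ideal_inD(5)[OF G t'c xS])
    from ideal_inD(3)[OF G 2 this] have "sc k * (pth w c * x) \<in> gr P"
      by (simp add: left_diff_distrib mult.assoc)
    then have "pth w c * x \<in> gr P" by (rule sc_cancel[OF G S_mult[OF cS(1) xS] c(3)])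
    then have "gst w c * (pth w c * x) \<in> gr P" by (rule ideal_inD(4)[OF G _ cS(2)])
    then show ?thesis using gc Vx by (simp add: mult.assoc[symmetric])
  qed
  define z' where "z' = gst u p * z * pth u p"
  have "comp n z' = t'"
  proof -
    have "n - int (length p) - - int (length p) = n" by simp
    then show ?thesis unfolding z'_def t'_def t_def
      using comp_rmult[OF pth_hom[OF p] S_mult[OF pS(2) zS], of n]
        comp_lmult[OF gst_hom[OF p] zS, of "n - int (length p)"] by simp
  qed
  then have "z' \<notin> gr P" using comp_gr[OF P, of z' n] t'G by auto
  moreover have "z' \<in> Q" unfolding z'_def by (intro ideal_inD(4,5)[OF Q(1)] z(1) pS)
  moreover have "V w * z' * V w = z'" unfolding z'_def using V_gst[OF p] pth_V[OF p] by (metis mult.assoc)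
  moreover have "c \<noteq> []" using c(2) n(1) by auto
  ultimately show ?thesis using c(1) VwP \<open>x \<in> gr P\<close> unfolding x_def by metis
qed

end

text \<open>A closed walk \<open>c\<close> without exits modulo the graded part of \<open>P\<close>. By \<open>c_min\<close> it is not a power of a shorter closed
  walk, which makes its powers the only closed walks at \<open>w\<close>.\<close>

locale exitless_cycle = graded_cohn_family E V Ed Gh sc comp
  for E :: "('v, 'e) pre_digraph" and V :: "'v \<Rightarrow> 'r::ring" and Ed Gh :: "'e \<Rightarrow> 'r"
    and sc :: "'k::field \<Rightarrow> 'r" and comp :: "int \<Rightarrow> 'r \<Rightarrow> 'r" +
  fixes P :: "'r set" and w :: 'v and c :: "'e list"
  assumes P: "ideal_in S P" and c_walk: "awalk w c w" and c_ne: "c \<noteq> []" and w_P: "V w \<notin> P"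
    and c_exitless: "V w - pth w c * gst w c \<in> gr P"
    and c_min: "c = a @ b \<Longrightarrow> a \<noteq> [] \<Longrightarrow> awalk w a w \<Longrightarrow> b = []"
begin

abbreviation "G \<equiv> gr P"
lemmas G = gr_ideal[OF P]

lemma w: "w \<in> verts E" using awalk_verts(1)[OF c_walk] .
lemma w_G: "V w \<notin> G" using gr_subset[OF P] w_P by auto

definition cyc :: "nat \<Rightarrow> 'e list" where "cyc n = concat (replicate n c)"
definition C :: "nat \<Rightarrow> 'r" where "C n = pth w (cyc n)"
definition D :: "nat \<Rightarrow> 'r" where "D n = gst w (cyc n)"

lemma cyc_0: "cyc 0 = []" and cyc_Suc: "cyc (Suc n) = c @ cyc n" and cyc_1: "cyc 1 = c"
  by (simp_all add: cyc_def)

lemma cyc_add: "cyc (m + n) = cyc m @ cyc n"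
  by (simp add: cyc_def replicate_add)

lemma cyc_walk: "awalk w (cyc n) w"
proof (induction n)
  case (Suc n)
  show ?case unfolding cyc_Suc by (rule awalk_appendI[OF c_walk Suc])
qed (simp add: cyc_0 awalk_Nil_iff w)

lemma length_cyc: "length (cyc n) \<ge> n"
proof (induction n)
  case (Suc n)
  have "length c \<ge> 1" using c_ne by (cases c) auto
  then show ?case using Suc by (simp add: cyc_Suc)
qed simp

lemma C_0 [simp]: "C 0 = V w" by (simp add: C_def cyc_0)
lemma C_1: "C 1 = pth w c" and D_1: "D 1 = gst w c" by (simp_all only: C_def D_def cyc_1)

lemma C_add: "C (m + n) = C m * C n"
  unfolding C_def cyc_add by (rule pth_append[OF cyc_walk cyc_walk])

lemma C_Suc: "C (Suc n) = pth w c * C n"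
  using C_add[of 1 n] C_1 by simp

lemma D_add: "D (m + n) = D m * D n"
  using gst_append[OF cyc_walk[of n] cyc_walk[of m]] cyc_add[of n m] by (simp add: D_def add.commute)

lemma C_S: "C n \<in> S" and D_S: "D n \<in> S"
  unfolding C_def D_def by (rule pth_S[OF cyc_walk], rule gst_S[OF cyc_walk])

lemma D_C: "D n * C n = V w" unfolding C_def D_def by (rule gst_pth_same[OF cyc_walk])

lemma V_C: "V w * C n = C n" "C n * V w = C n" "V w * D n = D n" "D n * V w = D n"
  unfolding C_def D_def by (rule V_pth[OF cyc_walk] pth_V[OF cyc_walk] V_gst[OF cyc_walk] gst_V[OF cyc_walk])+

lemma exitless_pow:
  assumes J: "ideal_in S J" "V w - pth w c * gst w c \<in> J" shows "V w - C n * D n \<in> J"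
proof (induction n)
  case 0
  then show ?case using V_V[OF w w] ideal_inD(2)[OF J(1)] by (simp add: D_def cyc_0)
next
  case (Suc n)
  have "C n * (V w - pth w c * gst w c) * D n \<in> J" by (intro ideal_inD(4,5)[OF J(1)] J(2) C_S D_S)
  moreover have "C n * (V w - pth w c * gst w c) * D n = C n * D n - C (Suc n) * D (Suc n)"
    using C_add[of n 1] D_add[of 1 n] C_1 D_1 V_C
    by (simp add: right_diff_distrib left_diff_distrib mult.assoc)
  ultimately show ?case using ideal_in_add[OF J(1) Suc] by fastforce
qed

lemma CD: "V w - C n * D n \<in> G" by (rule exitless_pow[OF G c_exitless])

text \<open>Since \<open>c\<close> has no exits, a walk from \<open>w\<close> that does not follow it ends in \<open>G\<close>.\<close>

lemma walk_in_cycle: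
  assumes "awalk w p u" "V u \<notin> G" shows "\<exists>t. awalk u t w \<and> cyc (length p) = p @ t"
proof -
  let ?n = "length p"
  have "(V w - C ?n * D ?n) * pth w p \<in> G" by (rule ideal_inD(5)[OF G CD pth_S[OF assms(1)]])
  then have *: "pth w p - C ?n * (D ?n * pth w p) \<in> G"
    using V_pth[OF assms(1)] by (simp add: left_diff_distrib mult.assoc)
  have nG: "pth w p \<notin> G" using pth_in_ideal[OF G assms(1)] assms(2) by simp
  from gst_pth_cases[OF cyc_walk assms(1), of ?n] show ?thesis
  proof (elim disjE exE conjE)
    fix t assume t: "p = cyc ?n @ t" "awalk w t u"
    have "length p = length (cyc ?n) + length t" using arg_cong[OF t(1), of length] by simp
    then have "length t = 0" using length_cyc[of ?n] by linarith
    then have "t = []" by simp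
    then show ?thesis using t awalk_verts(2)[OF assms(1)] w by (intro exI[of _ "[]"]) (auto simp: awalk_Nil_iff)
  next
    fix t assume "cyc ?n = p @ t" "awalk u t w"
    then show ?thesis by auto
  next
    assume "gst w (cyc ?n) * pth w p = 0"
    then show ?thesis using * nG by (simp add: D_def)
  qed
qed

lemma closed_walk:
  assumes "awalk w p w" shows "\<exists>k. p = cyc k"
proof -
  have *: "\<exists>k. p = cyc k" if "awalk w p w" "cyc n = p @ t" for n p t
    using that
  proof (induction n arbitrary: p)
    case 0
    then show ?case by (intro exI[of _ 0]) (simp add: cyc_0)
  next
    case (Suc n)
    show ?case
    proof (cases "p = []")
      case True
      then show ?thesis by (intro exI[of _ 0]) (simp add: cyc_0)
    next
      case False
      have "c @ cyc n = p @ t" using Suc.prems(2) by (simp add: cyc_Suc)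
      then consider r where "c = p @ r" | r where "p = c @ r" "cyc n = r @ t"
        by (auto simp: append_eq_append_conv2)
      then show ?thesis
      proof cases
        case 1
        then have "r = []" using c_min[OF _ False Suc.prems(1)] by simp
        then show ?thesis using 1 cyc_1 by (intro exI[of _ 1]) simp
      next
        case 2
        have "awalk w r w" using Suc.prems(1) awalk_awlast[OF c_walk] by (simp add: 2(1) awalk_append_iff)
        from Suc.IH[OF this 2(2)] obtain k where "r = cyc k" ..
        then show ?thesis using 2(1) by (intro exI[of _ "Suc k"]) (simp add: cyc_Suc)
      qed
    qed
  qed
  from walk_in_cycle[OF assms w_G] obtain t where "cyc (length p) = p @ t" by auto
  from *[OF assms this] show ?thesis .
qed

text \<open>Both walks extend along the cycle by the same walk \<open>t\<close> to closed walks, and the range of \<open>t\<close> may be inserted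
  between them as \<open>t\<close> has no exits.\<close>

lemma monomial_in_corner:
  assumes p: "awalk w p u" and q: "awalk w q u" and u: "V u \<notin> G"
  shows "\<exists>i j. pth w p * gst w q - C i * D j \<in> G"
proof -
  let ?n = "length p"
  from walk_in_cycle[OF p u] obtain t where t: "awalk u t w" "cyc ?n = p @ t" by auto
  from closed_walk[OF awalk_appendI[OF q t(1)]] obtain j where j: "q @ t = cyc j" ..
  have C: "C ?n = pth w p * pth u t" unfolding C_def t(2) by (rule pth_append[OF p t(1)])
  have Dn: "D ?n = gst u t * gst w p" unfolding D_def t(2) by (rule gst_append[OF p t(1)])
  have Dj: "D j = gst u t * gst w q" unfolding D_def j[symmetric] by (rule gst_append[OF q t(1)])
  have "(V w - C ?n * D ?n) * (pth w p * gst w q) \<in> G"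
    by (intro ideal_inD(5)[OF G CD] S_mult pth_S[OF p] gst_S[OF q])
  moreover have "C ?n * D ?n * (pth w p * gst w q) = C ?n * D j"
  proof -
    have "C ?n * D ?n * (pth w p * gst w q) = C ?n * (gst u t * (gst w p * pth w p) * gst w q)"
      unfolding Dn by (simp add: mult.assoc)
    then show ?thesis unfolding gst_pth_same[OF p] gst_V[OF t(1)] Dj .
  qed
  moreover have "V w * (pth w p * gst w q) = pth w p * gst w q"
    using V_pth[OF p] by (simp add: mult.assoc[symmetric])
  ultimately show ?thesis by (metis left_diff_distrib)
qed

section \<open>Polynomials in an exitless cycle\<close>

text \<open>The value of a polynomial at the cycle.\<close>

definition ev :: "'k poly \<Rightarrow> 'r" where
  "ev g = fold_coeffs (\<lambda>a x. sc a * V w + pth w c * x) g 0"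

lemma ev_0 [simp]: "ev 0 = 0" by (simp add: ev_def)

lemma ev_pCons: "ev (pCons a g) = sc a * V w + pth w c * ev g"
  by (cases "a = 0 \<and> g = 0") (auto simp: ev_def)

lemma ev_S: "ev g \<in> S"
  by (induction g) (auto simp: ev_pCons S_0 intro!: S_add sc_S V_S w S_mult pth_S[OF c_walk])

lemma V_ev: "V w * ev g = ev g"
proof (induction g)
  case (pCons a g)
  have "V w * (sc a * V w) = sc a * V w" using S_comm[OF V_S[OF w], of a] V_V[OF w w] by (metis mult.assoc)
  moreover have "V w * (pth w c * ev g) = pth w c * ev g" using V_pth[OF c_walk] by (simp add: mult.assoc[symmetric])
  ultimately show ?case by (simp add: ev_pCons distrib_left)
qed simp

lemma ev_V: "ev g * V w = ev g"
  by (induction g) (simp_all add: ev_pCons distrib_right mult.assoc V_V w)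

lemma ev_add: "ev (g + h) = ev g + ev h"
proof (induction g h rule: poly_induct2)
  case (pCons a g b h)
  then show ?case by (simp add: ev_pCons sc_add distrib_left distrib_right add.assoc add.left_commute)
qed simp

lemma ev_smult: "ev (smult a g) = sc a * ev g"
proof (induction g)
  case (pCons b g)
  have "sc a * pth w c = pth w c * sc a" by (rule sc_pth[OF c_walk])
  then show ?case using pCons.IH by (simp add: ev_pCons sc_mult distrib_left mult.assoc[symmetric])
qed simp

lemma ev_mult: "ev (g * h) = ev g * ev h"
proof (induction g)
  case (pCons a g)
  have "ev (pCons a g * h) = sc a * ev h + pth w c * (ev g * ev h)"
    by (simp add: ev_add ev_smult ev_pCons pCons.IH)
  also have "sc a * ev h = sc a * V w * ev h" using V_ev by (simp add: mult.assoc)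
  finally show ?case by (simp add: ev_pCons distrib_right mult.assoc)
qed simp

lemma ev_monom: "ev (monom a n) = sc a * C n"
proof (induction n)
  case 0
  then show ?case by (simp add: monom_0 ev_pCons)
next
  case (Suc n)
  have "sc a * pth w c = pth w c * sc a" by (rule sc_pth[OF c_walk])
  then show ?case using Suc by (simp add: monom_Suc ev_pCons C_Suc mult.assoc[symmetric])
qed

lemma ev_monom_1: "ev (monom 1 n) = C n"
  by (simp add: ev_monom S_one C_S)

lemma ev_1: "ev 1 = V w"
  using ev_monom_1[of 0] by (simp add: monom_0 one_pCons)

lemma comp_ev_neg: "n < 0 \<Longrightarrow> comp n (ev g) = 0"
proof (induction g arbitrary: n)
  case (pCons a g)
  have "comp n (sc a * V w) = 0" using comp_hom[OF sc_hom[OF V_hom[OF w]], of n] pCons.prems by simp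
  moreover have "comp n (pth w c * ev g) = 0"
    using comp_lmult[OF pth_hom[OF c_walk] ev_S] pCons.IH[of "n - int (length c)"] pCons.prems by simp
  ultimately show ?case unfolding ev_pCons
    using comp_add[OF sc_S[OF V_S[OF w]] S_mult[OF pth_S[OF c_walk] ev_S]] by simp
qed simp

text \<open>The constant term is the component of degree zero, so by the grading it vanishes; the remaining
  polynomial can be divided by the cycle.\<close>

lemma ev_in_G: "ev g \<in> G \<Longrightarrow> g = 0"
proof (induction g)
  case (pCons a g)
  have "comp 0 (ev (pCons a g)) \<in> G" by (rule comp_gr[OF P pCons.prems])
  moreover have "comp 0 (ev (pCons a g)) = sc a * V w"
    unfolding ev_pCons
    using comp_add[OF sc_S[OF V_S[OF w]] S_mult[OF pth_S[OF c_walk] ev_S]]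
      comp_hom[OF sc_hom[OF V_hom[OF w]], of 0] comp_lmult[OF pth_hom[OF c_walk] ev_S, of 0]
      comp_ev_neg[of "- int (length c)" g] c_ne by simp
  ultimately have "sc a * V w \<in> G" by simp
  then have a: "a = 0" using sc_cancel[OF G V_S[OF w]] w_G by blast
  then have "pth w c * ev g \<in> G" using pCons.prems by (simp add: ev_pCons)
  then have "gst w c * (pth w c * ev g) \<in> G" by (rule ideal_inD(4)[OF G _ gst_S[OF c_walk]])
  then have "ev g \<in> G" using gst_pth_same[OF c_walk] V_ev by (simp add: mult.assoc[symmetric])
  then show ?case using pCons.IH a by simp
qed simp

definition corner :: "'r \<Rightarrow> bool" where "corner d \<longleftrightarrow> d \<in> S \<and> V w * d * V w = d"

lemma corner_ev: "corner (ev g)" by (simp add: corner_def ev_S V_ev ev_V)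

lemma cornerD: assumes "corner d" shows "d \<in> S" "V w * d = d" "d * V w = d"
  using assms V_V[OF w w] unfolding corner_def by (metis mult.assoc)+

lemma corner_mult: "corner d \<Longrightarrow> corner e \<Longrightarrow> corner (d * e)"
  unfolding corner_def[of "d * e"] using cornerD by (metis S_mult mult.assoc)

lemma corner_C: "corner (C n)"
  unfolding corner_def using C_S V_C by (simp add: mult.assoc)

lemma corner_VxV: "x \<in> S \<Longrightarrow> corner (V w * x * V w)"
  unfolding corner_def using V_V[OF w w] by (simp add: S_mult V_S w mult.assoc) (simp add: mult.assoc[symmetric])

text \<open>Clearing denominators: in the corner at \<open>w\<close> modulo \<open>G\<close>, which is a ring of Laurent polynomials
  in the cycle, \<open>d\<close> is \<open>g(c) / c^N\<close>.\<close>

definition rep :: "'r \<Rightarrow> nat \<Rightarrow> 'k poly \<Rightarrow> bool" where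
  "rep d N g \<longleftrightarrow> corner d \<and> d * C N - ev g \<in> G"

lemma rep_raise: assumes "rep d N g" shows "rep d (N + M) (g * monom 1 M)"
proof -
  have "(d * C N - ev g) * C M \<in> G" using assms C_S ideal_inD(5)[OF G] by (simp add: rep_def)
  then show ?thesis using assms
    by (simp add: rep_def C_add ev_mult ev_monom_1 left_diff_distrib mult.assoc)
qed

lemma rep_add: assumes "rep d N g" "rep e M h" shows "\<exists>K k. rep (d + e) K k"
proof -
  have 1: "rep d (N + M) (g * monom 1 M)" by (rule rep_raise[OF assms(1)])
  have 2: "rep e (N + M) (h * monom 1 N)" using rep_raise[OF assms(2), of N] by (simp add: add.commute)
  have "rep (d + e) (N + M) (g * monom 1 M + h * monom 1 N)"
    using 1 2 ideal_in_add[OF G, of "d * C (N + M) - ev (g * monom 1 M)" "e * C (N + M) - ev (h * monom 1 N)"]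
    by (simp add: rep_def corner_def S_add distrib_left distrib_right ev_add add_diff_add)
  then show ?thesis by auto
qed

lemma rep_VxV: assumes "x \<in> S" shows "\<exists>N g. rep (V w * x * V w) N g"
  using assms unfolding S_def
proof (induction x rule: aspan.induct)
  case zero
  have "rep (V w * 0 * V w) 0 0" using ideal_inD(2)[OF G] by (simp add: rep_def corner_def S_0)
  then show ?case by blast
next
  case (plus x y)
  have "\<exists>N g. rep (V w * x * V w) N g"
  proof -
    from plus.hyps(1) obtain k u p v q z where x: "x = sc k * (pth u p * gst v q)" "awalk u p z" "awalk v q z"
      unfolding monomials_def by auto
    have xS: "x \<in> S" using sc_S[OF pth_gst_S[OF x(2,3)]] by (simp add: x(1))
    have cx: "corner (V w * x * V w)" by (rule corner_VxV[OF xS])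
    have eq: "V w * x * V w = sc k * ((V w * pth u p) * (gst v q * V w))"
    proof -
      have "V w * sc k = sc k * V w" using S_comm[OF V_S[OF w]] by simp
      then have "V w * (sc k * (pth u p * gst v q)) = sc k * (V w * (pth u p * gst v q))"
        by (metis mult.assoc)
      then show ?thesis by (simp add: x(1) mult.assoc)
    qed
    show ?thesis
    proof (cases "u = w \<and> v = w \<and> V z \<notin> G")
      case True
      then have uv: "u = w" "v = w" "V z \<notin> G" by auto
      have eq': "V w * x * V w = sc k * (pth w p * gst w q)"
        unfolding eq using V_pth[OF x(2)] gst_V[OF x(3)] uv by simp
      from monomial_in_corner[of p z q] x(2,3) uv obtain i j where
        ij: "pth w p * gst w q - C i * D j \<in> G" by auto
      have "sc k * ((pth w p * gst w q - C i * D j) * C j) \<in> G"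
        by (intro sc_in_ideal[OF G] ideal_inD(5)[OF G ij] C_S)
      moreover have "C i * D j * C j = C i" using D_C V_C by (simp add: mult.assoc)
      ultimately have "V w * x * V w * C j - ev (monom k i) \<in> G"
        unfolding eq' ev_monom by (simp add: left_diff_distrib right_diff_distrib mult.assoc)
      then have "rep (V w * x * V w) j (monom k i)" using cx by (simp add: rep_def)
      then show ?thesis by blast
    next
      case False
      have "V w * x * V w \<in> G"
      proof (cases "u = w \<and> v = w")
        case True
        then have "V z \<in> G" using False by simp
        then have "pth u p \<in> G" using pth_in_ideal[OF G x(2)] by simp
        then have "x \<in> G" unfolding x(1) by (intro sc_in_ideal[OF G] ideal_inD(5)[OF G] gst_S[OF x(3)])
        then show ?thesis by (intro ideal_inD(4,5)[OF G] V_S w)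
      next
        case False
        then have "V w * pth u p = 0 \<or> gst v q * V w = 0"
          using V_pth_0[OF x(2) w] gst_V_0[OF x(3) w] by auto
        then have "V w * x * V w = 0" unfolding eq by auto
        then show ?thesis using ideal_inD(2)[OF G] by simp
      qed
      then have "rep (V w * x * V w) 0 0" using cx cornerD(3)[OF cx] by (simp add: rep_def)
      then show ?thesis by blast
    qed
  qed
  then obtain N g where 1: "rep (V w * x * V w) N g" by auto
  from plus.IH obtain M h where 2: "rep (V w * y * V w) M h" by auto
  have "V w * (x + y) * V w = V w * x * V w + V w * y * V w" by (simp add: distrib_left distrib_right)
  then show ?case using rep_add[OF 1 2] by simp
qed

lemma rep_exists: assumes "corner d" shows "\<exists>N g. rep d N g"
  using rep_VxV[of d] assms by (simp add: corner_def)

lemma rep_ev: "rep (ev g) 0 g"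
  using corner_ev ev_V ideal_inD(2)[OF G] by (simp add: rep_def)

text \<open>Powers of the cycle are invertible in the corner modulo \<open>G\<close>.\<close>

lemma C_cancel:
  assumes "ideal_in S J" "G \<subseteq> J" "corner d" "d * C N \<in> J" shows "d \<in> J"
proof -
  have "d * (V w - C N * D N) \<in> J" using ideal_inD(4)[OF G CD cornerD(1)[OF assms(3)]] assms(2) by auto
  moreover have "d * C N * D N \<in> J" by (rule ideal_inD(5)[OF assms(1,4) D_S])
  ultimately have "d * (V w - C N * D N) + d * C N * D N \<in> J" by (rule ideal_in_add[OF assms(1)])
  then show ?thesis using cornerD(3)[OF assms(3)] by (simp add: right_diff_distrib mult.assoc)
qed

lemma rep_in_ideal:
  assumes "ideal_in S J" "G \<subseteq> J" "rep d N g" shows "d \<in> J \<longleftrightarrow> ev g \<in> J"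
proof -
  have d: "corner d" "d * C N - ev g \<in> J" using assms by (auto simp: rep_def)
  have "d * C N \<in> J \<longleftrightarrow> ev g \<in> J" by (rule ideal_in_diff_cancel[OF assms(1) d(2)])
  moreover have "d \<in> J \<Longrightarrow> d * C N \<in> J" by (rule ideal_inD(5)[OF assms(1) _ C_S])
  ultimately show ?thesis using C_cancel[OF assms(1,2) d(1)] by blast
qed

lemma C_comm: assumes "corner e" shows "C N * e - e * C N \<in> G"
proof -
  from rep_exists[OF assms] obtain M h where h: "e * C M - ev h \<in> G" by (auto simp: rep_def)
  have eS: "e \<in> S" by (rule cornerD(1)[OF assms])
  have hN: "C N * ev h = ev h * C N"
    using ev_mult[of "monom 1 N" h] ev_mult[of h "monom 1 N"] by (simp add: ev_monom_1 mult.commute)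
  have CC: "C M * C N = C N * C M" using C_add[of M N] C_add[of N M] by (simp add: add.commute)
  have "C N * (e * C M - ev h) - (e * C M - ev h) * C N \<in> G"
    by (intro ideal_inD(3)[OF G] ideal_inD(4,5)[OF G] h C_S)
  moreover have "C N * (e * C M - ev h) - (e * C M - ev h) * C N = (C N * e - e * C N) * C M"
    using hN CC by (simp add: right_diff_distrib left_diff_distrib mult.assoc)
  ultimately have "(C N * e - e * C N) * C M \<in> G" by simp
  moreover have "corner (C N * e - e * C N)"
    using corner_mult[OF corner_C assms] corner_mult[OF assms corner_C]
    by (simp add: corner_def S_diff right_diff_distrib left_diff_distrib)
  ultimately show ?thesis using C_cancel[OF G] by blast
qed

lemma rep_mult: assumes "rep d N g" "rep e M h" shows "rep (d * e) (N + M) (g * h)"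
proof -
  have de: "corner d" "corner e" and d: "d * C N - ev g \<in> G" and e: "e * C M - ev h \<in> G"
    using assms by (auto simp: rep_def)
  have S: "d \<in> S" "e \<in> S" using cornerD(1) de by auto
  have "d * (C N * e - e * C N) * C M \<in> G" by (intro ideal_inD(4,5)[OF G] C_comm de S C_S)
  moreover have "(d * C N - ev g) * (e * C M) \<in> G" by (intro ideal_inD(5)[OF G d] S_mult S C_S)
  moreover have "ev g * (e * C M - ev h) \<in> G" by (intro ideal_inD(4)[OF G e] ev_S)
  ultimately have "(d * C N - ev g) * (e * C M) + ev g * (e * C M - ev h) - d * (C N * e - e * C N) * C M \<in> G"
    by (intro ideal_inD(3)[OF G] ideal_in_add[OF G])
  then have "d * e * C (N + M) - ev (g * h) \<in> G"
    by (simp add: C_add ev_mult right_diff_distrib left_diff_distrib mult.assoc)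
  then show ?thesis using corner_mult[OF de] by (simp add: rep_def)
qed

lemma rep_unique: assumes "rep d N g" "rep d M h" shows "g * monom 1 M = h * monom 1 N"
proof -
  have 1: "d * C (N + M) - ev (g * monom 1 M) \<in> G" using rep_raise[OF assms(1)] by (simp add: rep_def)
  have 2: "d * C (N + M) - ev (h * monom 1 N) \<in> G"
    using rep_raise[OF assms(2), of N] by (simp add: rep_def add.commute)
  have "ev (g * monom 1 M - h * monom 1 N) = ev (g * monom 1 M) - ev (h * monom 1 N)"
    using ev_add[of "g * monom 1 M - h * monom 1 N" "h * monom 1 N"] by simp
  also have "\<dots> \<in> G" using ideal_inD(3)[OF G 2 1] by simp
  finally show ?thesis using ev_in_G by fastforce
qed

text \<open>The corner is commutative modulo \<open>G\<close>, so primeness may be tested on products of polynomials.\<close>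

lemma ev_prime:
  assumes J: "prime_in S J" "G \<subseteq> J" and "ev (g * h) \<in> J" shows "ev g \<in> J \<or> ev h \<in> J"
proof (rule prime_inD(3)[OF J(1) ev_S ev_S])
  note JI = prime_inD(1)[OF J(1)]
  fix s assume s: "s \<in> S"
  from rep_VxV[OF s] obtain N k where "rep (V w * s * V w) N k" by auto
  from rep_mult[OF rep_mult[OF rep_ev this] rep_ev]
  have r: "rep (ev g * (V w * s * V w) * ev h) (0 + N + 0) (g * k * h)" .
  have "ev (g * k * h) = ev (g * h) * ev k" by (simp add: ev_mult[symmetric] mult.commute mult.left_commute)
  also have "\<dots> \<in> J" by (rule ideal_inD(5)[OF JI assms(3) ev_S])
  finally have "ev g * (V w * s * V w) * ev h \<in> J" using rep_in_ideal[OF JI J(2) r] by simp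
  moreover have "ev g * (V w * s * V w) * ev h = ev g * s * ev h"
    using V_ev ev_V by (metis mult.assoc)
  ultimately show "ev g * s * ev h \<in> J" by simp
qed

text \<open>The polynomials with value in \<open>J\<close> form an ideal of a principal ideal domain.\<close>

lemma ev_generator: assumes J: "ideal_in S J" shows "\<exists>f. \<forall>g. ev g \<in> J \<longleftrightarrow> f dvd g"
proof (cases "\<exists>g. g \<noteq> 0 \<and> ev g \<in> J")
  case False
  then show ?thesis using ideal_inD(2)[OF J] by (intro exI[of _ 0]) auto
next
  case True
  then obtain f where f: "f \<noteq> 0" "ev f \<in> J" and min: "\<And>g. g \<noteq> 0 \<Longrightarrow> ev g \<in> J \<Longrightarrow> degree f \<le> degree g"
    using ex_has_least_nat[of "\<lambda>g. g \<noteq> 0 \<and> ev g \<in> J" _ degree] by metis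
  have "f dvd g" if g: "ev g \<in> J" for g
  proof -
    have "ev (g mod f) = ev g - ev f * ev (g div f)"
      using ev_add[of "f * (g div f)" "g mod f"] by (simp add: ev_mult)
    then have "ev (g mod f) \<in> J" using ideal_inD(3,5)[OF J] g f(2) ev_S by simp
    then have "g mod f = 0" using min[of "g mod f"] degree_mod_less[OF f(1), of g] by fastforce
    then show ?thesis by (rule dvd_eq_mod_eq_0[THEN iffD2])
  qed
  moreover have "ev g \<in> J" if "f dvd g" for g
    using that ideal_inD(5)[OF J f(2) ev_S] by (auto simp: dvd_def ev_mult)
  ultimately show ?thesis by blast
qed

text \<open>If all of these corner elements were in \<open>Q\<close>, then by primeness \<open>x t w \<in> Q\<close> for all \<open>t\<close>, and again \<open>x \<in> Q\<close>.\<close>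

lemma corner_nonmember:
  assumes Q: "prime_in S Q" "V w \<notin> Q" and x: "x \<in> S" "x \<notin> Q"
  shows "\<exists>s\<in>S. \<exists>t\<in>S. V w * s * x * t * V w \<notin> Q"
proof (rule ccontr)
  assume no: "\<not> ?thesis"
  have "x * t * V w \<in> Q" if t: "t \<in> S" for t
  proof -
    have xt: "x * t * V w \<in> S" by (intro S_mult x t V_S w)
    have "V w \<in> Q \<or> x * t * V w \<in> Q"
      by (rule prime_inD(3)[OF Q(1) V_S[OF w] xt]) (use no t in \<open>simp add: mult.assoc\<close>)
    then show ?thesis using Q(2) by simp
  qed
  then have "x \<in> Q \<or> V w \<in> Q" by (rule prime_inD(3)[OF Q(1) x(1) V_S[OF w]])
  then show False using Q(2) x(2) by simp
qed

text \<open>The projection \<open>eps u F\<close> in a spanning element of \<open>G\<close> annihilates every walk along the cycle: the next edge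
  lies in \<open>F\<close>, because otherwise the vertices of the cycle would lie in \<open>P\<close>.\<close>

lemma gr_absorbed: assumes "x \<in> G" shows "\<exists>N. x * C N = 0"
proof -
  have "aspan (right_gens P) \<subseteq> {x. \<exists>N. \<forall>M\<ge>N. x * C M = 0}"
  proof (rule aspan_closed_set)
    show "x + y \<in> {x. \<exists>N. \<forall>M\<ge>N. x * C M = 0}"
      if xy: "x \<in> {x. \<exists>N. \<forall>M\<ge>N. x * C M = 0}" "y \<in> {x. \<exists>N. \<forall>M\<ge>N. x * C M = 0}" for x y
    proof -
      from xy obtain N1 N2 where "\<forall>M\<ge>N1. x * C M = 0" "\<forall>M\<ge>N2. y * C M = 0" by auto
      then have "\<forall>M\<ge>max N1 N2. (x + y) * C M = 0" by (simp add: distrib_right)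
      then show ?thesis by blast
    qed
    show "right_gens P \<subseteq> {x. \<exists>N. \<forall>M\<ge>N. x * C M = 0}"
    proof
      fix x assume "x \<in> right_gens P"
      then obtain a u F v q where x: "x = a * eps u F * gst v q" "a \<in> S" "adm u F" "eps u F \<in> P" "awalk v q u"
        unfolding right_gens_def by auto
      have "x * C M = 0" if M: "M \<ge> Suc (length q)" for M
      proof -
        have eq: "x * C M = a * (eps u F * (gst v q * pth w (cyc M)))" by (simp add: x(1) C_def mult.assoc)
        from gst_pth_cases[OF x(5) cyc_walk, of M] show ?thesis
        proof (elim disjE exE conjE)
          fix t assume t: "v = w" "cyc M = q @ t" "awalk u t w" "gst v q * pth w (cyc M) = pth u t"
          have "length (cyc M) > length q" using length_cyc[of M] M by linarith
          then have "t \<noteq> []" using t(2) by auto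
          show ?thesis
          proof (cases "hd t \<in> F")
            case True
            then show ?thesis unfolding eq t(4) eps_pth[OF x(3) t(3) \<open>t \<noteq> []\<close>] by simp
          next
            case False
            then have "eps u F * pth u t = pth u t" using eps_pth[OF x(3) t(3) \<open>t \<noteq> []\<close>] by simp
            then have "pth u t \<in> P" using ideal_inD(5)[OF P x(4) pth_S[OF t(3)]] by simp
            then have False using pth_in_ideal[OF P t(3)] w_P by simp
            then show ?thesis ..
          qed
        next
          fix t assume "q = cyc M @ t"
          then have "length (cyc M) \<le> length q" by simp
          then show ?thesis using length_cyc[of M] M by linarith
        qed (simp add: eq)
      qed
      then show "x \<in> {x. \<exists>N. \<forall>M\<ge>N. x * C M = 0}" by blast
    qed
  qed simp
  then show ?thesis using gr_right_form[OF P] assms by blast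
qed

end

section \<open>Powers of a prime ideal\<close>

definition iprod :: "'r::ring set \<Rightarrow> 'r set \<Rightarrow> 'r set" where
  "iprod I J = aspan {a * b | a b. a \<in> I \<and> b \<in> J}"

text \<open>\<open>ipow P n\<close> is the power of \<open>P\<close> with exponent \<open>n + 1\<close>, as the zeroth power makes no sense in a ring
  without identity.\<close>

primrec ipow :: "'r::ring set \<Rightarrow> nat \<Rightarrow> 'r set" where
  "ipow P 0 = P"
| "ipow P (Suc n) = iprod P (ipow P n)"

lemma iprodI: "a \<in> I \<Longrightarrow> b \<in> J \<Longrightarrow> a * b \<in> iprod I J"
  unfolding iprod_def by (rule aspan_base) auto

lemma iprod_subset:
  assumes "0 \<in> A" "\<And>x y. x \<in> A \<Longrightarrow> y \<in> A \<Longrightarrow> x + y \<in> A" "\<And>a b. a \<in> I \<Longrightarrow> b \<in> J \<Longrightarrow> a * b \<in> A"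
  shows "iprod I J \<subseteq> A"
  unfolding iprod_def by (rule aspan_closed_set) (use assms in auto)

lemma iprod_ideal:
  assumes I: "ideal_in S I" and J: "ideal_in S J" shows "ideal_in S (iprod I J)"
  unfolding iprod_def
proof (rule aspan_ideal)
  let ?X = "{a * b | a b. a \<in> I \<and> b \<in> J}"
  have "?X \<subseteq> I" using ideal_inD(5)[OF I] ideal_inD(1)[OF J] by auto
  from subset_trans[OF ideal_in_aspan_subset[OF I this] ideal_inD(1)[OF I]] show "aspan ?X \<subseteq> S" .
  fix x assume "x \<in> ?X"
  then obtain a b where ab: "x = a * b" "a \<in> I" "b \<in> J" by auto
  have "- x = (- a) * b" by (simp add: ab(1))
  then show "- x \<in> ?X" using ideal_in_uminus[OF I ab(2)] ab(3) by blast
  fix s assume s: "s \<in> S"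
  have "s * x = (s * a) * b" "x * s = a * (b * s)" by (simp_all add: ab(1) mult.assoc)
  then show "s * x \<in> ?X" "x * s \<in> ?X"
    using ideal_inD(4)[OF I ab(2) s] ideal_inD(5)[OF J ab(3) s] ab(2,3) by blast+
qed

lemma ipow_ideal: "ideal_in S P \<Longrightarrow> ideal_in S (ipow P n)"
  by (induction n) (simp_all add: iprod_ideal)

lemma iprod_subset_left: "ideal_in S I \<Longrightarrow> J \<subseteq> S \<Longrightarrow> iprod I J \<subseteq> I"
  by (rule iprod_subset) (auto simp: ideal_inD(2,5) ideal_in_add subset_iff)

lemma iprod_subset_right: "ideal_in S J \<Longrightarrow> I \<subseteq> S \<Longrightarrow> iprod I J \<subseteq> J"
  by (rule iprod_subset) (auto simp: ideal_inD(2,4) ideal_in_add subset_iff)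

context exitless_cycle
begin

text \<open>An ideal that contains a polynomial in the cycle also contains one with nonzero constant
  term, and multiplying it by the projection off the cycle leaves a multiple of that projection.\<close>

lemma exit_in_ideal:
  assumes Q: "ideal_in S Q" and g: "g \<noteq> 0" "ev g \<in> Q"
  shows "V w - pth w c * gst w c \<in> Q"
proof -
  obtain h where h: "h \<noteq> 0" "ev h \<in> Q" and min: "\<And>g. g \<noteq> 0 \<Longrightarrow> ev g \<in> Q \<Longrightarrow> degree h \<le> degree g"
    using ex_has_least_nat[of "\<lambda>g. g \<noteq> 0 \<and> ev g \<in> Q" g degree] g by metis
  obtain a k where hk: "h = pCons a k" by (cases h)
  have gc: "gst w c * pth w c = V w" by (rule gst_pth_same[OF c_walk])
  \<comment> \<open>Otherwise \<open>c\<^sup>*\<close> would lower the degree of \<open>h\<close>.\<close>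
  have "a \<noteq> 0"
  proof
    assume "a = 0"
    then have "k \<noteq> 0" "ev h = pth w c * ev k" using h(1) hk by (auto simp: ev_pCons)
    then have "gst w c * (pth w c * ev k) \<in> Q" using ideal_inD(4)[OF Q h(2) gst_S[OF c_walk]] by simp
    then have "ev k \<in> Q" using gc V_ev by (simp add: mult.assoc[symmetric])
    from min[OF \<open>k \<noteq> 0\<close> this] show False using \<open>k \<noteq> 0\<close> \<open>a = 0\<close> hk by simp
  qed
  define x where "x = V w - pth w c * gst w c"
  have xS: "x \<in> S" unfolding x_def by (intro S_diff V_S w S_mult pth_S[OF c_walk] gst_S[OF c_walk])
  have xc: "x * pth w c = 0"
    using gc V_pth[OF c_walk] pth_V[OF c_walk] by (simp add: x_def left_diff_distrib mult.assoc)
  have xV: "x * V w = x"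
    using V_V[OF w w] gst_V[OF c_walk] by (simp add: x_def left_diff_distrib mult.assoc)
  have "x * ev h = x * (sc a * V w) + (x * pth w c) * ev k"
    by (simp add: hk ev_pCons distrib_left mult.assoc)
  also have "\<dots> = sc a * x" using xc xV S_comm[OF xS, of a] S_comm[OF V_S[OF w], of a]
    by (simp add: mult.assoc[symmetric])
  finally have "sc a * x \<in> Q" using ideal_inD(4)[OF Q h(2) xS] by simp
  then show ?thesis unfolding x_def[symmetric] by (rule sc_cancel[OF Q xS \<open>a \<noteq> 0\<close>])
qed

text \<open>By \<open>exit_in_ideal\<close> the cycle has no exits modulo \<open>Q\<close> either. Thus powers of \<open>c\<close> are invertible modulo \<open>Q\<close>, while
  they annihilate the elements of \<open>G\<close>; so \<open>G\<close> times \<open>w\<close> lies in \<open>Q\<close>, and \<open>w\<close> does not.\<close>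

lemma smaller_prime_contains_gr:
  assumes Q: "prime_in S Q" "Q \<subseteq> P" and z: "corner z" "z \<in> Q" "z \<notin> G"
  shows "G \<subseteq> Q"
proof -
  note QI = prime_inD(1)[OF Q(1)]
  have wQ: "V w \<notin> Q" using Q(2) w_P by auto
  from rep_exists[OF z(1)] obtain N g where g: "rep z N g" by auto
  then have g0: "g \<noteq> 0" using rep_in_ideal[OF G subset_refl g] z(3) ideal_inD(2)[OF G] by auto
  have "z * C N - ev g \<in> G" using g by (simp add: rep_def)
  from gr_absorbed[OF this] obtain M where "(z * C N - ev g) * C M = 0" by auto
  then have "ev (g * monom 1 M) = z * (C N * C M)"
    by (simp add: ev_mult ev_monom_1 left_diff_distrib mult.assoc)
  then have "ev (g * monom 1 M) \<in> Q" using ideal_inD(5)[OF QI z(2) S_mult[OF C_S C_S]] by simp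
  then have exit: "V w - pth w c * gst w c \<in> Q"
    using exit_in_ideal[OF QI, of "g * monom 1 M"] g0 by simp
  have GV: "x * V w \<in> Q" if x: "x \<in> G" for x
  proof -
    from gr_absorbed[OF x] obtain N where N: "x * C N = 0" by auto
    have "x \<in> S" using x ideal_inD(1)[OF G] by auto
    then have "x * (V w - C N * D N) \<in> Q" by (rule ideal_inD(4)[OF QI exitless_pow[OF QI exit]])
    moreover have "x * (C N * D N) = 0" using N by (simp add: mult.assoc[symmetric])
    ultimately show ?thesis by (simp add: right_diff_distrib)
  qed
  show ?thesis
  proof
    fix x assume x: "x \<in> G"
    then have "x \<in> S" using ideal_inD(1)[OF G] by auto
    then have "x \<in> Q \<or> V w \<in> Q"
      by (rule prime_inD(3)[OF Q(1) _ V_S[OF w]]) (rule GV[OF ideal_inD(5)[OF G x]])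
    then show "x \<in> Q" using wQ by simp
  qed
qed

text \<open>The polynomials with values in \<open>Q\<close> and in \<open>P\<close> form nonzero prime ideals, which coincide because nonzero primes of
  a principal ideal domain are maximal. The corner of a prime ideal determines it.\<close>

lemma no_smaller_prime:
  assumes PP: "prime_in S P" and Q: "prime_in S Q" "Q \<subseteq> P" and z: "corner z" "z \<in> Q" "z \<notin> G"
  shows "P \<subseteq> Q"
proof -
  note QI = prime_inD(1)[OF Q(1)]
  have wQ: "V w \<notin> Q" using Q(2) w_P by auto
  have GQ: "G \<subseteq> Q" by (rule smaller_prime_contains_gr[OF Q z])
  from ev_generator[OF P] obtain f where f: "\<And>g. ev g \<in> P \<longleftrightarrow> f dvd g" by auto
  from ev_generator[OF QI] obtain f' where f': "\<And>g. ev g \<in> Q \<longleftrightarrow> f' dvd g" by auto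
  from rep_exists[OF z(1)] obtain N g where g: "rep z N g" by auto
  then have "g \<noteq> 0" using rep_in_ideal[OF G subset_refl g] z(3) ideal_inD(2)[OF G] by auto
  moreover have "ev g \<in> Q" using rep_in_ideal[OF QI GQ g] z(2) by simp
  ultimately have "f' \<noteq> 0" using f'[of g] by auto
  have "ev f' \<in> Q" using f' by simp
  then have "f dvd f'" using f Q(2) by auto
  then obtain k where k: "f' = f * k" by (auto simp: dvd_def)
  \<comment> \<open>\<open>f\<close> generates the larger of two prime ideals and divides the generator \<open>f'\<close> of the smaller, which is prime.\<close>
  have "ev f \<in> Q"
  proof (rule ccontr)
    assume "ev f \<notin> Q"
    then have "ev k \<in> Q" using ev_prime[OF Q(1) GQ, of f k] \<open>ev f' \<in> Q\<close> k by simp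
    then have "f * k dvd k" using f'[of k] k by simp
    then have "f dvd 1" using \<open>f' \<noteq> 0\<close> k dvd_mult_cancel_right[of f k 1] by simp
    then have "ev 1 \<in> P" using f by simp
    then show False using ev_1 w_P by simp
  qed
  then have PQ: "ev g \<in> Q" if "ev g \<in> P" for g
    using that f'[of f] f'[of g] f[of g] by (meson dvd_trans)
  show ?thesis
  proof (rule ccontr)
    assume "\<not> P \<subseteq> Q"
    then obtain x where x: "x \<in> P" "x \<notin> Q" by auto
    have xS: "x \<in> S" using x(1) ideal_inD(1)[OF P] by auto
    from corner_nonmember[OF Q(1) wQ xS x(2)] obtain s t where st: "s \<in> S" "t \<in> S"
      "V w * s * x * t * V w \<notin> Q" by auto
    define d where "d = V w * (s * x * t) * V w"
    have "s * x * t \<in> S" by (intro S_mult st xS)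
    then have "corner d" unfolding d_def by (rule corner_VxV)
    have "d \<in> P" unfolding d_def by (intro ideal_inD(4,5)[OF P] x(1) st V_S w)
    from rep_exists[OF \<open>corner d\<close>] obtain N g where g: "rep d N g" by auto
    have "ev g \<in> P" using rep_in_ideal[OF P gr_subset[OF P] g] \<open>d \<in> P\<close> by simp
    then have "d \<in> Q" using rep_in_ideal[OF QI GQ g] PQ by simp
    then show False using st(3) by (simp add: d_def mult.assoc)
  qed
qed

text \<open>The ideal generated by \<open>G\<close> and the vertex \<open>w\<close> contains \<open>w\<close>, so \<open>w x\<close> lies in its graded part, which is s-unital.\<close>

lemma ideal_at_cycle_unit:
  assumes "x \<in> S"
  shows "\<exists>y\<in>aspan {a * V w * b | a b. a \<in> S \<and> b \<in> S}. \<exists>\<gamma>\<in>G. V w * x = V w * x * (y + \<gamma>)"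
proof -
  let ?X = "{a * V w * b | a b. a \<in> S \<and> b \<in> S}"
  define N where "N = {y + \<gamma> | y \<gamma>. y \<in> aspan ?X \<and> \<gamma> \<in> G}"
  note XI = ideal_generated_by(1)[OF V_S[OF w]]
  have NI: "ideal_in S N" unfolding ideal_in_def
  proof (intro conjI ballI)
    show "N \<subseteq> S" using ideal_inD(1)[OF XI] ideal_inD(1)[OF G] by (auto simp: N_def intro: S_add)
    have "0 + 0 \<in> N" unfolding N_def using aspan.zero ideal_inD(2)[OF G] by blast
    then show "0 \<in> N" by simp
    show "x - y \<in> N" if "x \<in> N" "y \<in> N" for x y
    proof -
      from that obtain a b a' b' where *: "x = a + b" "y = a' + b'" "a \<in> aspan ?X" "a' \<in> aspan ?X" "b \<in> G" "b' \<in> G"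
        unfolding N_def by auto
      have "x - y = (a - a') + (b - b')" by (simp add: *)
      moreover have "a - a' \<in> aspan ?X" by (rule ideal_inD(3)[OF XI *(3,4)])
      moreover have "b - b' \<in> G" by (rule ideal_inD(3)[OF G *(5,6)])
      ultimately show ?thesis unfolding N_def by blast
    qed
    show "s * x \<in> N" "x * s \<in> N" if x: "x \<in> N" and s: "s \<in> S" for x s
    proof -
      from x obtain a b where *: "x = a + b" "a \<in> aspan ?X" "b \<in> G" unfolding N_def by auto
      have "s * x = s * a + s * b" "x * s = a * s + b * s" by (simp_all add: *(1) distrib_left distrib_right)
      then show "s * x \<in> N" "x * s \<in> N"
        unfolding N_def using ideal_inD(4,5)[OF XI *(2) s] ideal_inD(4,5)[OF G *(3) s] by blast+
    qed
  qed
  have "V w + 0 \<in> N" unfolding N_def using ideal_generated_by(2)[OF V_S[OF w]] ideal_inD(2)[OF G] by blast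
  then have "V w \<in> gr N" using V_gr[OF w] by simp
  then have "V w * x \<in> gr N" by (rule ideal_inD(5)[OF gr_ideal[OF NI] _ assms])
  from gr_right_unit[OF NI this] obtain v where v: "v \<in> gr N" "V w * x * v = V w * x" by auto
  have "v \<in> N" using v(1) gr_subset[OF NI] by auto
  then obtain y \<gamma> where "v = y + \<gamma>" "y \<in> aspan ?X" "\<gamma> \<in> G" unfolding N_def by auto
  then show ?thesis using v(2) by (intro bexI[of _ y] bexI[of _ \<gamma>]) simp_all
qed

text \<open>Modulo \<open>G\<close>, the powers of \<open>P\<close> are generated at \<open>w\<close> by the powers of one polynomial.\<close>

definition gen_at :: "'k poly \<Rightarrow> 'r set" where
  "gen_at f = {ev f * s + \<gamma> | s \<gamma>. s \<in> S \<and> V w * s = s \<and> \<gamma> \<in> G}"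

lemma gen_at_add: "x \<in> gen_at f \<Longrightarrow> y \<in> gen_at f \<Longrightarrow> x + y \<in> gen_at f"
proof -
  assume "x \<in> gen_at f" "y \<in> gen_at f"
  then obtain s \<gamma> s' \<gamma>' where *: "x = ev f * s + \<gamma>" "y = ev f * s' + \<gamma>'" "s \<in> S" "s' \<in> S"
    "V w * s = s" "V w * s' = s'" "\<gamma> \<in> G" "\<gamma>' \<in> G" unfolding gen_at_def by auto
  have "x + y = ev f * (s + s') + (\<gamma> + \<gamma>')" by (simp add: * distrib_left add.assoc add.left_commute)
  moreover have "s + s' \<in> S" "V w * (s + s') = s + s'" "\<gamma> + \<gamma>' \<in> G"
    using * S_add ideal_in_add[OF G] by (simp_all add: distrib_left)
  ultimately show ?thesis unfolding gen_at_def by blast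
qed

lemma gen_at_I: "s \<in> S \<Longrightarrow> V w * s = s \<Longrightarrow> x - ev f * s \<in> G \<Longrightarrow> x \<in> gen_at f"
  unfolding gen_at_def by (rule CollectI, rule exI[of _ s], rule exI[of _ "x - ev f * s"]) simp

lemma gen_at_0: "0 \<in> gen_at f"
  using gen_at_I[of 0 0 f] S_0 ideal_inD(2)[OF G] by simp

lemma corner_gen_at:
  assumes f: "\<And>g. ev g \<in> P \<longleftrightarrow> f dvd g" and d: "corner d" "d \<in> P" and b: "b \<in> S"
  shows "d * b \<in> gen_at f"
proof -
  from rep_exists[OF d(1)] obtain N g where g: "rep d N g" by auto
  have "ev g \<in> P" using rep_in_ideal[OF P gr_subset[OF P] g] d(2) by simp
  then obtain k where k: "g = f * k" using f by (auto simp: dvd_def)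
  define s where "s = ev k * D N * b"
  have "(d * C N - ev g) * D N * b \<in> G" using g by (intro ideal_inD(5)[OF G] D_S b) (simp add: rep_def)
  moreover have "d * (V w - C N * D N) * b \<in> G" by (intro ideal_inD(4,5)[OF G] CD b cornerD(1) d)
  ultimately have "(d * C N - ev g) * D N * b + d * (V w - C N * D N) * b \<in> G" by (rule ideal_in_add[OF G])
  moreover have "(d * C N - ev g) * D N * b + d * (V w - C N * D N) * b = d * b - ev f * s"
    using cornerD(3)[OF d(1)] by (simp add: s_def k ev_mult left_diff_distrib right_diff_distrib mult.assoc[symmetric])
  ultimately have "d * b - ev f * s \<in> G" by simp
  moreover have "s \<in> S" unfolding s_def by (intro S_mult ev_S D_S b)
  moreover have "V w * s = s" unfolding s_def using V_ev by (simp add: mult.assoc[symmetric])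
  ultimately show ?thesis by (intro gen_at_I)
qed

text \<open>A right unit for \<open>w x\<close> in the ideal generated by \<open>w\<close> splits \<open>w x\<close> into elements of the corner times elements of \<open>S\<close>.\<close>

lemma prime_gen_at:
  assumes f: "\<And>g. ev g \<in> P \<longleftrightarrow> f dvd g" and x: "x \<in> P" shows "V w * x \<in> gen_at f"
proof -
  let ?X = "{a * V w * b | a b. a \<in> S \<and> b \<in> S}"
  have xS: "x \<in> S" using x ideal_inD(1)[OF P] by auto
  from ideal_at_cycle_unit[OF xS] obtain y \<gamma> where y: "y \<in> aspan ?X" "\<gamma> \<in> G"
    "V w * x = V w * x * (y + \<gamma>)" by auto
  have "aspan ?X \<subseteq> {y. V w * x * y \<in> gen_at f}"
  proof (rule aspan_closed_set)
    show "?X \<subseteq> {y. V w * x * y \<in> gen_at f}"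
    proof
      fix y assume "y \<in> ?X"
      then obtain a b where ab: "y = a * V w * b" "a \<in> S" "b \<in> S" by auto
      have "V w * (x * a) * V w * b \<in> gen_at f"
      proof (rule corner_gen_at[OF f _ _ ab(3)])
        show "corner (V w * (x * a) * V w)" by (rule corner_VxV[OF S_mult[OF xS ab(2)]])
        show "V w * (x * a) * V w \<in> P" by (intro ideal_inD(4,5)[OF P] x ab V_S w)
      qed
      then show "y \<in> {y. V w * x * y \<in> gen_at f}" by (simp add: ab(1) mult.assoc)
    qed
  qed (simp_all add: gen_at_0 distrib_left gen_at_add)
  then have "V w * x * y \<in> gen_at f" using y(1) by auto
  moreover have "V w * x * \<gamma> \<in> gen_at f"
    using gen_at_I[of 0 "V w * x * \<gamma>" f] ideal_inD(4)[OF G y(2) S_mult[OF V_S[OF w] xS]] S_0 by simp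
  ultimately show ?thesis using y(3) gen_at_add by (metis distrib_left)
qed

lemma ipow_gen_at:
  assumes f: "\<And>g. ev g \<in> P \<longleftrightarrow> f dvd g" and "x \<in> ipow P n" shows "V w * x \<in> gen_at (f ^ Suc n)"
  using assms(2)
proof (induction n arbitrary: x)
  case 0
  then show ?case using prime_gen_at[OF f] by simp
next
  case (Suc n)
  have "iprod P (ipow P n) \<subseteq> {x. V w * x \<in> gen_at (f ^ Suc (Suc n))}"
  proof (rule iprod_subset)
    fix p y assume p: "p \<in> P" and y: "y \<in> ipow P n"
    have yS: "y \<in> S" using y ideal_inD(1)[OF ipow_ideal[OF P]] by auto
    from prime_gen_at[OF f p] obtain s \<gamma> where s: "V w * p = ev f * s + \<gamma>" "s \<in> S" "V w * s = s" "\<gamma> \<in> G"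
      unfolding gen_at_def by auto
    have "s * y \<in> ipow P n" by (rule ideal_inD(4)[OF ipow_ideal[OF P] y s(2)])
    from Suc.IH[OF this] obtain s' \<gamma>' where s': "V w * (s * y) = ev (f ^ Suc n) * s' + \<gamma>'" "s' \<in> S"
      "V w * s' = s'" "\<gamma>' \<in> G" unfolding gen_at_def by auto
    have sy: "s * y = ev (f ^ Suc n) * s' + \<gamma>'" using s'(1) s(3) by (simp add: mult.assoc[symmetric])
    have "V w * (p * y) = (V w * p) * y" by (simp add: mult.assoc)
    also have "\<dots> = ev f * (s * y) + \<gamma> * y" unfolding s(1) by (simp add: distrib_right mult.assoc)
    also have "\<dots> = ev (f ^ Suc (Suc n)) * s' + (ev f * \<gamma>' + \<gamma> * y)"
      unfolding sy power_Suc[of f "Suc n"] ev_mult by (simp add: distrib_left mult.assoc add.assoc)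
    finally have "V w * (p * y) - ev (f ^ Suc (Suc n)) * s' = ev f * \<gamma>' + \<gamma> * y" by simp
    moreover have "ev f * \<gamma>' + \<gamma> * y \<in> G"
      by (rule ideal_in_add[OF G ideal_inD(4)[OF G s'(4) ev_S] ideal_inD(5)[OF G s(4) yS]])
    ultimately show "p * y \<in> {x. V w * x \<in> gen_at (f ^ Suc (Suc n))}"
      using gen_at_I[OF s'(2,3)] by simp
  qed (simp_all add: gen_at_0 distrib_left gen_at_add)
  then show ?case using Suc.prems by auto
qed

lemma ev_power_in_ipow: "ev f \<in> P \<Longrightarrow> ev (f ^ Suc n) \<in> ipow P n"
proof (induction n)
  case (Suc n)
  have "ev f * ev (f ^ Suc n) \<in> iprod P (ipow P n)" by (rule iprodI[OF Suc.prems Suc.IH[OF Suc.prems]])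
  then show ?case by (simp add: ev_mult)
qed simp

text \<open>All elements involved are expressed by polynomials in the cycle, and unique factorisation gives the contradiction.\<close>

lemma power_not_absorbed:
  assumes PP: "prime_in S P" and z: "corner z" "z \<in> P" "z \<notin> G"
    and A: "ideal_in S A" "\<not> A \<subseteq> P" and B: "ideal_in S B" "\<not> B \<subseteq> P" and rs: "r < s"
    and sub: "\<And>a x b. a \<in> A \<Longrightarrow> x \<in> ipow P r \<Longrightarrow> b \<in> B \<Longrightarrow> a * x * b \<in> ipow P s"
  shows False
proof -
  note GP = gr_subset[OF P]
  from ev_generator[OF P] obtain f where f: "\<And>g. ev g \<in> P \<longleftrightarrow> f dvd g" by auto
  from rep_exists[OF z(1)] obtain N g where g: "rep z N g" by auto
  then have "g \<noteq> 0" using rep_in_ideal[OF G subset_refl g] z(3) ideal_inD(2)[OF G] by auto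
  moreover have "f dvd g" using rep_in_ideal[OF P GP g] z(2) f by simp
  ultimately have f0: "f \<noteq> 0" by auto
  have corner_elt: "\<exists>a\<in>I. corner a \<and> a \<notin> P" if I: "ideal_in S I" "\<not> I \<subseteq> P" for I
  proof -
    from I(2) obtain x where x: "x \<in> I" "x \<notin> P" by auto
    have xS: "x \<in> S" using x(1) ideal_inD(1)[OF I(1)] by auto
    from corner_nonmember[OF PP w_P xS x(2)] obtain s t where st: "s \<in> S" "t \<in> S"
      "V w * s * x * t * V w \<notin> P" by auto
    have "corner (V w * (s * x * t) * V w)" by (intro corner_VxV S_mult st xS)
    moreover have "V w * s * x * t * V w \<in> I" by (intro ideal_inD(4,5)[OF I(1)] x(1) st V_S w S_mult)
    ultimately show ?thesis using st(3) by (metis mult.assoc)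
  qed
  from corner_elt[OF A] obtain a where a: "a \<in> A" "corner a" "a \<notin> P" by auto
  from corner_elt[OF B] obtain b where b: "b \<in> B" "corner b" "b \<notin> P" by auto
  from rep_exists[OF a(2)] obtain Na ga where ra: "rep a Na ga" by auto
  from rep_exists[OF b(2)] obtain Nb gb where rb: "rep b Nb gb" by auto
  \<comment> \<open>This element corresponds to \<open>ga * f ^ Suc r * gb\<close> up to a power of the cycle, and it would have to be divisible by
    \<open>f ^ Suc s\<close>, although \<open>f\<close> divides neither \<open>ga\<close> nor \<open>gb\<close>.\<close>
  define x where "x = a * ev (f ^ Suc r) * b"
  have "ev f \<in> P" using f by simp
  then have "x \<in> ipow P s" unfolding x_def by (rule sub[OF a(1) ev_power_in_ipow b(1)])
  from ipow_gen_at[OF f this] obtain y \<gamma> where y: "V w * x = ev (f ^ Suc s) * y + \<gamma>" "y \<in> S" "V w * y = y" "\<gamma> \<in> G"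
    unfolding gen_at_def by auto
  have rx: "rep x (Na + 0 + Nb) (ga * f ^ Suc r * gb)"
    unfolding x_def by (rule rep_mult[OF rep_mult[OF ra rep_ev] rb])
  have cx: "corner x" using rx by (simp add: rep_def)
  have xy: "x = ev (f ^ Suc s) * (V w * y * V w) + \<gamma> * V w"
    using arg_cong[OF y(1), of "\<lambda>x. x * V w"] cornerD[OF cx] y(3) by (simp add: distrib_right mult.assoc)
  from rep_VxV[OF y(2)] obtain K k where "rep (V w * y * V w) K k" by auto
  from rep_mult[OF rep_ev this] have rk: "rep (ev (f ^ Suc s) * (V w * y * V w)) (0 + K) (f ^ Suc s * k)" .
  have "rep x K (f ^ Suc s * k)"
  proof -
    have "(ev (f ^ Suc s) * (V w * y * V w)) * C K - ev (f ^ Suc s * k) \<in> G" using rk by (simp add: rep_def)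
    moreover have "\<gamma> * V w * C K \<in> G" by (intro ideal_inD(5)[OF G] y(4) V_S w C_S)
    ultimately have "((ev (f ^ Suc s) * (V w * y * V w)) * C K - ev (f ^ Suc s * k)) + \<gamma> * V w * C K \<in> G"
      by (rule ideal_in_add[OF G])
    then have "x * C K - ev (f ^ Suc s * k) \<in> G"
      unfolding xy by (simp add: distrib_right algebra_simps)
    then show ?thesis using cx by (simp add: rep_def)
  qed
  from rep_unique[OF rx this] have "ga * f ^ Suc r * gb * monom 1 K = f ^ Suc s * k * monom 1 (Na + 0 + Nb)" .
  moreover have "f ^ Suc s = f ^ Suc r * (f * f ^ (s - Suc r))"
  proof -
    have "Suc s = Suc r + Suc (s - Suc r)" using rs by simp
    then show ?thesis by (metis power_add power_Suc)
  qed
  ultimately have "f ^ Suc r * (ga * gb * monom 1 K) = f ^ Suc r * (f * (f ^ (s - Suc r) * k * monom 1 (Na + 0 + Nb)))"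
    by (simp only: mult_ac)
  then have "ga * gb * monom 1 K = f * (f ^ (s - Suc r) * k * monom 1 (Na + 0 + Nb))"
    using f0 by (subst (asm) mult_cancel_left) simp
  then have "f dvd ga * gb * monom 1 K" by (simp only: dvd_triv_left)
  then have "ev (ga * gb * monom 1 K) \<in> P" using f by simp
  then have "ev (ga * gb) \<in> P \<or> ev (monom 1 K) \<in> P" by (rule ev_prime[OF PP GP])
  then show False
  proof
    assume "ev (monom 1 K) \<in> P"
    then have "D K * C K \<in> P" using ideal_inD(4)[OF P _ D_S] by (simp add: ev_monom_1)
    then show False using D_C w_P by simp
  next
    assume "ev (ga * gb) \<in> P"
    then have "ev ga \<in> P \<or> ev gb \<in> P" by (rule ev_prime[OF PP GP])
    then show False using rep_in_ideal[OF P GP ra] rep_in_ideal[OF P GP rb] a(3) b(3) by simp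
  qed
qed

end

context graded_cohn_family
begin

text \<open>The projection off \<open>a\<close> lies below the projection off \<open>a @ b\<close>.\<close>

lemma exitless_prefix:
  assumes G: "ideal_in S G" and ab: "awalk w a w" "awalk w b w" and "V w - pth w (a @ b) * gst w (a @ b) \<in> G"
  shows "V w - pth w a * gst w a \<in> G"
proof -
  let ?x = "V w - pth w a * gst w a"
  have w: "w \<in> verts E" using awalk_verts(1)[OF ab(1)] .
  have xS: "?x \<in> S" by (intro S_diff V_S w S_mult pth_S[OF ab(1)] gst_S[OF ab(1)])
  have "?x * pth w a = 0"
    using gst_pth_same[OF ab(1)] V_pth[OF ab(1)] pth_V[OF ab(1)] by (simp add: left_diff_distrib mult.assoc)
  then have "?x * (pth w (a @ b) * gst w (a @ b)) = 0"
    unfolding pth_append[OF ab] by (simp add: mult.assoc[symmetric])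
  moreover have "?x * V w = ?x" using V_V[OF w w] gst_V[OF ab(1)] by (simp add: left_diff_distrib mult.assoc)
  ultimately have "?x * (V w - pth w (a @ b) * gst w (a @ b)) = ?x" by (simp add: right_diff_distrib)
  then show ?thesis using ideal_inD(4)[OF G assms(4) xS] by simp
qed

lemma exitless_cycle_minimal:
  assumes P: "ideal_in S P" and Q: "ideal_in S Q" "Q \<subseteq> P" "\<not> Q \<subseteq> gr P"
  shows "\<exists>w c z. exitless_cycle E V Ed Gh sc comp P w c \<and> z \<in> Q \<and> z \<in> S \<and> V w * z * V w = z \<and> z \<notin> gr P"
proof -
  note G = gr_ideal[OF P]
  from exitless_cycle_exists[OF assms] obtain w c0 z where
    c0: "awalk w c0 w" "c0 \<noteq> []" "V w - pth w c0 * gst w c0 \<in> gr P"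
    and z: "V w \<notin> P" "z \<in> Q" "V w * z * V w = z" "z \<notin> gr P" by auto
  \<comment> \<open>A shortest cycle without exits at \<open>w\<close> is not a power, since its closed prefixes have no exits either.\<close>
  define R where "R c \<longleftrightarrow> awalk w c w \<and> c \<noteq> [] \<and> V w - pth w c * gst w c \<in> gr P" for c
  have "R c0" using c0 by (simp add: R_def)
  then obtain c where c: "R c" and min: "\<And>d. R d \<Longrightarrow> length c \<le> length d"
    using ex_has_least_nat[of R c0 length] by auto
  have "exitless_cycle E V Ed Gh sc comp P w c"
  proof (unfold_locales)
    show "ideal_in S P" "V w \<notin> P" by fact+
    show "awalk w c w" "c \<noteq> []" "V w - pth w c * gst w c \<in> gr P" using c by (simp_all add: R_def)
    fix a b assume ab: "c = a @ b" "a \<noteq> []" "awalk w a w"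
    have "awalk w b w" using \<open>awalk w c w\<close> awalk_awlast[OF ab(3)] by (simp add: ab(1) awalk_append_iff)
    with exitless_prefix[OF G ab(3)] c have "R a" using ab by (simp add: R_def)
    from min[OF this] show "b = []" using ab(1) by simp
  qed
  moreover have "z \<in> S" using z(2) ideal_inD(1)[OF Q(1)] by auto
  ultimately show ?thesis using z by metis
qed

lemma prime_strict_subset_gr:
  assumes P: "prime_in S P" and Q: "prime_in S Q" and "Q \<subset> P" shows "Q \<subseteq> gr P"
proof (rule ccontr)
  assume "\<not> Q \<subseteq> gr P"
  from exitless_cycle_minimal[OF prime_inD(1)[OF P] prime_inD(1)[OF Q] _ this] assms(3)
  obtain w c z where *: "exitless_cycle E V Ed Gh sc comp P w c" and z: "z \<in> Q" "z \<in> S" "V w * z * V w = z" "z \<notin> gr P"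
    by auto
  from exitless_cycle.no_smaller_prime[OF * P Q] assms(3) z show False
    using exitless_cycle.corner_def[OF *] by blast
qed

text \<open>An s-unital ideal is contained in its own powers.\<close>

lemma gr_subset_ipow:
  assumes P: "ideal_in S P" shows "gr P \<subseteq> ipow P n"
proof (induction n)
  case 0
  then show ?case using gr_subset[OF P] by simp
next
  case (Suc n)
  show ?case
  proof
    fix x assume x: "x \<in> gr P"
    from gr_right_unit[OF P this] obtain v where v: "v \<in> gr P" "x * v = x" by auto
    have "x \<in> P" "v \<in> ipow P n" using x v(1) gr_subset[OF P] Suc.IH by auto
    then show "x \<in> ipow P (Suc n)" using iprodI[of x P v "ipow P n"] v(2) by simp
  qed
qed

text \<open>If \<open>P = gr P\<close>, then \<open>P\<close> is idempotent; otherwise there is a cycle to which \<open>power_not_absorbed\<close> applies.\<close>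

lemma prime_power_cancel:
  assumes PP: "prime_in S P" and A: "ideal_in S A" "\<not> A \<subseteq> P" and B: "ideal_in S B" "\<not> B \<subseteq> P"
    and rs: "r \<le> s"
    and sub: "\<And>a x b. a \<in> A \<Longrightarrow> x \<in> ipow P r \<Longrightarrow> b \<in> B \<Longrightarrow> a * x * b \<in> ipow P s"
  shows "ipow P r = ipow P s"
proof (cases "P \<subseteq> gr P")
  case True
  have P: "ideal_in S P" by (rule prime_inD(1)[OF PP])
  have "ipow P n = P" for n
  proof
    show "P \<subseteq> ipow P n" using True gr_subset_ipow[OF P] by blast
    show "ipow P n \<subseteq> P"
      using iprod_subset_left[OF P ideal_inD(1)[OF ipow_ideal[OF P]]] by (cases n) auto
  qed
  then show ?thesis by simp
next
  case False
  have P: "ideal_in S P" by (rule prime_inD(1)[OF PP])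
  show ?thesis
  proof (cases "r = s")
    case True
    then show ?thesis by simp
  next
    case neq: False
    from exitless_cycle_minimal[OF P P subset_refl False]
    obtain w c z where *: "exitless_cycle E V Ed Gh sc comp P w c" and z: "z \<in> P" "z \<in> S" "V w * z * V w = z" "z \<notin> gr P"
      by auto
    have "exitless_cycle.corner E V Ed Gh sc w z" using z exitless_cycle.corner_def[OF *] by blast
    moreover have "r < s" using rs neq by simp
    ultimately have False
      using exitless_cycle.power_not_absorbed[OF * PP _ z(1,4) A B _ sub] by blast
    then show ?thesis ..
  qed
qed

end

section \<open>Uniqueness of irredundant products\<close>

context graded_cohn_family
begin

text \<open>The last factor \<open>S\<close> does not change a product, by local units, and makes products of appended lists uniform.\<close>

fun iprods :: "'r set list \<Rightarrow> 'r set" where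
  "iprods [] = S"
| "iprods (I # Is) = iprod I (iprods Is)"

lemma iprods_ideal: "(\<And>I. I \<in> set Is \<Longrightarrow> ideal_in S I) \<Longrightarrow> ideal_in S (iprods Is)"
  by (induction Is) (simp_all add: ideal_in_S iprod_ideal)

lemma iprod_S:
  assumes I: "ideal_in S I" shows "iprod I S = I" "iprod S I = I"
proof -
  have unit: "\<exists>u\<in>S. x * u = x \<and> u * x = x" if x: "x \<in> I" for x
  proof -
    have "x \<in> S" using x ideal_inD(1)[OF I] by auto
    from S_local_unit_ex[OF this] obtain W where W: "finite W" "W \<subseteq> verts E"
      "(\<Sum>w\<in>W. V w) * x = x" "x * (\<Sum>w\<in>W. V w) = x" by auto
    have "(\<Sum>w\<in>W. V w) \<in> S" by (rule S_sum, rule V_S, rule subsetD[OF W(2)])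
    then show ?thesis using W(3,4) by auto
  qed
  show "iprod I S = I"
  proof
    show "iprod I S \<subseteq> I" by (rule iprod_subset_left[OF I subset_refl])
    show "I \<subseteq> iprod I S"
    proof
      fix x assume x: "x \<in> I"
      from unit[OF x] obtain u where "u \<in> S" "x * u = x" by auto
      then show "x \<in> iprod I S" using iprodI[OF x, of u S] by simp
    qed
  qed
  show "iprod S I = I"
  proof
    show "iprod S I \<subseteq> I" by (rule iprod_subset_right[OF I subset_refl])
    show "I \<subseteq> iprod S I"
    proof
      fix x assume x: "x \<in> I"
      from unit[OF x] obtain u where "u \<in> S" "u * x = x" by auto
      then show "x \<in> iprod S I" using iprodI[of u S x I, OF _ x] by simp
    qed
  qed
qed

lemma iprod_assoc: "iprod (iprod I J) K = iprod I (iprod J (K :: 'r set))"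
proof
  show "iprod (iprod I J) K \<subseteq> iprod I (iprod J K)"
  proof (rule iprod_subset)
    fix x k assume x: "x \<in> iprod I J" and k: "k \<in> K"
    have "iprod I J \<subseteq> {x. x * k \<in> iprod I (iprod J K)}"
    proof (rule iprod_subset)
      fix a b assume "a \<in> I" "b \<in> J"
      then have "a * (b * k) \<in> iprod I (iprod J K)" using k by (intro iprodI)
      then show "a * b \<in> {x. x * k \<in> iprod I (iprod J K)}" by (simp add: mult.assoc)
    qed (simp_all add: iprod_def aspan.zero distrib_right aspan_add)
    then show "x * k \<in> iprod I (iprod J K)" using x by auto
  qed (simp_all add: iprod_def aspan.zero aspan_add)
  show "iprod I (iprod J K) \<subseteq> iprod (iprod I J) K"
  proof (rule iprod_subset)
    fix a x assume a: "a \<in> I" and x: "x \<in> iprod J K"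
    have "iprod J K \<subseteq> {x. a * x \<in> iprod (iprod I J) K}"
    proof (rule iprod_subset)
      fix b k assume "b \<in> J" "k \<in> K"
      then have "(a * b) * k \<in> iprod (iprod I J) K" using a by (intro iprodI)
      then show "b * k \<in> {x. a * x \<in> iprod (iprod I J) K}" by (simp add: mult.assoc)
    qed (simp_all add: iprod_def aspan.zero distrib_left aspan_add)
    then show "a * x \<in> iprod (iprod I J) K" using x by auto
  qed (simp_all add: iprod_def aspan.zero aspan_add)
qed

lemma iprods_append:
  assumes "\<And>I. I \<in> set Js \<Longrightarrow> ideal_in S I"
  shows "iprods (Is @ Js) = iprod (iprods Is) (iprods Js)"
  by (induction Is) (simp_all add: iprod_S iprods_ideal assms iprod_assoc)

lemma iprods_subset_member:
  assumes "\<And>I. I \<in> set Is \<Longrightarrow> ideal_in S I" "I \<in> set Is" shows "iprods Is \<subseteq> I"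
  using assms
proof (induction Is)
  case (Cons J Js)
  have J: "ideal_in S J" "ideal_in S (iprods Js)" using Cons.prems(1) iprods_ideal[of Js] by auto
  show ?case
  proof (cases "I = J")
    case True
    then show ?thesis using iprod_subset_left[OF J(1) ideal_inD(1)[OF J(2)]] by simp
  next
    case False
    then have "iprods Js \<subseteq> I" using Cons by simp
    then show ?thesis using iprod_subset_right[OF J(2) ideal_inD(1)[OF J(1)]] by auto
  qed
qed simp

lemma prime_iprod:
  assumes P: "prime_in S P" and I: "ideal_in S I" and J: "ideal_in S J" and "iprod I J \<subseteq> P"
  shows "I \<subseteq> P \<or> J \<subseteq> P"
proof (rule ccontr)
  assume "\<not> ?thesis"
  then obtain a b where ab: "a \<in> I" "a \<notin> P" "b \<in> J" "b \<notin> P" by auto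
  have "a \<in> S" "b \<in> S" using ab ideal_inD(1)[OF I] ideal_inD(1)[OF J] by auto
  then have "a \<in> P \<or> b \<in> P"
  proof (rule prime_inD(3)[OF P])
    fix s assume "s \<in> S"
    then have "a * s * b \<in> iprod I J" by (intro iprodI ideal_inD(5)[OF I] ab)
    then show "a * s * b \<in> P" using assms(4) by auto
  qed
  then show False using ab by simp
qed

lemma prime_iprods:
  assumes P: "prime_in S P" and "\<And>I. I \<in> set Is \<Longrightarrow> ideal_in S I" and "iprods Is \<subseteq> P"
  shows "\<exists>I\<in>set Is. I \<subseteq> P"
  using assms(2,3)
proof (induction Is)
  case Nil
  then show ?case using prime_inD(2)[OF P] ideal_inD(1)[OF prime_inD(1)[OF P]] by auto
next
  case (Cons J Js)
  have J: "ideal_in S J" "ideal_in S (iprods Js)" using Cons.prems(1) iprods_ideal[of Js] by auto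
  have "J \<subseteq> P \<or> iprods Js \<subseteq> P" by (rule prime_iprod[OF P J]) (use Cons.prems(2) in simp)
  then show ?case using Cons by auto
qed

lemma prime_ipow:
  assumes P: "prime_in S P" and Q: "ideal_in S Q" and "ipow Q n \<subseteq> P" shows "Q \<subseteq> P"
  using assms(3)
proof (induction n)
  case (Suc n)
  have "Q \<subseteq> P \<or> ipow Q n \<subseteq> P" by (rule prime_iprod[OF P Q ipow_ideal[OF Q]]) (use Suc.prems in simp)
  then show ?case using Suc.IH by auto
qed simp

lemma ipow_subset: "ideal_in S P \<Longrightarrow> ipow P n \<subseteq> P"
  using iprod_subset_left[of S P] ideal_inD(1)[OF ipow_ideal[of S P]] by (cases n) auto

text \<open>A pair \<open>(P, n)\<close> stands for the prime power with exponent \<open>n + 1\<close>.\<close>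

definition factors :: "('r set \<times> nat) list \<Rightarrow> 'r set list" where
  "factors ps = map (\<lambda>(P, n). ipow P n) ps"

definition irredundant :: "'r set list \<Rightarrow> bool" where
  "irredundant Is \<longleftrightarrow> length Is = 1 \<or>
     (\<forall>i<length Is. iprods Is \<noteq> iprods (take i Is @ drop (Suc i) Is))"

definition prime_powers :: "('r set \<times> nat) list \<Rightarrow> bool" where
  "prime_powers ps \<longleftrightarrow> distinct (map fst ps) \<and> (\<forall>(P, n)\<in>set ps. prime_in S P) \<and> irredundant (factors ps)"

lemma factors_ideal:
  assumes "prime_powers ps" "I \<in> set (factors ps)" shows "ideal_in S I"
  using assms ipow_ideal prime_inD(1) unfolding prime_powers_def factors_def by fastforce

lemma split_prime_powers:
  assumes "prime_powers ps" "(P, n) \<in> set ps"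
  obtains a b where "ps = a @ (P, n) # b" "factors ps = factors a @ ipow P n # factors b"
    "\<And>Q m. (Q, m) \<in> set a \<union> set b \<Longrightarrow> (Q, m) \<in> set ps \<and> Q \<noteq> P"
proof -
  from assms(2) obtain a b where ab: "ps = a @ (P, n) # b" by (auto simp: in_set_conv_decomp)
  have "distinct (map fst a @ P # map fst b)" using assms(1) ab by (simp add: prime_powers_def)
  then have "P \<notin> fst ` set a" "P \<notin> fst ` set b" by auto
  then have "\<And>Q m. (Q, m) \<in> set a \<union> set b \<Longrightarrow> (Q, m) \<in> set ps \<and> Q \<noteq> P"
    using ab by force
  then show ?thesis using that[of a b] ab by (simp add: factors_def)
qed

text \<open>A prime power is redundant as soon as the product contains a power of a smaller prime: the
  smaller prime lies in the graded part of the larger one, which is s-unital and contained in all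
  powers of the larger prime.\<close>

lemma prime_powers_incomparable:
  assumes ps: "prime_powers ps" and Q: "(Q, m) \<in> set ps" and P: "(P, n) \<in> set ps" and "Q \<noteq> P"
  shows "\<not> Q \<subseteq> P"
proof
  assume "Q \<subseteq> P"
  have pr: "prime_in S P" "prime_in S Q" using ps P Q by (auto simp: prime_powers_def)
  note PI = prime_inD(1)[OF pr(1)] and QI = prime_inD(1)[OF pr(2)]
  have QG: "Q \<subseteq> gr P" by (rule prime_strict_subset_gr[OF pr]) (use \<open>Q \<subseteq> P\<close> \<open>Q \<noteq> P\<close> in auto)
  obtain a b where ab: "ps = a @ (P, n) # b" "factors ps = factors a @ ipow P n # factors b"
    by (rule split_prime_powers[OF ps P], rule that)
  define A B where "A = iprods (factors a)" and "B = iprods (factors b)"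
  have idl: "ideal_in S I" if "I \<in> set (factors a) \<union> set (factors b)" for I
    using factors_ideal[OF ps, of I] that by (auto simp: ab(2))
  then have A: "ideal_in S A" and B: "ideal_in S B" unfolding A_def B_def by (auto intro: iprods_ideal)
  have len: "length a < length ps" by (simp add: ab(1))
  have "length ps \<noteq> 1" using Q P \<open>Q \<noteq> P\<close> by (auto simp: length_Suc_conv)
  then have irr: "iprods (factors ps) \<noteq> iprods (take (length a) (factors ps) @ drop (Suc (length a)) (factors ps))"
    using ps len by (auto simp: prime_powers_def irredundant_def factors_def)
  have full: "iprods (factors ps) = iprod A (iprod (ipow P n) B)"
  proof -
    have "iprods (factors ps) = iprod A (iprods (ipow P n # factors b))"
      unfolding ab(2) A_def by (rule iprods_append) (use idl ipow_ideal[OF PI] in auto)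
    then show ?thesis by (simp add: B_def)
  qed
  have "iprods (take (length a) (factors ps) @ drop (Suc (length a)) (factors ps)) = iprods (factors a @ factors b)"
    unfolding ab(2) by (simp add: factors_def)
  also have "\<dots> = iprod A B" unfolding A_def B_def by (rule iprods_append) (use idl in auto)
  finally have neq: "iprod A (iprod (ipow P n) B) \<noteq> iprod A B" using irr full by simp
  \<comment> \<open>The factors on the side of \<open>Q\<close> have their product in \<open>gr P\<close>, and there \<open>P\<close> contributes a unit.\<close>
  have inG: "iprods (factors c) \<subseteq> gr P"
    if "(Q, m) \<in> set c" "\<And>I. I \<in> set (factors c) \<Longrightarrow> ideal_in S I" for c
  proof -
    have "ipow Q m \<in> set (factors c)" using that(1) by (force simp: factors_def)
    from iprods_subset_member[OF that(2) this] show ?thesis using ipow_subset[OF QI] QG by blast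
  qed
  have "(Q, m) \<in> set a \<or> (Q, m) \<in> set b" using Q \<open>Q \<noteq> P\<close> by (simp add: ab(1))
  then show False
  proof
    assume "(Q, m) \<in> set a"
    then have AG: "A \<subseteq> gr P" unfolding A_def by (rule inG) (use idl in auto)
    have "iprod A (ipow P n) = A"
    proof
      show "iprod A (ipow P n) \<subseteq> A" by (rule iprod_subset_left[OF A ideal_inD(1)[OF ipow_ideal[OF PI]]])
      show "A \<subseteq> iprod A (ipow P n)"
      proof
        fix x assume x: "x \<in> A"
        from gr_right_unit[OF PI, of x] x AG obtain v where v: "v \<in> gr P" "x * v = x" by auto
        have "v \<in> ipow P n" using v(1) gr_subset_ipow[OF PI] by auto
        then show "x \<in> iprod A (ipow P n)" using iprodI[OF x, of v "ipow P n"] v(2) by simp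
      qed
    qed
    then show False using neq by (simp add: iprod_assoc[symmetric])
  next
    assume "(Q, m) \<in> set b"
    then have BG: "B \<subseteq> gr P" unfolding B_def by (rule inG) (use idl in auto)
    have "iprod (ipow P n) B = B"
    proof
      show "iprod (ipow P n) B \<subseteq> B" by (rule iprod_subset_right[OF B ideal_inD(1)[OF ipow_ideal[OF PI]]])
      show "B \<subseteq> iprod (ipow P n) B"
      proof
        fix x assume x: "x \<in> B"
        from gr_left_unit[OF PI, of x] x BG obtain v where v: "v \<in> gr P" "v * x = x" by auto
        have "v \<in> ipow P n" using v(1) gr_subset_ipow[OF PI] by auto
        then show "x \<in> iprod (ipow P n) B" using iprodI[of v "ipow P n" x B, OF _ x] v(2) by simp
      qed
    qed
    then show False using neq by simp
  qed
qed

lemma prime_below_factor: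
  assumes ps: "prime_powers ps" and qs: "prime_powers qs"
    and eq: "iprods (factors ps) = iprods (factors qs)" and P: "(P, n) \<in> set ps"
  shows "\<exists>(Q, m)\<in>set qs. Q \<subseteq> P"
proof -
  have pr: "prime_in S P" using ps P by (auto simp: prime_powers_def)
  have "ipow P n \<in> set (factors ps)" using P by (force simp: factors_def)
  from iprods_subset_member[OF factors_ideal[OF ps] this] have "iprods (factors qs) \<subseteq> P"
    using eq ipow_subset[OF prime_inD(1)[OF pr]] by blast
  from prime_iprods[OF pr factors_ideal[OF qs] this] obtain I where "I \<in> set (factors qs)" "I \<subseteq> P" by auto
  then obtain Q m where Q: "(Q, m) \<in> set qs" "ipow Q m \<subseteq> P" by (auto simp: factors_def)
  have "prime_in S Q" using qs Q(1) by (auto simp: prime_powers_def)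
  then have "Q \<subseteq> P" using prime_ipow[OF pr prime_inD(1) Q(2)] by simp
  then show ?thesis using Q(1) by auto
qed

text \<open>A prime of one product lies above one of the other and vice versa; by incomparability the two inclusions
  are equalities.\<close>

lemma same_primes:
  assumes ps: "prime_powers ps" and qs: "prime_powers qs"
    and eq: "iprods (factors ps) = iprods (factors qs)"
  shows "fst ` set ps \<subseteq> fst ` set qs"
proof (rule subsetI)
  fix P assume "P \<in> fst ` set ps"
  then obtain n where P: "(P, n) \<in> set ps" by auto
  from prime_below_factor[OF ps qs eq P] obtain Q m where Q: "(Q, m) \<in> set qs" "Q \<subseteq> P" by auto
  from prime_below_factor[OF qs ps eq[symmetric] Q(1)] obtain P' n' where P': "(P', n') \<in> set ps" "P' \<subseteq> Q" by auto
  have "P' = P" using prime_powers_incomparable[OF ps P'(1) P] P'(2) Q(2) by auto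
  then have "Q = P" using P'(2) Q(2) by simp
  then show "P \<in> fst ` set qs" using Q(1) by force
qed

text \<open>The remaining factors of the product are not contained in \<open>P\<close>, so they can be cancelled.\<close>

lemma same_powers:
  assumes ps: "prime_powers ps" and qs: "prime_powers qs"
    and eq: "iprods (factors ps) = iprods (factors qs)"
    and P: "(P, r) \<in> set ps" "(P, s) \<in> set qs" and "r \<le> s"
  shows "ipow P r = ipow P s"
proof -
  have pr: "prime_in S P" using ps P by (auto simp: prime_powers_def)
  note PI = prime_inD(1)[OF pr]
  from split_prime_powers[OF ps P(1)] obtain a b where ab: "ps = a @ (P, r) # b"
    "factors ps = factors a @ ipow P r # factors b"
    "\<And>Q m. (Q, m) \<in> set a \<union> set b \<Longrightarrow> (Q, m) \<in> set ps \<and> Q \<noteq> P" by blast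
  have idl: "ideal_in S I" if "I \<in> set (factors a) \<union> set (factors b)" for I
    using factors_ideal[OF ps, of I] that by (auto simp: ab(2))
  have nsub: "\<not> iprods (factors c) \<subseteq> P" if c: "set c \<subseteq> set a \<union> set b" for c
  proof
    assume sub: "iprods (factors c) \<subseteq> P"
    have "set (factors c) \<subseteq> set (factors a) \<union> set (factors b)" using c by (auto simp: factors_def)
    then have "\<And>I. I \<in> set (factors c) \<Longrightarrow> ideal_in S I" using idl by auto
    from prime_iprods[OF pr this sub] obtain I where "I \<in> set (factors c)" "I \<subseteq> P" by auto
    then obtain Q m where Q: "(Q, m) \<in> set c" "ipow Q m \<subseteq> P" by (auto simp: factors_def)
    then have Q': "(Q, m) \<in> set ps" "Q \<noteq> P" using ab(3)[of Q m] c by auto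
    then have "prime_in S Q" using ps by (auto simp: prime_powers_def)
    then have "Q \<subseteq> P" using prime_ipow[OF pr prime_inD(1) Q(2)] by simp
    then show False using prime_powers_incomparable[OF ps Q'(1) P(1) Q'(2)] by simp
  qed
  have A: "ideal_in S (iprods (factors a))" and B: "ideal_in S (iprods (factors b))"
    using idl by (auto intro: iprods_ideal)
  have "ipow P s \<in> set (factors qs)" using P(2) by (force simp: factors_def)
  from iprods_subset_member[OF factors_ideal[OF qs] this]
  have sub: "iprods (factors ps) \<subseteq> ipow P s" using eq by simp
  show ?thesis
  proof (rule prime_power_cancel[OF pr A nsub B nsub \<open>r \<le> s\<close>])
    fix x y z assume *: "x \<in> iprods (factors a)" "y \<in> ipow P r" "z \<in> iprods (factors b)"
    have "x * (y * z) \<in> iprod (iprods (factors a)) (iprods (ipow P r # factors b))"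
      using * by (auto intro!: iprodI)
    also have "\<dots> = iprods (factors ps)"
      unfolding ab(2) by (rule iprods_append[symmetric]) (use idl ipow_ideal[OF PI] in auto)
    finally show "x * y * z \<in> ipow P s" using sub by (auto simp: mult.assoc)
  qed auto
qed

theorem unique_prime_powers:
  assumes ps: "prime_powers ps" and qs: "prime_powers qs"
    and eq: "iprods (factors ps) = iprods (factors qs)"
  shows "length ps = length qs \<and>
    (\<exists>\<sigma>. \<sigma> permutes {..<length ps} \<and> (\<forall>i<length ps. factors ps ! i = factors qs ! \<sigma> i))"
proof -
  have dist: "distinct (map fst ps)" "distinct (map fst qs)" using ps qs by (simp_all add: prime_powers_def)
  have "fst ` set ps = fst ` set qs" using same_primes[OF ps qs eq] same_primes[OF qs ps eq[symmetric]] by auto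
  then have "set (map fst ps) = set (map fst qs)" by simp
  then have m: "mset (map fst ps) = mset (map fst qs)"
    using set_eq_iff_mset_eq_distinct[OF dist] by blast
  then have len: "length ps = length qs" by (metis length_map size_mset)
  from mset_eq_permutation[OF m] obtain \<sigma> where \<sigma>: "\<sigma> permutes {..<length (map fst qs)}"
    "permute_list \<sigma> (map fst qs) = map fst ps" by auto
  have "factors ps ! i = factors qs ! \<sigma> i" if i: "i < length ps" for i
  proof -
    have \<sigma>i: "\<sigma> i < length qs" using permutes_in_image[OF \<sigma>(1), of i] i len by simp
    have "fst (ps ! i) = fst (qs ! \<sigma> i)"
      using arg_cong[OF \<sigma>(2), of "\<lambda>xs. xs ! i"] permute_list_nth[OF \<sigma>(1), of i] i len \<sigma>i by simp
    then obtain P r s where prs: "ps ! i = (P, r)" "qs ! \<sigma> i = (P, s)" by (metis prod.collapse)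
    then have in_set: "(P, r) \<in> set ps" "(P, s) \<in> set qs" using i \<sigma>i by (metis nth_mem)+
    have "ipow P r = ipow P s"
    proof (cases "r \<le> s")
      case True
      then show ?thesis by (rule same_powers[OF ps qs eq in_set])
    next
      case False
      then have "s \<le> r" by simp
      from same_powers[OF qs ps eq[symmetric] in_set(2,1) this] show ?thesis by simp
    qed
    then show ?thesis using prs i \<sigma>i by (simp add: factors_def)
  qed
  then show ?thesis using len \<sigma>(1) by auto
qed

end

section \<open>Transport along an isomorphism onto a subring\<close>

text \<open>An isomorphism \<open>\<phi>\<close> of a ring given by a record onto a subring \<open>S\<close> of a ring type. The record need not have an
  identity, so the inverses of its additive group are recovered from \<open>S\<close>.\<close>

locale ring_transport =
  fixes R :: "('a, 'b) ring_scheme" (structure) and \<phi> :: "'a \<Rightarrow> 'r::ring" and S :: "'r set"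
  assumes bij: "bij_betw \<phi> (carrier R) S"
    and add_closed: "x \<in> carrier R \<Longrightarrow> y \<in> carrier R \<Longrightarrow> x \<oplus> y \<in> carrier R"
    and mult_closed: "x \<in> carrier R \<Longrightarrow> y \<in> carrier R \<Longrightarrow> x \<otimes> y \<in> carrier R"
    and zero_closed: "\<zero> \<in> carrier R"
    and \<phi>_add: "x \<in> carrier R \<Longrightarrow> y \<in> carrier R \<Longrightarrow> \<phi> (x \<oplus> y) = \<phi> x + \<phi> y"
    and \<phi>_mult: "x \<in> carrier R \<Longrightarrow> y \<in> carrier R \<Longrightarrow> \<phi> (x \<otimes> y) = \<phi> x * \<phi> y"
    and \<phi>_zero: "\<phi> \<zero> = 0"
    and uminus_closed: "s \<in> S \<Longrightarrow> - s \<in> S"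
begin

lemma \<phi>_S: "x \<in> carrier R \<Longrightarrow> \<phi> x \<in> S"
  using bij by (auto simp: bij_betw_def)

lemma \<phi>_inj: "x \<in> carrier R \<Longrightarrow> y \<in> carrier R \<Longrightarrow> \<phi> x = \<phi> y \<Longrightarrow> x = y"
  using bij by (auto simp: bij_betw_def dest: inj_onD)

lemma \<phi>_surj: assumes "y \<in> S" obtains x where "x \<in> carrier R" "\<phi> x = y"
  using bij assms by (auto simp: bij_betw_def)

lemma \<phi>_minus:
  assumes "x \<in> carrier R" shows "inv\<^bsub>add_monoid R\<^esub> x \<in> carrier R \<and> \<phi> (inv\<^bsub>add_monoid R\<^esub> x) = - \<phi> x"
proof -
  obtain y where y: "y \<in> carrier R" "\<phi> y = - \<phi> x"
    using \<phi>_surj[OF uminus_closed[OF \<phi>_S[OF assms]]] by metis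
  have xy: "x \<oplus> y = \<zero>" "y \<oplus> x = \<zero>"
    using assms y by (auto intro!: \<phi>_inj add_closed zero_closed simp: \<phi>_add \<phi>_zero)
  have "inv\<^bsub>add_monoid R\<^esub> x = y"
    unfolding m_inv_def
  proof (rule the_equality)
    show "y \<in> carrier (add_monoid R) \<and> x \<otimes>\<^bsub>add_monoid R\<^esub> y = \<one>\<^bsub>add_monoid R\<^esub> \<and> y \<otimes>\<^bsub>add_monoid R\<^esub> x = \<one>\<^bsub>add_monoid R\<^esub>"
      using y xy by simp
    fix z assume z: "z \<in> carrier (add_monoid R) \<and> x \<otimes>\<^bsub>add_monoid R\<^esub> z = \<one>\<^bsub>add_monoid R\<^esub> \<and> z \<otimes>\<^bsub>add_monoid R\<^esub> x = \<one>\<^bsub>add_monoid R\<^esub>"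
    then have "\<phi> x + \<phi> z = 0" using assms \<phi>_add[of x z] \<phi>_zero by simp
    moreover have "\<phi> x + \<phi> y = 0" using y(2) by simp
    ultimately have "\<phi> z = \<phi> y" by (metis add_left_cancel)
    then show "z = y" using z y by (auto intro: \<phi>_inj)
  qed
  then show ?thesis using y by simp
qed

lemma two_sided_ideal_iff:
  "two_sided_ideal R I \<longleftrightarrow> I \<subseteq> carrier R \<and> ideal_in S (\<phi> ` I)"
proof
  assume I: "two_sided_ideal R I"
  then have "subgroup I (add_monoid R)" by (simp add: two_sided_ideal_def additive_subgroup_def)
  then have sub: "I \<subseteq> carrier R" "\<And>x y. x \<in> I \<Longrightarrow> y \<in> I \<Longrightarrow> x \<oplus> y \<in> I" "\<zero> \<in> I"
    "\<And>x. x \<in> I \<Longrightarrow> inv\<^bsub>add_monoid R\<^esub> x \<in> I" by (auto simp: subgroup_def)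
  have "ideal_in S (\<phi> ` I)" unfolding ideal_in_def
  proof (intro conjI ballI)
    show "\<phi> ` I \<subseteq> S" using sub(1) \<phi>_S by auto
    show "0 \<in> \<phi> ` I" using sub(3) \<phi>_zero by (metis imageI)
    fix a assume "a \<in> \<phi> ` I"
    then obtain x where x: "a = \<phi> x" "x \<in> I" "x \<in> carrier R" using sub(1) by auto
    show "a - b \<in> \<phi> ` I" if b: "b \<in> \<phi> ` I" for b
    proof -
      from b obtain y where y: "b = \<phi> y" "y \<in> I" "y \<in> carrier R" using sub(1) by auto
      have "\<phi> (x \<oplus> inv\<^bsub>add_monoid R\<^esub> y) = a - b"
        using \<phi>_add[OF x(3), of "inv\<^bsub>add_monoid R\<^esub> y"] \<phi>_minus[OF y(3)] x y by simp
      moreover have "x \<oplus> inv\<^bsub>add_monoid R\<^esub> y \<in> I" using sub(2,4) x y by simp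
      ultimately show ?thesis by (metis imageI)
    qed
    show "s * a \<in> \<phi> ` I" "a * s \<in> \<phi> ` I" if s: "s \<in> S" for s
    proof -
      from \<phi>_surj[OF s] obtain t where t: "t \<in> carrier R" "\<phi> t = s" by auto
      have "t \<otimes> x \<in> I" "x \<otimes> t \<in> I" using I x(2) t(1) by (simp_all add: two_sided_ideal_def)
      then show "s * a \<in> \<phi> ` I" "a * s \<in> \<phi> ` I"
        using \<phi>_mult[OF t(1) x(3)] \<phi>_mult[OF x(3) t(1)] t(2) x(1) by (metis imageI)+
    qed
  qed
  then show "I \<subseteq> carrier R \<and> ideal_in S (\<phi> ` I)" using sub(1) by simp
next
  assume I: "I \<subseteq> carrier R \<and> ideal_in S (\<phi> ` I)"
  then have IS: "ideal_in S (\<phi> ` I)" and Ic: "\<And>x. x \<in> I \<Longrightarrow> x \<in> carrier R" by auto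
  have mem: "x \<in> I" if "x \<in> carrier R" "\<phi> x \<in> \<phi> ` I" for x
    using that Ic \<phi>_inj by (metis imageE)
  have "subgroup I (add_monoid R)"
  proof
    show "I \<subseteq> carrier (add_monoid R)" using I by simp
    show "x \<otimes>\<^bsub>add_monoid R\<^esub> y \<in> I" if "x \<in> I" "y \<in> I" for x y
      using that mem[OF add_closed[OF Ic Ic]] \<phi>_add[OF Ic Ic] ideal_in_add[OF IS, of "\<phi> x" "\<phi> y"] by simp
    show "\<one>\<^bsub>add_monoid R\<^esub> \<in> I" using mem[OF zero_closed] \<phi>_zero ideal_inD(2)[OF IS] by simp
    show "inv\<^bsub>add_monoid R\<^esub> x \<in> I" if "x \<in> I" for x
      using that mem \<phi>_minus[OF Ic] ideal_in_uminus[OF IS, of "\<phi> x"] by simp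
  qed
  moreover have "y \<otimes> x \<in> I \<and> x \<otimes> y \<in> I" if "x \<in> I" "y \<in> carrier R" for x y
    using that mem[OF mult_closed[OF that(2) Ic]] mem[OF mult_closed[OF Ic that(2)]]
      \<phi>_mult[OF that(2) Ic] \<phi>_mult[OF Ic that(2)] ideal_inD(4,5)[OF IS, of "\<phi> x" "\<phi> y"] \<phi>_S by simp
  ultimately show "two_sided_ideal R I"
    by (simp add: two_sided_ideal_def additive_subgroup_def)
qed

lemma image_ideal_prod:
  assumes I: "I \<subseteq> carrier R" "0 \<in> \<phi> ` I" and J: "J \<subseteq> carrier R"  "0 \<in> \<phi> ` J"
  shows "ideal_prod R I J \<subseteq> carrier R" "\<phi> ` ideal_prod R I J = iprod (\<phi> ` I) (\<phi> ` J)"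
proof -
  have *: "x \<in> carrier R \<and> \<phi> x \<in> iprod (\<phi> ` I) (\<phi> ` J)" if "x \<in> ideal_prod R I J" for x
    using that
  proof (induction x rule: ideal_prod.induct)
    case (prod i j)
    then have ij: "i \<in> carrier R" "j \<in> carrier R" using I J by auto
    have "\<phi> i * \<phi> j \<in> iprod (\<phi> ` I) (\<phi> ` J)" by (intro iprodI imageI prod)
    then show ?case using mult_closed[OF ij] \<phi>_mult[OF ij] by simp
  next
    case (sum s1 s2)
    then show ?case using add_closed[of s1 s2] \<phi>_add[of s1 s2] by (simp add: iprod_def aspan_add)
  qed
  then show "ideal_prod R I J \<subseteq> carrier R" by auto
  have "iprod (\<phi> ` I) (\<phi> ` J) \<subseteq> \<phi> ` ideal_prod R I J"
  proof (rule iprod_subset)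
    show "a * b \<in> \<phi> ` ideal_prod R I J" if ab: "a \<in> \<phi> ` I" "b \<in> \<phi> ` J" for a b
    proof -
      from ab obtain i j where ij: "i \<in> I" "j \<in> J" "a = \<phi> i" "b = \<phi> j" by auto
      have "\<phi> (i \<otimes> j) = a * b" using \<phi>_mult[of i j] ij I J by auto
      then show ?thesis using ideal_prod.prod[OF ij(1,2), of R] by (metis imageI)
    qed
    from this[OF I(2) J(2)] show "0 \<in> \<phi> ` ideal_prod R I J" by simp
    show "a + b \<in> \<phi> ` ideal_prod R I J" if ab: "a \<in> \<phi> ` ideal_prod R I J" "b \<in> \<phi> ` ideal_prod R I J" for a b
    proof -
      from ab obtain x y where xy: "x \<in> ideal_prod R I J" "y \<in> ideal_prod R I J" "a = \<phi> x" "b = \<phi> y" by auto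
      have "\<phi> (x \<oplus> y) = a + b" using \<phi>_add *[OF xy(1)] *[OF xy(2)] xy(3,4) by simp
      then show ?thesis using ideal_prod.sum[OF xy(1,2)] by (metis imageI)
    qed
  qed
  then show "\<phi> ` ideal_prod R I J = iprod (\<phi> ` I) (\<phi> ` J)" using * by auto
qed

lemma image_inj:
  assumes "I \<subseteq> carrier R" "J \<subseteq> carrier R" "\<phi> ` I = \<phi> ` J" shows "I = J"
  using inj_on_image_eq_iff[of \<phi> "carrier R" I J] assms bij by (auto simp: bij_betw_def)

lemma two_sided_ideal_vimage:
  assumes J: "ideal_in S J" shows "\<exists>I. two_sided_ideal R I \<and> \<phi> ` I = J"
proof -
  have "\<phi> ` (carrier R \<inter> \<phi> -` J) = J"
  proof
    show "J \<subseteq> \<phi> ` (carrier R \<inter> \<phi> -` J)"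
    proof
      fix y assume y: "y \<in> J"
      then have "y \<in> S" using ideal_inD(1)[OF J] by auto
      from \<phi>_surj[OF this] show "y \<in> \<phi> ` (carrier R \<inter> \<phi> -` J)" using y by (metis IntI imageI vimageI2)
    qed
  qed auto
  then show ?thesis using J by (intro exI[of _ "carrier R \<inter> \<phi> -` J"]) (simp add: two_sided_ideal_iff)
qed

end

locale cohn_transport = graded_cohn_family E V Ed Gh sc comp + ring_transport R \<phi> S
  for E :: "('v, 'e) pre_digraph" and V :: "'v \<Rightarrow> 'r::ring" and Ed Gh :: "'e \<Rightarrow> 'r"
    and sc :: "'k::field \<Rightarrow> 'r" and comp :: "int \<Rightarrow> 'r \<Rightarrow> 'r"
    and R :: "('a, 'b) ring_scheme" and \<phi> :: "'a \<Rightarrow> 'r"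
begin

lemma prime_ideal_image:
  assumes P: "prime_ideal R P" shows "prime_in S (\<phi> ` P)"
  unfolding prime_in_def
proof (intro conjI ballI impI)
  have PI: "two_sided_ideal R P" using P by (simp add: prime_ideal_def)
  then have Pc: "P \<subseteq> carrier R" and PS: "ideal_in S (\<phi> ` P)" by (simp_all add: two_sided_ideal_iff)
  show "ideal_in S (\<phi> ` P)" by fact
  show "\<phi> ` P \<noteq> S"
  proof
    assume "\<phi> ` P = S"
    then have "\<phi> ` P = \<phi> ` carrier R" using bij by (simp add: bij_betw_def)
    then have "P = carrier R" by (rule image_inj[OF Pc subset_refl])
    then show False using P by (simp add: prime_ideal_def)
  qed
  fix a b assume a: "a \<in> S" and b: "b \<in> S" and ab: "\<forall>s\<in>S. a * s * b \<in> \<phi> ` P"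
  let ?X = "\<lambda>a. {x * a * y | x y. x \<in> S \<and> y \<in> S}"
  from two_sided_ideal_vimage[OF ideal_generated_by(1)[OF a]] obtain I where
    I: "two_sided_ideal R I" "\<phi> ` I = aspan (?X a)" by auto
  from two_sided_ideal_vimage[OF ideal_generated_by(1)[OF b]] obtain J where
    J: "two_sided_ideal R J" "\<phi> ` J = aspan (?X b)" by auto
  have Ic: "I \<subseteq> carrier R" "ideal_in S (\<phi> ` I)" and Jc: "J \<subseteq> carrier R" "ideal_in S (\<phi> ` J)"
    using I(1) J(1) by (simp_all add: two_sided_ideal_iff)
  note prod = image_ideal_prod[OF Ic(1) ideal_inD(2)[OF Ic(2)] Jc(1) ideal_inD(2)[OF Jc(2)]]
  have "iprod (\<phi> ` I) (\<phi> ` J) \<subseteq> \<phi> ` P"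
  proof (rule iprod_subset)
    fix u v assume u: "u \<in> \<phi> ` I" and v: "v \<in> \<phi> ` J"
    have "aspan (?X a) \<subseteq> {u. u * v \<in> \<phi> ` P}"
    proof (rule aspan_closed_set)
      show "?X a \<subseteq> {u. u * v \<in> \<phi> ` P}"
      proof
        fix u assume "u \<in> ?X a"
        then obtain x y where u: "u = x * a * y" "x \<in> S" "y \<in> S" by auto
        have "aspan (?X b) \<subseteq> {v. u * v \<in> \<phi> ` P}"
        proof (rule aspan_closed_set)
          show "?X b \<subseteq> {v. u * v \<in> \<phi> ` P}"
          proof
            fix v assume "v \<in> ?X b"
            then obtain x' y' where v: "v = x' * b * y'" "x' \<in> S" "y' \<in> S" by auto
            have "x * (a * (y * x') * b) * y' \<in> \<phi> ` P"
              by (intro ideal_inD(4,5)[OF PS] bspec[OF ab] S_mult u v)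
            then show "v \<in> {v. u * v \<in> \<phi> ` P}" by (simp add: u(1) v(1) mult.assoc)
          qed
        qed (simp_all add: ideal_inD(2)[OF PS] distrib_left ideal_in_add[OF PS])
        then show "u \<in> {u. u * v \<in> \<phi> ` P}" using v J(2) by auto
      qed
    qed (simp_all add: ideal_inD(2)[OF PS] distrib_right ideal_in_add[OF PS])
    then show "u * v \<in> \<phi> ` P" using u I(2) by auto
  qed (simp_all add: ideal_inD(2)[OF PS] ideal_in_add[OF PS])
  then have "\<phi> ` ideal_prod R I J \<subseteq> \<phi> ` P" using prod(2) by simp
  have "ideal_prod R I J \<subseteq> P"
  proof
    fix x assume x: "x \<in> ideal_prod R I J"
    then obtain p where p: "p \<in> P" "\<phi> x = \<phi> p" using \<open>\<phi> ` ideal_prod R I J \<subseteq> \<phi> ` P\<close> by auto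
    have "x = p" by (rule \<phi>_inj[OF _ _ p(2)]) (use x p(1) prod(1) Pc in auto)
    then show "x \<in> P" using p(1) by simp
  qed
  then have "I \<subseteq> P \<or> J \<subseteq> P" using P I(1) J(1) by (auto simp: prime_ideal_def)
  moreover have "a \<in> \<phi> ` I" "b \<in> \<phi> ` J" using ideal_generated_by(2) a b I(2) J(2) by auto
  ultimately show "a \<in> \<phi> ` P \<or> b \<in> \<phi> ` P" by auto
qed

lemma image_ideal_list_prod:
  assumes "\<And>I. I \<in> set Is \<Longrightarrow> two_sided_ideal R I"
  shows "ideal_list_prod R Is \<subseteq> carrier R \<and> \<phi> ` ideal_list_prod R Is = iprods (map (image \<phi>) Is)"
  using assms
proof (induction Is)
  case Nil
  then show ?case using bij by (simp add: bij_betw_def)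
next
  case (Cons I Is)
  have I: "I \<subseteq> carrier R" "ideal_in S (\<phi> ` I)" using Cons.prems by (simp_all add: two_sided_ideal_iff)
  show ?case
  proof (cases Is)
    case Nil
    then show ?thesis using I by (simp add: iprod_S)
  next
    case (Cons J Js)
    have IH: "ideal_list_prod R Is \<subseteq> carrier R" "\<phi> ` ideal_list_prod R Is = iprods (map (image \<phi>) Is)"
      using Cons.IH Cons.prems by auto
    have "ideal_in S (iprods (map (image \<phi>) Is))"
      by (rule iprods_ideal) (use Cons.prems in \<open>auto simp: two_sided_ideal_iff\<close>)
    then have "0 \<in> \<phi> ` ideal_list_prod R Is" unfolding IH(2) by (rule ideal_inD(2))
    note prod = image_ideal_prod[OF I(1) ideal_inD(2)[OF I(2)] IH(1) this]
    show ?thesis using prod IH(2) Cons by simp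
  qed
qed

lemma two_sided_ideal_power:
  assumes P: "two_sided_ideal R P"
  shows "two_sided_ideal R (ideal_power R P (Suc n))" "\<phi> ` ideal_power R P (Suc n) = ipow (\<phi> ` P) n"
proof -
  have PS: "ideal_in S (\<phi> ` P)" using P by (simp add: two_sided_ideal_iff)
  have *: "iprods (map (image \<phi>) (replicate (Suc n) P)) = ipow (\<phi> ` P) n"
  proof (induction n)
    case 0
    then show ?case using iprod_S[OF PS] by simp
  qed simp
  have "ideal_list_prod R (replicate (Suc n) P) \<subseteq> carrier R \<and>
    \<phi> ` ideal_list_prod R (replicate (Suc n) P) = iprods (map (image \<phi>) (replicate (Suc n) P))"
    by (rule image_ideal_list_prod) (use P in auto)
  then show "\<phi> ` ideal_power R P (Suc n) = ipow (\<phi> ` P) n"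
    and "two_sided_ideal R (ideal_power R P (Suc n))"
    using * ipow_ideal[OF PS, of n] by (simp_all only: ideal_power_def two_sided_ideal_iff)
qed

lemma prime_powers_image:
  assumes "powers_of_distinct_primes R Is" "irredundant_product R Is"
  shows "\<exists>ps. prime_powers ps \<and> factors ps = map (image \<phi>) Is \<and> (\<forall>I\<in>set Is. two_sided_ideal R I)"
proof -
  from assms(1) obtain Ps rs where len: "length Ps = length Is" "length rs = length Is" and
    dist: "distinct Ps" and Ps: "\<And>i. i < length Is \<Longrightarrow> prime_ideal R (Ps ! i)"
    and rs: "\<And>i. i < length Is \<Longrightarrow> rs ! i \<ge> 1 \<and> Is ! i = ideal_power R (Ps ! i) (rs ! i)"
    unfolding powers_of_distinct_primes_def by auto
  have tsi: "two_sided_ideal R (Ps ! i)" if "i < length Is" for i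
    using Ps[OF that] by (simp add: prime_ideal_def)
  have Is_i: "two_sided_ideal R (Is ! i) \<and> \<phi> ` (Is ! i) = ipow (\<phi> ` (Ps ! i)) (rs ! i - 1)" if i: "i < length Is" for i
  proof -
    have "Suc (rs ! i - 1) = rs ! i" using rs[OF i] by simp
    then show ?thesis using two_sided_ideal_power[OF tsi[OF i], of "rs ! i - 1"] rs[OF i] by simp
  qed
  define ps where "ps = map (\<lambda>i. (\<phi> ` (Ps ! i), rs ! i - 1)) [0..<length Is]"
  have fac: "factors ps = map (image \<phi>) Is"
    by (rule nth_equalityI) (simp_all add: factors_def ps_def Is_i)
  have Is_ideal: "\<forall>I\<in>set Is. two_sided_ideal R I" using Is_i by (auto simp: in_set_conv_nth)
  have "distinct (map fst ps)"
  proof -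
    have "map fst ps = map (image \<phi>) Ps"
      by (rule nth_equalityI) (simp_all add: ps_def len)
    moreover have "inj_on (image \<phi>) (set Ps)"
    proof (rule inj_onI)
      fix A B assume AB: "A \<in> set Ps" "B \<in> set Ps" "\<phi> ` A = \<phi> ` B"
      then have "A \<subseteq> carrier R" "B \<subseteq> carrier R"
        using tsi len(1) by (auto simp: in_set_conv_nth two_sided_ideal_iff)
      then show "A = B" using AB(3) by (rule image_inj)
    qed
    ultimately show ?thesis using dist by (simp add: distinct_map)
  qed
  moreover have "\<forall>(P, n)\<in>set ps. prime_in S P" using prime_ideal_image Ps by (auto simp: ps_def)
  moreover have "irredundant (factors ps)"
  proof (cases "length Is = 1")
    case True
    then show ?thesis by (simp add: irredundant_def fac)
  next
    case False
    have "iprods (map (image \<phi>) Is) \<noteq> iprods (take i (map (image \<phi>) Is) @ drop (Suc i) (map (image \<phi>) Is))"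
      if i: "i < length Is" for i
    proof
      let ?Js = "take i Is @ drop (Suc i) Is"
      assume eq: "iprods (map (image \<phi>) Is) = iprods (take i (map (image \<phi>) Is) @ drop (Suc i) (map (image \<phi>) Is))"
      have J: "\<And>I. I \<in> set ?Js \<Longrightarrow> two_sided_ideal R I"
        using Is_ideal by (auto dest: in_set_takeD in_set_dropD)
      have 1: "ideal_list_prod R Is \<subseteq> carrier R \<and> \<phi> ` ideal_list_prod R Is = iprods (map (image \<phi>) Is)"
        by (rule image_ideal_list_prod) (use Is_ideal in simp)
      have 2: "ideal_list_prod R ?Js \<subseteq> carrier R \<and> \<phi> ` ideal_list_prod R ?Js = iprods (map (image \<phi>) ?Js)"
        by (rule image_ideal_list_prod[OF J])
      have "\<phi> ` ideal_list_prod R Is = \<phi> ` ideal_list_prod R ?Js"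
        using 1 2 eq by (simp add: take_map drop_map)
      then have "ideal_list_prod R Is = ideal_list_prod R ?Js" using 1 2 image_inj by blast
      moreover have "\<forall>i<length Is. ideal_list_prod R Is \<noteq> ideal_list_prod R (take i Is @ drop (Suc i) Is)"
        using assms(2) False unfolding irredundant_product_def by blast
      ultimately show False using i by blast
    qed
    then show ?thesis by (simp add: irredundant_def fac)
  qed
  ultimately show ?thesis using fac Is_ideal unfolding prime_powers_def by blast
qed

theorem unique_prime_power_factors:
  assumes "powers_of_distinct_primes R Is" "irredundant_product R Is"
    and "powers_of_distinct_primes R Js" "irredundant_product R Js"
    and eq: "ideal_list_prod R Is = ideal_list_prod R Js"
  shows "length Is = length Js \<and>
    (\<exists>\<sigma>. \<sigma> permutes {..<length Is} \<and> (\<forall>i<length Is. Is ! i = Js ! \<sigma> i))"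
proof -
  from prime_powers_image[OF assms(1,2)] obtain ps where ps: "prime_powers ps"
    "factors ps = map (image \<phi>) Is" "\<forall>I\<in>set Is. two_sided_ideal R I" by auto
  from prime_powers_image[OF assms(3,4)] obtain qs where qs: "prime_powers qs"
    "factors qs = map (image \<phi>) Js" "\<forall>I\<in>set Js. two_sided_ideal R I" by auto
  have len: "length ps = length Is" "length qs = length Js"
    using arg_cong[OF ps(2), of length] arg_cong[OF qs(2), of length] by (simp_all add: factors_def)
  have "iprods (factors ps) = iprods (factors qs)"
    using image_ideal_list_prod[of Is] image_ideal_list_prod[of Js] ps(2,3) qs(2,3) eq by auto
  from unique_prime_powers[OF ps(1) qs(1) this] obtain \<sigma> where
    l: "length Is = length Js" and \<sigma>: "\<sigma> permutes {..<length Is}"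
    "\<And>i. i < length Is \<Longrightarrow> factors ps ! i = factors qs ! \<sigma> i" by (auto simp: len)
  have "Is ! i = Js ! \<sigma> i" if i: "i < length Is" for i
  proof -
    have si: "\<sigma> i < length Js" using permutes_in_image[OF \<sigma>(1), of i] i l by simp
    have "\<phi> ` (Is ! i) = \<phi> ` (Js ! \<sigma> i)" using \<sigma>(2)[OF i] ps(2) qs(2) i si by simp
    moreover have "Is ! i \<subseteq> carrier R" "Js ! \<sigma> i \<subseteq> carrier R"
      using ps(3) qs(3) i si by (auto simp: two_sided_ideal_iff)
    ultimately show ?thesis using image_inj by blast
  qed
  then show ?thesis using l \<sigma>(1) by blast
qed

end

section \<open>Additive endomorphisms\<close>

text \<open>Additive endomorphisms form a ring type in which the quotients of a free algebra by its various ideals, which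
  are not types themselves, can be embedded.\<close>

typedef (overloaded) 'a endo = "{f :: 'a::ab_group_add \<Rightarrow> 'a. \<forall>x y. f (x + y) = f x + f y}"
  morphisms app Endo
  by (rule exI[of _ "\<lambda>x. 0"]) simp

lemma app_add: "app f (x + y) = app f x + app f y"
  using app[of f] by simp

lemma app_Endo: "(\<And>x y. f (x + y) = f x + f y) \<Longrightarrow> app (Endo f) = f"
  by (rule Endo_inverse) simp

lemma endo_eqI: "(\<And>x. app f x = app g x) \<Longrightarrow> f = g"
  by (rule app_inject[THEN iffD1]) (rule ext)

instantiation endo :: (ab_group_add) ring
begin

definition "0 = Endo (\<lambda>x. 0)"
definition "f + g = Endo (\<lambda>x. app f x + app g x)"
definition "f - g = Endo (\<lambda>x. app f x - app g x)"
definition "- f = Endo (\<lambda>x. - app f x)"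
definition "f * g = Endo (\<lambda>x. app f (app g x))"

lemma app_simps [simp]:
  "app 0 x = 0" "app (f + g) x = app f x + app g x" "app (f - g) x = app f x - app g x"
  "app (- f) x = - app f x" "app (f * g) x = app f (app g x)"
  unfolding zero_endo_def plus_endo_def minus_endo_def uminus_endo_def times_endo_def
  by (simp_all add: app_Endo app_add)

instance
  by standard (rule endo_eqI, simp add: app_add add.assoc add.commute add.left_commute)+

end

text \<open>Extend a basis of \<open>W\<close> to one of the whole space and annihilate the former.\<close>

lemma (in vector_space) projection_along_subspace:
  assumes "subspace W"
  shows "\<exists>\<pi>. (\<forall>x y. \<pi> (x + y) = \<pi> x + \<pi> y) \<and> (\<forall>x. \<pi> x = 0 \<longleftrightarrow> x \<in> W) \<and> (\<forall>x. x - \<pi> x \<in> W)"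
proof -
  interpret vp: vector_space_pair scale scale by unfold_locales
  obtain B where B: "B \<subseteq> W" "independent B" "W \<subseteq> span B" using basis_exists[of W] by metis
  define C where "C = extend_basis B"
  have C: "independent C" "B \<subseteq> C" "span C = UNIV"
    using independent_extend_basis[OF B(2)] extend_basis_superset[OF B(2)] span_extend_basis[OF B(2)]
    by (simp_all add: C_def)
  define \<pi> where "\<pi> = vp.construct C (\<lambda>b. if b \<in> B then 0 else b)"
  have lin: "Vector_Spaces.linear scale scale \<pi>" unfolding \<pi>_def by (rule vp.linear_construct[OF C(1)])
  note add = vp.linear_add[OF lin] and scl = vp.linear_scale[OF lin] and zero = vp.linear_0[OF lin]
  have basis: "\<pi> b = (if b \<in> B then 0 else b)" if "b \<in> C" for b
    unfolding \<pi>_def by (rule vp.construct_basis[OF C(1) that])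
  have diff: "x - \<pi> x \<in> W" for x
  proof -
    have "x \<in> span C" using C(3) by simp
    then show ?thesis
    proof (induction rule: span_induct_alt)
      case base
      then show ?case using zero subspace_0[OF assms] by simp
    next
      case (step c x y)
      have "x - \<pi> x \<in> W" using basis[OF step(1)] B(1) subspace_0[OF assms] by auto
      then have "c *s (x - \<pi> x) + (y - \<pi> y) \<in> W"
        using step(2) subspace_add[OF assms] subspace_scale[OF assms] by blast
      moreover have "c *s x + y - \<pi> (c *s x + y) = c *s (x - \<pi> x) + (y - \<pi> y)"
        by (simp add: add scl scale_right_diff_distrib)
      ultimately show ?case by (simp only:)
    qed
  qed
  have "\<pi> x = 0" if "x \<in> W" for x
  proof -
    have "x \<in> span B" using B(3) that by auto
    then show ?thesis
    proof (induction rule: span_induct_alt)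
      case (step c x y)
      then have "\<pi> x = 0" using basis[of x] C(2) by auto
      then show ?case using step by (simp add: add scl)
    qed (rule zero)
  qed
  then have "\<pi> x = 0 \<longleftrightarrow> x \<in> W" for x using diff[of x] by auto
  then show ?thesis using add diff by blast
qed

section \<open>Noncommutative polynomials\<close>

definition restr :: "('a \<Rightarrow> bool) \<Rightarrow> ('a \<Rightarrow>\<^sub>0 'b::ab_group_add) \<Rightarrow> ('a \<Rightarrow>\<^sub>0 'b)" where
  "restr Q p = Poly_Mapping.mapp (\<lambda>k v. if Q k then v else 0) p"

lemma lookup_restr: "Poly_Mapping.lookup (restr Q p) k = (if Q k then Poly_Mapping.lookup p k else 0)"
  by (simp add: restr_def lookup_mapp in_keys_iff when_def)

lemma restr_add: "restr Q (p + q) = restr Q p + restr Q q"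
  by (rule poly_mapping_eqI) (simp add: lookup_restr lookup_add)

lemma restr_diff: "restr Q (p - q) = restr Q p - restr Q q"
  by (rule poly_mapping_eqI) (simp add: lookup_restr lookup_minus)

lemma restr_0 [simp]: "restr Q 0 = 0"
  by (rule poly_mapping_eqI) (simp add: lookup_restr)

lemma restr_single: "restr Q (Poly_Mapping.single k v) = (if Q k then Poly_Mapping.single k v else 0)"
  by (rule poly_mapping_eqI) (simp add: lookup_restr lookup_single when_def)

lemma restr_id: "(\<And>k. k \<in> Poly_Mapping.keys p \<Longrightarrow> Q k) \<Longrightarrow> restr Q p = p"
  by (rule poly_mapping_eqI) (auto simp: lookup_restr in_keys_iff)

lemma keys_restr: "Poly_Mapping.keys (restr Q p) = {k \<in> Poly_Mapping.keys p. Q k}"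
  by (auto simp: in_keys_iff lookup_restr split: if_splits)

lemma sum_singles: "(\<Sum>k\<in>Poly_Mapping.keys p. Poly_Mapping.single k (Poly_Mapping.lookup p k)) = (p :: 'a \<Rightarrow>\<^sub>0 'b::ab_group_add)"
proof (rule poly_mapping_eqI)
  fix j
  have "(\<Sum>k\<in>Poly_Mapping.keys p. Poly_Mapping.lookup (Poly_Mapping.single k (Poly_Mapping.lookup p k)) j) =
    (\<Sum>k\<in>Poly_Mapping.keys p. if k = j then Poly_Mapping.lookup p j else 0)"
    by (rule sum.cong) (auto simp: lookup_single when_def)
  then show "Poly_Mapping.lookup (\<Sum>k\<in>Poly_Mapping.keys p. Poly_Mapping.single k (Poly_Mapping.lookup p k)) j = Poly_Mapping.lookup p j"
    by (simp add: lookup_sum in_keys_iff)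
qed

lemma additive_sum:
  fixes f :: "'a::ab_group_add \<Rightarrow> 'b::ab_group_add"
  assumes "\<And>x y. f (x + y) = f x + f y" shows "f (sum g A) = (\<Sum>i\<in>A. f (g i))"
proof -
  have "f 0 = 0" using assms[of 0 0] by simp
  then show ?thesis by (induction A rule: infinite_finite_induct) (simp_all add: assms)
qed

lemma additive_eqI:
  fixes f g :: "('a \<Rightarrow>\<^sub>0 'b::ab_group_add) \<Rightarrow> 'c::ab_group_add"
  assumes f: "\<And>x y. f (x + y) = f x + f y" and g: "\<And>x y. g (x + y) = g x + g y"
    and "\<And>k v. f (Poly_Mapping.single k v) = g (Poly_Mapping.single k v)"
  shows "f p = g p"
  using additive_sum[of f, OF f, of "\<lambda>k. Poly_Mapping.single k (Poly_Mapping.lookup p k)" "Poly_Mapping.keys p"]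
    additive_sum[of g, OF g, of "\<lambda>k. Poly_Mapping.single k (Poly_Mapping.lookup p k)" "Poly_Mapping.keys p"]
  by (simp add: sum_singles assms(3))

abbreviation const :: "'k::field \<Rightarrow> 'g word \<Rightarrow>\<^sub>0 'k" where "const c \<equiv> Poly_Mapping.single 0 c"

lemma const_central: "const c * p = p * const c"
  by (rule additive_eqI[of "\<lambda>p. const c * p" "\<lambda>p. p * const c"])
    (simp_all add: distrib_left distrib_right mult_single mult.commute)

lemma const_vector_space: "vector_space (\<lambda>c (p :: 'g word \<Rightarrow>\<^sub>0 'k::field). const c * p)"
  by standard (simp_all add: distrib_left distrib_right single_add mult.assoc[symmetric] mult_single)

text \<open>Polynomials in the letters \<open>X\<close> with arbitrary constant term; \<open>polys0\<close> below are those with constant term zero.\<close>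

definition polys :: "'g set \<Rightarrow> ('g word \<Rightarrow>\<^sub>0 'k::field) set" where
  "polys X = {p. \<forall>w\<in>Poly_Mapping.keys p. set (letters w) \<subseteq> X}"

abbreviation polys0 :: "'g set \<Rightarrow> ('g word \<Rightarrow>\<^sub>0 'k::field) set" where
  "polys0 X \<equiv> carrier (free_algebra X)"

lemma polys0_iff: "p \<in> polys0 X \<longleftrightarrow> (\<forall>w\<in>Poly_Mapping.keys p. letters w \<noteq> [] \<and> set (letters w) \<subseteq> X)"
  by (simp add: free_algebra_def)

lemma polys0_polys: "p \<in> polys0 X \<Longrightarrow> p \<in> polys X"
  by (auto simp: polys0_iff polys_def)

lemma keys_mult_cases:
  assumes "w \<in> Poly_Mapping.keys (p * q)"
  obtains u v where "u \<in> Poly_Mapping.keys p" "v \<in> Poly_Mapping.keys q" "letters w = letters u @ letters v"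
proof -
  from assms keys_mult[of p q] obtain u v where "u \<in> Poly_Mapping.keys p" "v \<in> Poly_Mapping.keys q" "w = u + v" by auto
  then show ?thesis using that by (simp add: plus_word_def)
qed

lemma polys_mult: "p \<in> polys X \<Longrightarrow> q \<in> polys X \<Longrightarrow> p * q \<in> polys X"
  unfolding polys_def
proof (intro CollectI ballI)
  fix w assume pq: "p \<in> {p. \<forall>w\<in>Poly_Mapping.keys p. set (letters w) \<subseteq> X}"
    "q \<in> {p. \<forall>w\<in>Poly_Mapping.keys p. set (letters w) \<subseteq> X}" and "w \<in> Poly_Mapping.keys (p * q)"
  from keys_mult_cases[OF this(3)] obtain u v where "u \<in> Poly_Mapping.keys p" "v \<in> Poly_Mapping.keys q"
    "letters w = letters u @ letters v" by metis
  then show "set (letters w) \<subseteq> X" using pq by auto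
qed

lemma polys0_mult:
  fixes p q :: "'a word \<Rightarrow>\<^sub>0 'b::field"
  shows "p \<in> polys0 X \<Longrightarrow> q \<in> polys X \<Longrightarrow> p * q \<in> polys0 X"
    "p \<in> polys X \<Longrightarrow> q \<in> polys0 X \<Longrightarrow> p * q \<in> polys0 X"
proof -
  have *: "letters w \<noteq> [] \<and> set (letters w) \<subseteq> X"
    if pq: "p \<in> polys X" "q \<in> polys X" "p \<in> polys0 X \<or> q \<in> polys0 X" and w: "w \<in> Poly_Mapping.keys (p * q)"
    for p q :: "'a word \<Rightarrow>\<^sub>0 'b" and w
  proof -
    from keys_mult_cases[OF w] obtain u v where uv: "u \<in> Poly_Mapping.keys p" "v \<in> Poly_Mapping.keys q"
      "letters w = letters u @ letters v" by metis
    then have "set (letters u) \<subseteq> X" "set (letters v) \<subseteq> X" using pq(1,2) by (auto simp: polys_def)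
    moreover have "letters u \<noteq> [] \<or> letters v \<noteq> []" using pq(3) uv(1,2) by (auto simp: polys0_iff)
    ultimately show ?thesis using uv(3) by auto
  qed
  show "p * q \<in> polys0 X" if "p \<in> polys0 X" "q \<in> polys X"
    unfolding polys0_iff using *[OF polys0_polys[OF that(1)] that(2)] that by blast
  show "p * q \<in> polys0 X" if "p \<in> polys X" "q \<in> polys0 X"
    unfolding polys0_iff using *[OF that(1) polys0_polys[OF that(2)]] that by blast
qed

lemma polys0_add: "p \<in> polys0 X \<Longrightarrow> q \<in> polys0 X \<Longrightarrow> p + q \<in> polys0 X"
  using keys_add[of p q] unfolding polys0_iff by blast

lemma polys0_uminus: "p \<in> polys0 X \<Longrightarrow> - p \<in> polys0 X"
  by (simp add: polys0_iff in_keys_iff)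

lemma polys0_diff: "p \<in> polys0 X \<Longrightarrow> q \<in> polys0 X \<Longrightarrow> p - q \<in> polys0 X"
  using polys0_add[OF _ polys0_uminus, of p X q] by simp

lemma polys0_0: "0 \<in> polys0 X" by (simp add: polys0_iff)

lemma polys0_sum: "(\<And>i. i \<in> A \<Longrightarrow> f i \<in> polys0 X) \<Longrightarrow> sum f A \<in> polys0 X"
  by (induction A rule: infinite_finite_induct) (simp_all add: polys0_0 polys0_add)

lemma const_polys: "const c \<in> polys X"
  by (auto simp: polys_def zero_word_def in_keys_iff lookup_single when_def split: if_splits)

lemma single_polys0: "l \<noteq> [] \<Longrightarrow> set l \<subseteq> X \<Longrightarrow> Poly_Mapping.single (Word l) c \<in> polys0 X"
  by (auto simp: polys0_iff in_keys_iff lookup_single when_def split: if_splits)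

lemma single_polys: "set l \<subseteq> X \<Longrightarrow> Poly_Mapping.single (Word l) c \<in> polys X"
  by (auto simp: polys_def in_keys_iff lookup_single when_def split: if_splits)

lemma gen_polys0: "x \<in> X \<Longrightarrow> gen x \<in> polys0 X"
  unfolding gen_def by (rule single_polys0) simp_all

lemma polys_split:
  fixes p :: "'g word \<Rightarrow>\<^sub>0 'k::field"
  assumes "p \<in> polys X" shows "\<exists>c. \<exists>f\<in>polys0 X. p = const c + f"
proof -
  let ?f = "restr (\<lambda>w. letters w \<noteq> []) p"
  have "p = const (Poly_Mapping.lookup p 0) + ?f"
  proof (rule poly_mapping_eqI)
    fix w :: "'g word"
    have "letters w = [] \<longleftrightarrow> w = 0" by (cases w) (simp add: zero_word_def)
    then show "Poly_Mapping.lookup p w = Poly_Mapping.lookup (const (Poly_Mapping.lookup p 0) + ?f) w"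
      by (auto simp: lookup_add lookup_single lookup_restr when_def)
  qed
  moreover have "?f \<in> polys0 X" using assms by (auto simp: polys0_iff polys_def keys_restr)
  ultimately show ?thesis by blast
qed

lemma free_algebra_ops:
  "p \<oplus>\<^bsub>free_algebra X\<^esub> q = p + q" "p \<otimes>\<^bsub>free_algebra X\<^esub> q = p * q" "\<zero>\<^bsub>free_algebra X\<^esub> = 0"
  by (simp_all add: free_algebra_def)

lemma free_algebra_transport: "ring_transport (free_algebra X) (\<lambda>x. x) (polys0 X)"
  by unfold_locales (simp_all add: free_algebra_ops bij_betw_def polys0_add polys0_mult polys0_polys
      polys0_0 polys0_uminus)

lemma two_sided_ideal_free_algebra: "two_sided_ideal (free_algebra X) I \<longleftrightarrow> ideal_in (polys0 X) I"
  using ring_transport.two_sided_ideal_iff[OF free_algebra_transport, of X I] ideal_inD(1)[of "polys0 X" I] by auto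

section \<open>Quotients of free algebras as rings of endomorphisms\<close>

locale algebra_quotient =
  fixes X :: "'g set" and I0 :: "('g word \<Rightarrow>\<^sub>0 'k::field) set"
    and \<pi> :: "('g word \<Rightarrow>\<^sub>0 'k) \<Rightarrow> ('g word \<Rightarrow>\<^sub>0 'k)"
  assumes I0: "ideal_in (polys0 X) I0"
    and I0_const: "p \<in> I0 \<Longrightarrow> const c * p \<in> I0"
    and \<pi>_add: "\<pi> (x + y) = \<pi> x + \<pi> y"
    and \<pi>_eq_0: "\<pi> x = 0 \<longleftrightarrow> x \<in> I0"
    and \<pi>_diff: "x - \<pi> x \<in> I0"
begin

abbreviation \<rho> :: "('g word \<Rightarrow>\<^sub>0 'k) \<Rightarrow> ('g word \<Rightarrow>\<^sub>0 'k)" where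
  "\<rho> \<equiv> restr (\<lambda>w. set (letters w) \<subseteq> X)"

text \<open>Left multiplication by \<open>x\<close>, read modulo \<open>I0\<close> on the representatives chosen by \<open>\<pi>\<close>. The restriction \<open>\<rho>\<close> discards words with
  letters outside \<open>X\<close>, by which \<open>I0\<close> cannot be multiplied.\<close>

definition T :: "('g word \<Rightarrow>\<^sub>0 'k) \<Rightarrow> ('g word \<Rightarrow>\<^sub>0 'k) endo" where
  "T x = Endo (\<lambda>a. \<pi> (x * \<rho> a))"

lemma app_T: "app (T x) a = \<pi> (x * \<rho> a)"
  unfolding T_def by (simp add: app_Endo restr_add distrib_left \<pi>_add)

lemma I0_polys0: "i \<in> I0 \<Longrightarrow> i \<in> polys0 X" using ideal_inD(1)[OF I0] by auto

lemma I0_mult: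
  assumes "x \<in> polys X" "i \<in> I0" shows "x * i \<in> I0" "i * x \<in> I0"
proof -
  from polys_split[OF assms(1)] obtain c f where x: "x = const c + f" "f \<in> polys0 X" by auto
  show "x * i \<in> I0" unfolding x(1) distrib_right
    by (intro ideal_in_add[OF I0] I0_const assms ideal_inD(4)[OF I0] x)
  show "i * x \<in> I0" unfolding x(1) distrib_left const_central[symmetric]
    by (intro ideal_in_add[OF I0] I0_const assms ideal_inD(5)[OF I0] x)
qed

lemma \<rho>_polys: "\<rho> a \<in> polys X" by (auto simp: polys_def keys_restr)
lemma \<rho>_id: "a \<in> polys X \<Longrightarrow> \<rho> a = a" by (rule restr_id) (auto simp: polys_def)

lemma \<pi>_minus: "\<pi> (x - y) = \<pi> x - \<pi> y"
  using \<pi>_add[of "x - y" y] by (simp add: algebra_simps)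

lemma T_add: "T (x + y) = T x + T y"
  by (rule endo_eqI) (simp add: app_T distrib_right \<pi>_add)

lemma T_diff: "T (x - y) = T x - T y"
  by (rule endo_eqI) (simp add: app_T left_diff_distrib \<pi>_minus)

lemma T_0 [simp]: "T 0 = 0"
  using T_diff[of 0 0] by simp

lemma T_sum: "T (sum f A) = (\<Sum>i\<in>A. T (f i))"
  by (rule additive_sum) (rule T_add)

lemma T_mult: assumes x: "x \<in> polys X" and y: "y \<in> polys X" shows "T (x * y) = T x * T y"
proof (rule endo_eqI)
  fix a
  define b where "b = y * \<rho> a"
  have b: "b \<in> polys X" unfolding b_def by (intro polys_mult y \<rho>_polys)
  have d: "b - \<pi> b \<in> I0" by (rule \<pi>_diff)
  have "\<rho> (b - \<pi> b) = b - \<pi> b" by (rule \<rho>_id[OF polys0_polys[OF I0_polys0[OF d]]])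
  then have "\<rho> (\<pi> b) = \<pi> b" using \<rho>_id[OF b] by (simp add: restr_diff)
  moreover have "x * (b - \<pi> b) \<in> I0" by (rule I0_mult(1)[OF x d])
  then have "\<pi> (x * b) = \<pi> (x * \<pi> b)" using \<pi>_eq_0[of "x * (b - \<pi> b)"] by (simp add: right_diff_distrib \<pi>_minus)
  ultimately show "app (T (x * y)) a = app (T x * T y) a" by (simp add: app_T b_def mult.assoc)
qed

text \<open>The value at \<open>1\<close> already detects membership in \<open>I0\<close>.\<close>

lemma T_eq_0: assumes "x \<in> polys X" shows "T x = 0 \<longleftrightarrow> x \<in> I0"
proof
  assume "T x = 0"
  then have "\<pi> (x * \<rho> 1) = 0" using app_T[of x 1] by simp
  moreover have "\<rho> 1 = (1 :: 'g word \<Rightarrow>\<^sub>0 'k)" using \<rho>_id[OF const_polys[of 1 X]] by simp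
  ultimately show "x \<in> I0" by (simp add: \<pi>_eq_0)
next
  assume "x \<in> I0"
  then show "T x = 0" by (intro endo_eqI) (simp add: app_T \<pi>_eq_0 I0_mult(2)[OF \<rho>_polys])
qed

lemma T_eq: assumes "x \<in> polys0 X" "y \<in> polys0 X" shows "T x = T y \<longleftrightarrow> x - y \<in> I0"
  using T_eq_0[OF polys0_polys[OF polys0_diff[OF assms]]] by (simp add: T_diff)

abbreviation "Q \<equiv> free_algebra X Quot I0"

definition coset :: "('g word \<Rightarrow>\<^sub>0 'k) \<Rightarrow> ('g word \<Rightarrow>\<^sub>0 'k) set" where
  "coset x = (\<lambda>i. i + x) ` I0"

lemma mem_coset: "y \<in> coset x \<longleftrightarrow> y - x \<in> I0"
  unfolding coset_def by (auto intro!: image_eqI[of _ _ "y - x"])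

lemma coset_eq: "coset x = coset y \<longleftrightarrow> x - y \<in> I0"
proof
  assume "coset x = coset y"
  moreover have "x \<in> coset x" using ideal_inD(2)[OF I0] by (simp add: mem_coset)
  ultimately show "x - y \<in> I0" by (simp add: mem_coset)
next
  assume xy: "x - y \<in> I0"
  have "z - x \<in> I0 \<longleftrightarrow> z - y \<in> I0" for z
    by (rule ideal_in_diff_cancel[OF I0]) (use ideal_in_uminus[OF I0 xy] in simp)
  then show "coset x = coset y" by (auto simp: mem_coset)
qed

lemma a_r_coset_eq: "a_r_coset (free_algebra X) I0 x = coset x"
  by (auto simp: a_r_coset_def' coset_def free_algebra_ops)

lemma Q_carrier: "carrier Q = coset ` polys0 X"
  by (auto simp: FactRing_def A_RCOSETS_def' a_r_coset_eq)

lemma Q_zero: "\<zero>\<^bsub>Q\<^esub> = coset 0"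
  by (simp add: FactRing_def coset_def)

lemma Q_add: "coset x \<oplus>\<^bsub>Q\<^esub> coset y = coset (x + y)"
proof -
  have "coset x \<oplus>\<^bsub>Q\<^esub> coset y = {a + b | a b. a \<in> coset x \<and> b \<in> coset y}"
    by (auto simp: FactRing_def set_add_def' free_algebra_ops)
  also have "\<dots> = coset (x + y)"
  proof
    show "{a + b | a b. a \<in> coset x \<and> b \<in> coset y} \<subseteq> coset (x + y)"
    proof
      fix z assume "z \<in> {a + b | a b. a \<in> coset x \<and> b \<in> coset y}"
      then obtain a b where z: "z = a + b" "a - x \<in> I0" "b - y \<in> I0" by (auto simp: mem_coset)
      have *: "z - (x + y) = (a - x) + (b - y)" by (simp add: z(1))
      show "z \<in> coset (x + y)" unfolding mem_coset * by (rule ideal_in_add[OF I0 z(2,3)])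
    qed
    show "coset (x + y) \<subseteq> {a + b | a b. a \<in> coset x \<and> b \<in> coset y}"
    proof
      fix z assume "z \<in> coset (x + y)"
      then have "z - y \<in> coset x" "y \<in> coset y" using ideal_inD(2)[OF I0] by (simp_all add: mem_coset algebra_simps)
      moreover have "z = (z - y) + y" by simp
      ultimately show "z \<in> {a + b | a b. a \<in> coset x \<and> b \<in> coset y}" by blast
    qed
  qed
  finally show ?thesis .
qed

lemma Q_mult: assumes "x \<in> polys0 X" "y \<in> polys0 X" shows "coset x \<otimes>\<^bsub>Q\<^esub> coset y = coset (x * y)"
proof -
  have "coset x \<otimes>\<^bsub>Q\<^esub> coset y = (\<Union>a\<in>coset x. \<Union>b\<in>coset y. coset (a * b))"
    by (simp add: FactRing_def rcoset_mult_def a_r_coset_eq free_algebra_ops)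
  moreover have *: "coset (a * b) = coset (x * y)" if a: "a \<in> coset x" and b: "b \<in> coset y" for a b
  proof -
    have ab: "a - x \<in> I0" "b - y \<in> I0" using a b by (simp_all add: mem_coset)
    have "a = x + (a - x)" by simp
    then have "a \<in> polys0 X" using polys0_add[OF assms(1) I0_polys0[OF ab(1)]] by simp
    then have "(a - x) * y + a * (b - y) \<in> I0"
      by (intro ideal_in_add[OF I0] ideal_inD(4)[OF I0 ab(2)] ideal_inD(5)[OF I0 ab(1)] assms)
    then show ?thesis unfolding coset_eq by (simp add: algebra_simps)
  qed
  moreover have "(\<Union>a\<in>coset x. \<Union>b\<in>coset y. coset (a * b)) = (\<Union>a\<in>coset x. \<Union>b\<in>coset y. coset (x * y))"
    by (intro SUP_cong refl *)
  moreover have "coset x \<noteq> {}" "coset y \<noteq> {}" using ideal_inD(2)[OF I0] by (auto simp: coset_def)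
  ultimately show ?thesis by simp
qed

definition \<phi> :: "('g word \<Rightarrow>\<^sub>0 'k) set \<Rightarrow> ('g word \<Rightarrow>\<^sub>0 'k) endo" where "\<phi> A = T (SOME x. x \<in> A)"

lemma \<phi>_coset: assumes "x \<in> polys0 X" shows "\<phi> (coset x) = T x"
proof -
  have "x \<in> coset x" using ideal_inD(2)[OF I0] by (simp add: mem_coset)
  then have "(SOME y. y \<in> coset x) - x \<in> I0" unfolding mem_coset[symmetric] by (rule someI)
  then have "T ((SOME y. y \<in> coset x) - x) = 0"
    using T_eq_0[OF polys0_polys[OF I0_polys0], of "(SOME y. y \<in> coset x) - x"] by simp
  then show ?thesis by (simp add: \<phi>_def T_diff)
qed

lemma quotient_transport: "ring_transport Q \<phi> (T ` polys0 X)"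
proof
  show "bij_betw \<phi> (carrier Q) (T ` polys0 X)"
    unfolding bij_betw_def
  proof
    show "inj_on \<phi> (carrier Q)"
    proof (rule inj_onI)
      fix A B assume AB: "A \<in> carrier Q" "B \<in> carrier Q" "\<phi> A = \<phi> B"
      from AB(1,2) obtain x y where xy: "A = coset x" "B = coset y" "x \<in> polys0 X" "y \<in> polys0 X"
        unfolding Q_carrier by (elim imageE)
      then have "T x = T y" using AB(3) by (simp add: \<phi>_coset)
      then show "A = B" unfolding xy(1,2) coset_eq using T_eq[OF xy(3,4)] by simp
    qed
    show "\<phi> ` carrier Q = T ` polys0 X"
      unfolding Q_carrier image_image by (rule image_cong) (simp_all add: \<phi>_coset)
  qed
  show "x \<oplus>\<^bsub>Q\<^esub> y \<in> carrier Q" if "x \<in> carrier Q" "y \<in> carrier Q" for x y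
    using that by (auto simp: Q_carrier Q_add polys0_add)
  show "x \<otimes>\<^bsub>Q\<^esub> y \<in> carrier Q" if "x \<in> carrier Q" "y \<in> carrier Q" for x y
    using that by (auto simp: Q_carrier Q_mult polys0_mult polys0_polys)
  show "\<zero>\<^bsub>Q\<^esub> \<in> carrier Q" by (auto simp: Q_carrier Q_zero polys0_0)
  show "\<phi> (x \<oplus>\<^bsub>Q\<^esub> y) = \<phi> x + \<phi> y" if "x \<in> carrier Q" "y \<in> carrier Q" for x y
    using that by (auto simp: Q_carrier Q_add polys0_add \<phi>_coset T_add)
  show "\<phi> (x \<otimes>\<^bsub>Q\<^esub> y) = \<phi> x * \<phi> y" if "x \<in> carrier Q" "y \<in> carrier Q" for x y
    using that by (auto simp: Q_carrier Q_mult polys0_mult polys0_polys \<phi>_coset T_mult)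
  show "\<phi> \<zero>\<^bsub>Q\<^esub> = 0" by (simp add: Q_zero \<phi>_coset polys0_0)
  show "- s \<in> T ` polys0 X" if s: "s \<in> T ` polys0 X" for s
  proof -
    from s obtain x where x: "s = T x" "x \<in> polys0 X" by auto
    have "- s = T (- x)" using T_diff[of 0 x] x(1) by simp
    then show ?thesis using polys0_uminus[OF x(2)] by (metis imageI)
  qed
qed

end

section \<open>The grading\<close>

fun gen_deg :: "('v, 'e) lpa_gen \<Rightarrow> int" where
  "gen_deg (Vertex v) = 0"
| "gen_deg (Edge e) = 1"
| "gen_deg (Ghost e) = - 1"

definition word_deg :: "('v, 'e) lpa_gen word \<Rightarrow> int" where
  "word_deg w = sum_list (map gen_deg (letters w))"

lemma word_deg_add: "word_deg (u + v) = word_deg u + word_deg v"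
  by (simp add: word_deg_def plus_word_def)

definition hcomp :: "int \<Rightarrow> (('v, 'e) lpa_gen word \<Rightarrow>\<^sub>0 'k::field) \<Rightarrow> (('v, 'e) lpa_gen word \<Rightarrow>\<^sub>0 'k)" where
  "hcomp n = restr (\<lambda>w. word_deg w = n)"

definition is_hom :: "int \<Rightarrow> (('v, 'e) lpa_gen word \<Rightarrow>\<^sub>0 'k::field) \<Rightarrow> bool" where
  "is_hom d p \<longleftrightarrow> (\<forall>n. hcomp n p = (if n = d then p else 0))"

lemma is_hom_0: "is_hom d 0" by (simp add: is_hom_def hcomp_def)

lemma is_hom_diff: "is_hom d p \<Longrightarrow> is_hom d q \<Longrightarrow> is_hom d (p - q)"
  by (simp add: is_hom_def hcomp_def restr_diff)

lemma is_hom_sum: "(\<And>i. i \<in> A \<Longrightarrow> is_hom d (f i)) \<Longrightarrow> is_hom d (sum f A)"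
proof (induction A rule: infinite_finite_induct)
  case (insert a A)
  then have "is_hom d (f a)" "is_hom d (sum f A)" by auto
  then show ?case using insert(1,2) by (simp add: is_hom_def hcomp_def restr_add)
qed (simp_all add: is_hom_0)

lemma is_hom_single: "word_deg w = d \<Longrightarrow> is_hom d (Poly_Mapping.single w c)"
  by (simp add: is_hom_def hcomp_def restr_single)

lemma gen_mult: "gen x * gen y = Poly_Mapping.single (Word [x, y]) 1"
  by (simp add: gen_def mult_single plus_word_def)

lemma lpa_relations_hom:
  fixes E :: "('v, 'e) pre_digraph" and r :: "('v, 'e) lpa_gen word \<Rightarrow>\<^sub>0 'k::field"
  assumes "r \<in> lpa_relations E" shows "\<exists>d. is_hom d r"
proof -
  have g: "is_hom (gen_deg x) (gen x :: ('v, 'e) lpa_gen word \<Rightarrow>\<^sub>0 'k)" for x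
    unfolding gen_def by (rule is_hom_single) (simp add: word_deg_def)
  have gg: "is_hom (gen_deg x + gen_deg y) (gen x * gen y :: ('v, 'e) lpa_gen word \<Rightarrow>\<^sub>0 'k)" for x y
    unfolding gen_mult by (rule is_hom_single) (simp add: word_deg_def)
  from assms consider
    v w where "r = gen (Vertex v) * gen (Vertex w) - (if v = w then gen (Vertex v) else 0)"
  | e where "r = gen (Vertex (tail E e)) * gen (Edge e) - gen (Edge e)"
  | e where "r = gen (Edge e) * gen (Vertex (head E e)) - gen (Edge e)"
  | e where "r = gen (Vertex (head E e)) * gen (Ghost e) - gen (Ghost e)"
  | e where "r = gen (Ghost e) * gen (Vertex (tail E e)) - gen (Ghost e)"
  | e f where "r = gen (Ghost e) * gen (Edge f) - (if e = f then gen (Vertex (head E e)) else 0)"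
  | v where "r = gen (Vertex v) - (\<Sum>e\<in>out_arcs E v. gen (Edge e) * gen (Ghost e))"
    unfolding lpa_relations_def by blast
  then show ?thesis
  proof cases
    case 1
    have "is_hom 0 (if v = w then gen (Vertex v) else 0 :: ('v, 'e) lpa_gen word \<Rightarrow>\<^sub>0 'k)" using g[of "Vertex v"] is_hom_0[of 0]
      by (cases "v = w") simp_all
    then show ?thesis using is_hom_diff gg[of "Vertex v" "Vertex w"] 1 by (intro exI[of _ 0]) auto
  next
    case 6
    have "is_hom 0 (if e = f then gen (Vertex (head E e)) else 0 :: ('v, 'e) lpa_gen word \<Rightarrow>\<^sub>0 'k)"
      using g[of "Vertex (head E e)"] is_hom_0[of 0] by (cases "e = f") simp_all
    then show ?thesis using is_hom_diff gg[of "Ghost e" "Edge f"] 6 by (intro exI[of _ 0]) auto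
  next
    case 7
    have "is_hom 0 (\<Sum>e\<in>out_arcs E v. gen (Edge e) * gen (Ghost e) :: ('v, 'e) lpa_gen word \<Rightarrow>\<^sub>0 'k)"
      by (rule is_hom_sum) (use gg[of "Edge _" "Ghost _"] in simp)
    then show ?thesis using is_hom_diff g[of "Vertex v"] 7 by (intro exI[of _ 0]) auto
  next
    case 2 then show ?thesis using is_hom_diff gg[of "Vertex (tail E e)" "Edge e"] g[of "Edge e"]
      by (intro exI[of _ 1]) auto
  next
    case 3 then show ?thesis using is_hom_diff gg[of "Edge e" "Vertex (head E e)"] g[of "Edge e"]
      by (intro exI[of _ 1]) auto
  next
    case 4 then show ?thesis using is_hom_diff gg[of "Vertex (head E e)" "Ghost e"] g[of "Ghost e"]
      by (intro exI[of _ "-1"]) auto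
  next
    case 5 then show ?thesis using is_hom_diff gg[of "Ghost e" "Vertex (tail E e)"] g[of "Ghost e"]
      by (intro exI[of _ "-1"]) auto
  qed
qed

lemma hcomp_add: "hcomp n (p + q) = hcomp n p + hcomp n q" by (simp add: hcomp_def restr_add)
lemma hcomp_diff: "hcomp n (p - q) = hcomp n p - hcomp n q" by (simp add: hcomp_def restr_diff)

lemma hcomp_single_mult:
  "hcomp n (Poly_Mapping.single w c * p) = Poly_Mapping.single w c * hcomp (n - word_deg w) p"
  by (rule additive_eqI[of "\<lambda>p. hcomp n (Poly_Mapping.single w c * p)"])
    (auto simp: hcomp_def restr_add distrib_left mult_single restr_single word_deg_add)

lemma hcomp_mult_single:
  "hcomp n (p * Poly_Mapping.single w c) = hcomp (n - word_deg w) p * Poly_Mapping.single w c"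
  by (rule additive_eqI[of "\<lambda>p. hcomp n (p * Poly_Mapping.single w c)"])
    (auto simp: hcomp_def restr_add distrib_right mult_single restr_single word_deg_add)

lemma hcomp_const_mult: "hcomp n (const c * p) = const c * hcomp n p"
  using hcomp_single_mult[of n 0 c p] by (simp add: word_deg_def zero_word_def)

lemma hcomp_polys0: "p \<in> polys0 X \<Longrightarrow> hcomp n p \<in> polys0 X"
  by (simp add: polys0_iff hcomp_def keys_restr)

context wf_digraph
begin

definition rel_ideal :: "(('a, 'b) lpa_gen word \<Rightarrow>\<^sub>0 'k::field) set" where
  "rel_ideal = algebra_ideal_generated (lpa_gens G) (lpa_relations G)"

lemma gens_polys0:
  "v \<in> verts G \<Longrightarrow> gen (Vertex v) \<in> polys0 (lpa_gens G)"
  "e \<in> arcs G \<Longrightarrow> gen (Edge e) \<in> polys0 (lpa_gens G)"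
  "e \<in> arcs G \<Longrightarrow> gen (Ghost e) \<in> polys0 (lpa_gens G)"
  by (auto intro!: gen_polys0 simp: lpa_gens_def)

lemma relations_polys0: "lpa_relations G \<subseteq> (polys0 (lpa_gens G) :: (('a, 'b) lpa_gen word \<Rightarrow>\<^sub>0 'k::field) set)"
  unfolding lpa_relations_def
  by (auto intro!: polys0_diff polys0_mult(1) polys0_sum gens_polys0 polys0_0 polys0_polys
      simp: regular_vertex_def)

lemma rel_ideal_least:
  assumes "ideal_in (polys0 (lpa_gens G)) J" "\<And>c p. p \<in> J \<Longrightarrow> const c * p \<in> J" "lpa_relations G \<subseteq> J"
  shows "rel_ideal \<subseteq> J"
  unfolding rel_ideal_def algebra_ideal_generated_def
  by (rule Inter_lower) (use assms in \<open>simp add: two_sided_ideal_free_algebra\<close>)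

lemma rel_ideal:
  "ideal_in (polys0 (lpa_gens G)) (rel_ideal :: (('a, 'b) lpa_gen word \<Rightarrow>\<^sub>0 'k::field) set)"
  "p \<in> rel_ideal \<Longrightarrow> const c * p \<in> (rel_ideal :: (('a, 'b) lpa_gen word \<Rightarrow>\<^sub>0 'k::field) set)"
  "lpa_relations G \<subseteq> (rel_ideal :: (('a, 'b) lpa_gen word \<Rightarrow>\<^sub>0 'k::field) set)"
proof -
  let ?P = "polys0 (lpa_gens G) :: (('a, 'b) lpa_gen word \<Rightarrow>\<^sub>0 'k::field) set"
  let ?J = "rel_ideal :: (('a, 'b) lpa_gen word \<Rightarrow>\<^sub>0 'k::field) set"
  define F where "F = {I. ideal_in ?P I \<and> (\<forall>c. \<forall>p\<in>I. const c * p \<in> I) \<and> lpa_relations G \<subseteq> I}"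
  have J: "?J = \<Inter>F"
    by (simp add: rel_ideal_def algebra_ideal_generated_def F_def two_sided_ideal_free_algebra)
  have P: "?P \<in> F" unfolding F_def
    using relations_polys0 by (auto simp: ideal_in_def polys0_0 polys0_diff polys0_mult polys0_polys const_polys)
  have mem: "I \<in> F \<Longrightarrow> ideal_in ?P I" for I by (simp add: F_def)
  show "ideal_in ?P ?J" unfolding J ideal_in_def
    using P mem by (auto dest: ideal_inD(2,3,4,5))
  show "p \<in> ?J \<Longrightarrow> const c * p \<in> ?J" unfolding J by (auto simp: F_def)
  show "lpa_relations G \<subseteq> ?J" unfolding J by (auto simp: F_def)
qed

text \<open>The elements of the ideal all of whose components are in it form an ideal that contains the relations,
  since these are homogeneous.\<close>

lemma hcomp_rel_ideal:
  fixes p :: "('a, 'b) lpa_gen word \<Rightarrow>\<^sub>0 'k::field"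
  assumes "p \<in> rel_ideal" shows "hcomp n p \<in> rel_ideal"
proof -
  let ?P = "polys0 (lpa_gens G) :: (('a, 'b) lpa_gen word \<Rightarrow>\<^sub>0 'k::field) set"
  note RI = rel_ideal(1)[where 'k = 'k]
  define H where "H = {p \<in> ?P. \<forall>n. hcomp n p \<in> rel_ideal}"
  have "rel_ideal \<subseteq> H"
  proof (rule rel_ideal_least)
    show "ideal_in ?P H" unfolding ideal_in_def
    proof (intro conjI ballI)
      show "H \<subseteq> ?P" by (auto simp: H_def)
      show "0 \<in> H" using ideal_inD(2)[OF RI] by (simp add: H_def polys0_0 hcomp_def)
      show "x - y \<in> H" if "x \<in> H" "y \<in> H" for x y
        using that by (auto simp: H_def polys0_diff hcomp_diff intro: ideal_inD(3)[OF RI])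
      fix x s assume x: "x \<in> H" and s: "s \<in> ?P"
      \<comment> \<open>Multiplication by a single word shifts the degree, so products with \<open>s\<close> are treated word by word.\<close>
      have sing: "Poly_Mapping.single w (Poly_Mapping.lookup s w) \<in> ?P" if "w \<in> Poly_Mapping.keys s" for w
      proof -
        have "letters w \<noteq> []" "set (letters w) \<subseteq> lpa_gens G" using s that by (auto simp: polys0_iff)
        from single_polys0[OF this] show ?thesis by simp
      qed
      have "hcomp n (s * x) \<in> rel_ideal" for n
      proof -
        have "hcomp n (s * x) = (\<Sum>w\<in>Poly_Mapping.keys s. hcomp n (Poly_Mapping.single w (Poly_Mapping.lookup s w) * x))"
          using additive_sum[of "\<lambda>y. hcomp n (y * x)" "\<lambda>w. Poly_Mapping.single w (Poly_Mapping.lookup s w)" "Poly_Mapping.keys s"]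
          by (simp add: sum_singles distrib_right hcomp_add)
        also have "\<dots> \<in> rel_ideal" unfolding hcomp_single_mult
          by (rule ideal_in_sum[OF RI], rule ideal_inD(4)[OF RI]) (use x sing in \<open>auto simp: H_def\<close>)
        finally show ?thesis .
      qed
      then show "s * x \<in> H" using x s by (simp add: H_def polys0_mult polys0_polys)
      have "hcomp n (x * s) \<in> rel_ideal" for n
      proof -
        have "hcomp n (x * s) = (\<Sum>w\<in>Poly_Mapping.keys s. hcomp n (x * Poly_Mapping.single w (Poly_Mapping.lookup s w)))"
          using additive_sum[of "\<lambda>y. hcomp n (x * y)" "\<lambda>w. Poly_Mapping.single w (Poly_Mapping.lookup s w)" "Poly_Mapping.keys s"]
          by (simp add: sum_singles distrib_left hcomp_add)
        also have "\<dots> \<in> rel_ideal" unfolding hcomp_mult_single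
          by (rule ideal_in_sum[OF RI], rule ideal_inD(5)[OF RI]) (use x sing in \<open>auto simp: H_def\<close>)
        finally show ?thesis .
      qed
      then show "x * s \<in> H" using x s by (simp add: H_def polys0_mult polys0_polys)
    qed
    show "const c * p \<in> H" if "p \<in> H" for c p
      using that rel_ideal(2) by (auto simp: H_def hcomp_const_mult polys0_mult const_polys)
    show "lpa_relations G \<subseteq> H"
    proof
      fix r :: "('a, 'b) lpa_gen word \<Rightarrow>\<^sub>0 'k" assume r: "r \<in> lpa_relations G"
      from lpa_relations_hom[OF r] obtain d where "is_hom d r" ..
      then have "hcomp n r \<in> rel_ideal" for n
        using r rel_ideal(3) ideal_inD(2)[OF RI] by (auto simp: is_hom_def)
      then show "r \<in> H" using r relations_polys0 by (auto simp: H_def)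
    qed
  qed
  then show ?thesis using assms by (auto simp: H_def)
qed

end

section \<open>Leavitt path algebras\<close>

locale lpa_endomorphisms = wf_digraph E + algebra_quotient "lpa_gens E" "wf_digraph.rel_ideal E" \<pi>
  for E :: "('v, 'e) pre_digraph" and \<pi> :: "(('v, 'e) lpa_gen word \<Rightarrow>\<^sub>0 'k::field) \<Rightarrow> (('v, 'e) lpa_gen word \<Rightarrow>\<^sub>0 'k)"
begin

abbreviation "X \<equiv> lpa_gens E"

definition LV :: "'v \<Rightarrow> (('v, 'e) lpa_gen word \<Rightarrow>\<^sub>0 'k) endo" where "LV v = T (gen (Vertex v))"
definition LE :: "'e \<Rightarrow> (('v, 'e) lpa_gen word \<Rightarrow>\<^sub>0 'k) endo" where "LE e = T (gen (Edge e))"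
definition LG :: "'e \<Rightarrow> (('v, 'e) lpa_gen word \<Rightarrow>\<^sub>0 'k) endo" where "LG e = T (gen (Ghost e))"
definition Lsc :: "'k \<Rightarrow> (('v, 'e) lpa_gen word \<Rightarrow>\<^sub>0 'k) endo" where "Lsc k = T (const k)"

lemma gens_X [simp]: "v \<in> verts E \<Longrightarrow> Vertex v \<in> X" "e \<in> arcs E \<Longrightarrow> Edge e \<in> X" "e \<in> arcs E \<Longrightarrow> Ghost e \<in> X"
  by (auto simp: lpa_gens_def)

lemma gen_polys: "x \<in> X \<Longrightarrow> gen x \<in> polys X" by (rule polys0_polys[OF gen_polys0])

lemma T_gen_mult: "x \<in> X \<Longrightarrow> y \<in> X \<Longrightarrow> T (gen x * gen y) = T (gen x) * T (gen y)"
  by (rule T_mult[OF gen_polys gen_polys])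

lemma T_relation: assumes "r \<in> lpa_relations E" shows "T r = 0"
  using T_eq_0[OF polys0_polys, of r] relations_polys0 rel_ideal(3) assms by blast

lemma T_relation_eq: "x - y \<in> lpa_relations E \<Longrightarrow> T x = T y"
  using T_relation[of "x - y"] by (simp add: T_diff)

lemma Lsc_mult: "p \<in> polys X \<Longrightarrow> Lsc k * T p = T (const k * p)" "p \<in> polys X \<Longrightarrow> T p * Lsc k = T (const k * p)"
proof -
  assume p: "p \<in> polys X"
  show "Lsc k * T p = T (const k * p)" unfolding Lsc_def by (rule T_mult[OF const_polys p, symmetric])
  show "T p * Lsc k = T (const k * p)"
    unfolding Lsc_def const_central by (rule T_mult[OF p const_polys, symmetric])
qed

sublocale cohn_family E LV LE LG Lsc
proof
  show "LV v * LV w = (if v = w then LV v else 0)" if "v \<in> verts E" "w \<in> verts E" for v w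
  proof -
    have "gen (Vertex v) * gen (Vertex w) - (if v = w then gen (Vertex v) else 0) \<in> lpa_relations E"
      unfolding lpa_relations_def using that by blast
    from T_relation_eq[OF this] show ?thesis
      unfolding LV_def by (cases "v = w") (simp_all add: T_gen_mult[symmetric] that)
  qed
  show "LV (tail E e) * LE e = LE e" if "e \<in> arcs E" for e
  proof -
    have "gen (Vertex (tail E e)) * gen (Edge e) - gen (Edge e) \<in> lpa_relations E"
      unfolding lpa_relations_def using that by blast
    from T_relation_eq[OF this] show ?thesis by (simp add: LV_def LE_def T_gen_mult[symmetric] that)
  qed
  show "LE e * LV (head E e) = LE e" if "e \<in> arcs E" for e
  proof -
    have "gen (Edge e) * gen (Vertex (head E e)) - gen (Edge e) \<in> lpa_relations E"
      unfolding lpa_relations_def using that by blast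
    from T_relation_eq[OF this] show ?thesis by (simp add: LV_def LE_def T_gen_mult[symmetric] that)
  qed
  show "LV (head E e) * LG e = LG e" if "e \<in> arcs E" for e
  proof -
    have "gen (Vertex (head E e)) * gen (Ghost e) - gen (Ghost e) \<in> lpa_relations E"
      unfolding lpa_relations_def using that by blast
    from T_relation_eq[OF this] show ?thesis by (simp add: LV_def LG_def T_gen_mult[symmetric] that)
  qed
  show "LG e * LV (tail E e) = LG e" if "e \<in> arcs E" for e
  proof -
    have "gen (Ghost e) * gen (Vertex (tail E e)) - gen (Ghost e) \<in> lpa_relations E"
      unfolding lpa_relations_def using that by blast
    from T_relation_eq[OF this] show ?thesis by (simp add: LV_def LG_def T_gen_mult[symmetric] that)
  qed
  show "LG e * LE f = (if e = f then LV (head E e) else 0)" if "e \<in> arcs E" "f \<in> arcs E" for e f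
  proof -
    have "gen (Ghost e) * gen (Edge f) - (if e = f then gen (Vertex (head E e)) else 0) \<in> lpa_relations E"
      unfolding lpa_relations_def using that by blast
    from T_relation_eq[OF this] show ?thesis
      by (cases "e = f") (simp_all add: LV_def LG_def LE_def T_gen_mult[symmetric] that)
  qed
  show "Lsc (a + b) = Lsc a + Lsc b" for a b by (simp add: Lsc_def single_add T_add)
  show "Lsc (a * b) = Lsc a * Lsc b" for a b
    by (simp add: Lsc_def T_mult[symmetric] const_polys mult_single)
  show "Lsc 1 * LV v = LV v" if "v \<in> verts E" for v
    using that by (simp add: LV_def Lsc_mult gen_polys)
  show "Lsc a * LV v = LV v * Lsc a" if "v \<in> verts E" for a v
    using that by (simp add: LV_def Lsc_mult gen_polys)
  show "Lsc a * LE e = LE e * Lsc a" if "e \<in> arcs E" for a e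
    using that by (simp add: LE_def Lsc_mult gen_polys)
  show "Lsc a * LG e = LG e * Lsc a" if "e \<in> arcs E" for a e
    using that by (simp add: LG_def Lsc_mult gen_polys)
qed

primrec path_word :: "'v \<Rightarrow> 'e list \<Rightarrow> ('v, 'e) lpa_gen list" where
  "path_word u [] = [Vertex u]"
| "path_word u (e # p) = Edge e # path_word (head E e) p"

primrec ghost_word :: "'v \<Rightarrow> 'e list \<Rightarrow> ('v, 'e) lpa_gen list" where
  "ghost_word u [] = [Vertex u]"
| "ghost_word u (e # p) = ghost_word (head E e) p @ [Ghost e]"

abbreviation mono :: "('v, 'e) lpa_gen list \<Rightarrow> (('v, 'e) lpa_gen word \<Rightarrow>\<^sub>0 'k)" where
  "mono l \<equiv> Poly_Mapping.single (Word l) 1"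

lemma mono_mult: "Poly_Mapping.single (Word l) a * Poly_Mapping.single (Word l') b = Poly_Mapping.single (Word (l @ l')) (a * b)"
  by (simp add: mult_single plus_word_def)

lemma word_of_path:
  assumes "awalk u p v"
  shows "set (path_word u p) \<subseteq> X" "set (ghost_word u p) \<subseteq> X"
    "T (mono (path_word u p)) = pth u p" "T (mono (ghost_word u p)) = gst u p"
    "word_deg (Word (path_word u p)) = int (length p)" "word_deg (Word (ghost_word u p)) = - int (length p)"
  using assms
proof (induction p arbitrary: u)
  case Nil
  {
    case 1 then show ?case by (auto simp: awalk_Nil_iff)
  next
    case 2 then show ?case by (auto simp: awalk_Nil_iff)
  next
    case 3 show ?case by (simp add: LV_def[symmetric] gen_def[symmetric])
  next
    case 4 show ?case by (simp add: LV_def[symmetric] gen_def[symmetric])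
  next
    case 5 then show ?case by (simp add: word_deg_def)
  next
    case 6 then show ?case by (simp add: word_deg_def)
  }
next
  case (Cons e p)
  {
    case 1 then show ?case using Cons.IH(1)[of "head E e"] by (simp add: awalk_Cons_iff)
  next
    case 2 then show ?case using Cons.IH(2)[of "head E e"] by (simp add: awalk_Cons_iff)
  next
    case 3
    then have e: "e \<in> arcs E" "awalk (head E e) p v" by (simp_all add: awalk_Cons_iff)
    have "mono (path_word u (e # p)) = gen (Edge e) * mono (path_word (head E e) p)"
      by (simp add: gen_def mono_mult)
    then show ?case
      using T_mult[OF gen_polys single_polys, of "Edge e" "path_word (head E e) p" 1] e
        Cons.IH(1)[OF e(2)] Cons.IH(3)[OF e(2)] by (simp add: LE_def[symmetric])
  next
    case 4
    then have e: "e \<in> arcs E" "awalk (head E e) p v" by (simp_all add: awalk_Cons_iff)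
    have "mono (ghost_word u (e # p)) = mono (ghost_word (head E e) p) * gen (Ghost e)"
      by (simp add: gen_def mono_mult)
    then show ?case
      using T_mult[OF single_polys gen_polys, of "ghost_word (head E e) p" "Ghost e" 1] e
        Cons.IH(2)[OF e(2)] Cons.IH(4)[OF e(2)] by (simp add: LG_def[symmetric])
  next
    case 5 then show ?case using Cons.IH(5)[of "head E e"] by (simp add: awalk_Cons_iff word_deg_def)
  next
    case 6 then show ?case using Cons.IH(6)[of "head E e"] by (simp add: awalk_Cons_iff word_deg_def)
  }
qed

lemma hmonomial_word:
  assumes "x \<in> hmonomials n"
  shows "\<exists>l k. l \<noteq> [] \<and> set l \<subseteq> X \<and> word_deg (Word l) = n \<and> x = T (Poly_Mapping.single (Word l) k)"
proof -
  from assms obtain k u p v q w where x: "x = Lsc k * (pth u p * gst v q)" and p: "awalk u p w" and q: "awalk v q w"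
    and n: "n = int (length p) - int (length q)" unfolding hmonomials_def by auto
  note wp = word_of_path[OF p] and wq = word_of_path[OF q]
  have m: "mono (path_word u p) \<in> polys X" "mono (ghost_word v q) \<in> polys X"
    using single_polys[OF wp(1)] single_polys[OF wq(2)] .
  have "x = T (const k * (mono (path_word u p) * mono (ghost_word v q)))"
    unfolding x wp(3)[symmetric] wq(4)[symmetric] T_mult[OF m, symmetric]
    by (rule Lsc_mult(1)[OF polys_mult[OF m]])
  also have "const k * (mono (path_word u p) * mono (ghost_word v q)) =
      Poly_Mapping.single (Word (path_word u p @ ghost_word v q)) k"
    by (simp add: mono_mult mult_single plus_word_def zero_word_def)
  finally have "x = T (Poly_Mapping.single (Word (path_word u p @ ghost_word v q)) k)" .
  moreover have "path_word u p @ ghost_word v q \<noteq> []" by (cases p) auto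
  moreover have "word_deg (Word (path_word u p @ ghost_word v q)) = n"
    using word_deg_add[of "Word (path_word u p)" "Word (ghost_word v q)"] wp(5) wq(6) n by (simp add: plus_word_def)
  moreover have "set (path_word u p @ ghost_word v q) \<subseteq> X" using wp(1) wq(2) by simp
  ultimately show ?thesis by blast
qed

lemma T_gen_S: assumes "x \<in> X" shows "T (gen x) \<in> S"
proof (cases x)
  case (Vertex v)
  then have "v \<in> verts E" using assms by (auto simp: lpa_gens_def)
  then show ?thesis unfolding Vertex LV_def[symmetric] by (rule V_S)
next
  case (Edge e)
  then have "e \<in> arcs E" using assms by (auto simp: lpa_gens_def)
  then show ?thesis unfolding Edge LE_def[symmetric] by (rule Ed_S)
next
  case (Ghost e)
  then have "e \<in> arcs E" using assms by (auto simp: lpa_gens_def)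
  then show ?thesis unfolding Ghost LG_def[symmetric] by (rule Gh_S)
qed

lemma T_word_S: "l \<noteq> [] \<Longrightarrow> set l \<subseteq> X \<Longrightarrow> T (mono l) \<in> S"
proof (induction l)
  case (Cons a l)
  then have a: "a \<in> X" "set l \<subseteq> X" by auto
  show ?case
  proof (cases "l = []")
    case True
    then show ?thesis using T_gen_S[OF a(1)] by (simp add: gen_def)
  next
    case False
    have "mono (a # l) = gen a * mono l" by (simp add: gen_def mono_mult)
    then have "T (mono (a # l)) = T (gen a) * T (mono l)" using T_mult[OF gen_polys[OF a(1)] single_polys[OF a(2)]] by simp
    then show ?thesis using S_mult[OF T_gen_S[OF a(1)] Cons.IH[OF False a(2)]] by simp
  qed
qed simp

text \<open>The image of \<open>T\<close> is a subring closed under scalars and generated by the images of the letters.\<close>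

lemma S_eq: "S = T ` polys0 X"
proof
  show "S \<subseteq> T ` polys0 X"
    unfolding S_def
  proof (rule aspan_closed_set)
    show "0 \<in> T ` polys0 X" using polys0_0 T_0 by (metis imageI)
    show "x + y \<in> T ` polys0 X" if xy: "x \<in> T ` polys0 X" "y \<in> T ` polys0 X" for x y
    proof -
      from xy obtain p q where "x = T p" "y = T q" "p \<in> polys0 X" "q \<in> polys0 X" by auto
      then have "x + y = T (p + q)" "p + q \<in> polys0 X" using T_add polys0_add by auto
      then show ?thesis by (metis imageI)
    qed
    show "monomials \<subseteq> T ` polys0 X"
    proof
      fix x assume "x \<in> monomials"
      then obtain n where "x \<in> hmonomials n" unfolding monomials_UN by auto
      from hmonomial_word[OF this] obtain l k where "l \<noteq> []" "set l \<subseteq> X" "x = T (Poly_Mapping.single (Word l) k)" by auto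
      then show "x \<in> T ` polys0 X" using single_polys0[of l X k] by (metis imageI)
    qed
  qed
  show "T ` polys0 X \<subseteq> S"
  proof (rule image_subsetI)
    fix p :: "('v, 'e) lpa_gen word \<Rightarrow>\<^sub>0 'k" assume p: "p \<in> polys0 X"
    have "T (Poly_Mapping.single w (Poly_Mapping.lookup p w)) \<in> S" if w: "w \<in> Poly_Mapping.keys p" for w
    proof -
      obtain l where l: "w = Word l" by (cases w)
      have l': "l \<noteq> []" "set l \<subseteq> X" using bspec[OF p[unfolded polys0_iff] w] by (simp_all add: l)
      have "Poly_Mapping.single w (Poly_Mapping.lookup p w) = const (Poly_Mapping.lookup p w) * mono l"
        by (simp add: l mult_single zero_word_def plus_word_def)
      then have "T (Poly_Mapping.single w (Poly_Mapping.lookup p w)) = Lsc (Poly_Mapping.lookup p w) * T (mono l)"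
        using Lsc_mult(1)[OF single_polys[OF l'(2)]] by simp
      then show ?thesis using sc_S[OF T_word_S[OF l']] by simp
    qed
    then have "(\<Sum>w\<in>Poly_Mapping.keys p. T (Poly_Mapping.single w (Poly_Mapping.lookup p w))) \<in> S" by (rule S_sum)
    then show "T p \<in> S" unfolding T_sum[symmetric] sum_singles .
  qed
qed

text \<open>Well defined by \<open>hcomp_rel_ideal\<close>, whichever preimage is chosen.\<close>

definition Lcomp :: "int \<Rightarrow> (('v, 'e) lpa_gen word \<Rightarrow>\<^sub>0 'k) endo \<Rightarrow> (('v, 'e) lpa_gen word \<Rightarrow>\<^sub>0 'k) endo" where
  "Lcomp n y = T (hcomp n (SOME x. x \<in> polys0 X \<and> T x = y))"

lemma Lcomp_T: assumes "x \<in> polys0 X" shows "Lcomp n (T x) = T (hcomp n x)"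
proof -
  define y where "y = (SOME y. y \<in> polys0 X \<and> T y = T x)"
  have y: "y \<in> polys0 X" "T y = T x" using someI[of "\<lambda>y. y \<in> polys0 X \<and> T y = T x" x] assms by (simp_all add: y_def)
  then have "y - x \<in> rel_ideal" using T_eq[OF y(1) assms] by simp
  then have "hcomp n y - hcomp n x \<in> rel_ideal" unfolding hcomp_diff[symmetric] by (rule hcomp_rel_ideal)
  then have "T (hcomp n y) = T (hcomp n x)"
    using T_eq[OF hcomp_polys0[OF y(1)] hcomp_polys0[OF assms]] by simp
  then show ?thesis by (simp add: Lcomp_def y_def)
qed

sublocale cohn_transport E LV LE LG Lsc Lcomp Q \<phi>
proof -
  have "graded_cohn_family_axioms E LV LE LG Lsc Lcomp"
  proof
    show "Lcomp n (x + y) = Lcomp n x + Lcomp n y" if xy: "x \<in> S" "y \<in> S" for x y n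
    proof -
      from xy obtain p q where pq: "x = T p" "y = T q" "p \<in> polys0 X" "q \<in> polys0 X" unfolding S_eq by auto
      show ?thesis
        using Lcomp_T[OF polys0_add[OF pq(3,4)], of n] Lcomp_T[OF pq(3), of n] Lcomp_T[OF pq(4), of n]
        by (simp add: pq(1,2) hcomp_add T_add)
    qed
    show "Lcomp n x = (if n = m then x else 0)" if "x \<in> hmonomials m" for x m n
    proof -
      from hmonomial_word[OF that] obtain l k where l: "l \<noteq> []" "set l \<subseteq> X" "word_deg (Word l) = m"
        "x = T (Poly_Mapping.single (Word l) k)" by auto
      show ?thesis using Lcomp_T[OF single_polys0[OF l(1,2)]] l(3,4) by (simp add: hcomp_def restr_single)
    qed
  qed
  then interpret graded_cohn_family E LV LE LG Lsc Lcomp by (intro graded_cohn_family.intro cohn_family_axioms)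
  show "cohn_transport E LV LE LG Lsc Lcomp Q \<phi>"
    by (intro cohn_transport.intro graded_cohn_family_axioms) (unfold S_eq, rule quotient_transport)
qed

end

theorem theorem3p2:
  fixes E :: "('v, 'e) pre_digraph"
    and L :: "(('v, 'e) lpa_gen word \<Rightarrow>\<^sub>0 'k::field) set ring"
    and Is Js :: "(('v, 'e) lpa_gen word \<Rightarrow>\<^sub>0 'k) set set list"
  assumes "wf_digraph E" and "verts E \<noteq> {}"
    and "L = leavitt_path_algebra TYPE('k) E"
    and "length Is \<ge> 1" and "powers_of_distinct_primes L Is" and "irredundant_product L Is"
    and "length Js \<ge> 1" and "powers_of_distinct_primes L Js" and "irredundant_product L Js"
    and "ideal_list_prod L Is = ideal_list_prod L Js"
  shows "length Is = length Js \<and>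
    (\<exists>\<sigma>. \<sigma> permutes {..<length Is} \<and> (\<forall>i<length Is. Is ! i = Js ! \<sigma> i))"
proof -
  interpret wf_digraph E by fact
  let ?I = "rel_ideal :: (('v, 'e) lpa_gen word \<Rightarrow>\<^sub>0 'k) set"
  note RI = rel_ideal[where 'k = 'k]
  interpret vs: vector_space "\<lambda>c (p :: ('v, 'e) lpa_gen word \<Rightarrow>\<^sub>0 'k). const c * p"
    by (rule const_vector_space)
  have "vs.subspace ?I"
    unfolding vs.subspace_def using RI(2) ideal_inD(2)[OF RI(1)] ideal_in_add[OF RI(1)] by blast
  from vs.projection_along_subspace[OF this] obtain \<pi> where
    \<pi>: "\<forall>x y. \<pi> (x + y) = \<pi> x + \<pi> y" "\<forall>x. \<pi> x = 0 \<longleftrightarrow> x \<in> ?I" "\<forall>x. x - \<pi> x \<in> ?I" by auto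
  interpret lpa_endomorphisms E \<pi>
    by unfold_locales (use \<pi> RI(1,2) in auto)
  have L: "L = Q" by (simp add: assms(3) leavitt_path_algebra_def rel_ideal_def)
  show ?thesis using unique_prime_power_factors assms(5,6,8-10) unfolding L by blast
qed

end
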